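(* Let $M,\rho,\mu,\sigma,T\in(0,\infty)$ with $\mu>\rho$, and let $B=(B_t)_{t\ge0}$ be a standard one-dimensional Brownian motion. Let $\bar S_0,\bar S_1$ be the solutions of $$d\bar S_0=\rho\,\bar S_0\,dt,\quad \bar S_0(0)=1,\qquad\qquad d\bar S_1=\mu\,\bar S_1\,dt+\sigma\,\bar S_1\,dB_t\ \text{(Itô)},\quad \bar S_1(0)=1 .$$ Define three total wealth processes on $[0,T]$, each of the form $S_0(t)+S_1(t)$: - $S^{(\mathrm i)}$: $dS_0=\rho S_0\,dt$, $S_0(0)=0$, and $dS_1=\mu S_1\,dt+\sigma S_1\,dB_t$ (Itô), $S_1(0)=M$; - $S^{(\mathrm{sk})}$: $dS_0=\rho S_0\,dt$, $S_0(0)=M\,\mathbf 1\{\bar S_1(T)\le\bar S_0(T)\}$, and $S_1$ is the solution of the Skorokhod equation $\delta S_1=\mu S_1\,dt+\sigma S_1\,\delta B_t$, $S_1(0)=M\,\mathbf 1\{\bar S_1(T)>\bar S_0(T)\}$; - $S^{(\mathrm{rs})}$: $dS_0=\rho S_0\,dt$, $S_0(0)=M\,\mathbf 1\{\bar S_1(T)\le\bar S_0(T)\}$, and $S_1$ is the solution of the Russo-Vallois forward equation $d^-S_1=\mu S_1\,dt+\sigma S_1\,d^-B_t$, $S_1(0)=M\,\mathbf 1\{\bar S_1(T)>\bar S_0(T)\}$. Then $$\mathbb E[S^{(\mathrm{sk})}(T)]<\mathbb E[S^{(\mathrm i)}(T)]<\mathbb E[S^{(\mathrm{rs})}(T)]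.$$
   Context: $\mathbf 1\{A\}$ is the indicator of the event $A$. Skorokhod integral: the extension of the Itô integral to not necessarily adapted integrands given by the adjoint $\delta$ of the Malliavin derivative $D$, i.e. $\int_0^T u_s\,\delta B_s=\delta(u)$ is characterized by $\mathbb E[F\,\delta(u)]=\mathbb E[\int_0^T D_sF\,u_s\,ds]$ for all $F\in\mathbb D^{1,2}$, and $\int_0^t u_s\,\delta B_s=\delta(u\mathbf 1_{[0,t]})$. The Skorokhod equation means $S_1(t)=S_1(0)+\mu\int_0^tS_1(s)\,ds+\sigma\int_0^tS_1(s)\,\delta B_s$. Its solution, obtained by Malliavin calculus, is $S_1(t)=S_1(0)\diamond\exp\{(\mu-\sigma^2/2)t+\sigma B_t\}$, where $\diamond$ is the Wick product (determined on multiple Wiener-Itô integrals by $I_n(f)\diamond I_m(g)=I_{n+m}(f\,\widehat\otimes\,g)$, with $\widehat\otimes$ the symmetrized tensor product, and extended bilinearly to chaos expansions). Russo-Vallois forward integral: $\int_0^t\varphi(s)\,d^-B_s=\lim_{\varepsilon\to0^+}\int_0^t\varphi(s)\frac{B_{s+\varepsilon}-B_s}{\varepsilon}\,ds$ (limit in probability). The forward equation means $S_1(t)=S_1(0)+\mu\int_0^tS_1(s)\,ds+\sigma\int_0^tS_1(s)\,d^-B_s$. Its solution, obtained by the rules of Itô calculus (which the forward integral preserves), is $S_1(t)=S_1(0)\exp\{(\mu-\sigma^2/2)t+\sigma B_t\}$. *)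

theory Defs
  imports "HOL-Probability.Probability"
begin

section \<open>Brownian motion\<close>

definition brownian_motion :: "'a measure \<Rightarrow> (real \<Rightarrow> 'a \<Rightarrow> real) \<Rightarrow> bool" where
  "brownian_motion P B \<longleftrightarrow>
     (\<forall>t\<ge>0. B t \<in> borel_measurable P) \<and>
     (\<forall>\<omega>\<in>space P. B 0 \<omega> = 0) \<and>
     (\<forall>\<omega>\<in>space P. continuous_on {0..} (\<lambda>t. B t \<omega>)) \<and>
     (\<forall>s t. 0 \<le> s \<and> s < t \<longrightarrow>
        distributed P lborel (\<lambda>\<omega>. B t \<omega> - B s \<omega>) (normal_density 0 (sqrt (t - s)))) \<and>
     (\<forall>n p. 0 \<le> p 0 \<and> (\<forall>i<n. p i \<le> p (Suc i)) \<longrightarrow>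
        prob_space.indep_vars P (\<lambda>_. borel) (\<lambda>i \<omega>. B (p (Suc i)) \<omega> - B (p i) \<omega>) {..<n})"

text \<open>The natural filtration of \<open>B\<close>, augmented by the null sets. Only the space and the
  sigma-algebra of these measures matter.\<close>

definition brownian_filtration :: "'a measure \<Rightarrow> (real \<Rightarrow> 'a \<Rightarrow> real) \<Rightarrow> real \<Rightarrow> 'a measure" where
  "brownian_filtration P B t =
     sigma (space P)
       (null_sets P \<union> (\<Union>s\<in>{0..t}. {B s -` U \<inter> space P | U. U \<in> sets borel}))"

text \<open>Initial enlargement by a random variable \<open>\<xi>\<close> that may anticipate \<open>B\<close>.\<close>

definition enlarged_filtration ::
    "'a measure \<Rightarrow> (real \<Rightarrow> 'a \<Rightarrow> real) \<Rightarrow> ('a \<Rightarrow> real) \<Rightarrow> real \<Rightarrow> 'a measure" where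
  "enlarged_filtration P B \<xi> t =
     sigma (space P)
       (sets (brownian_filtration P B t) \<union> {\<xi> -` U \<inter> space P | U. U \<in> sets borel})"

abbreviation leb :: "real \<Rightarrow> real measure" where
  "leb t \<equiv> restrict_space lborel {0..t}"

section \<open>Mean-square notions\<close>

definition square_integrable :: "'b measure \<Rightarrow> ('b \<Rightarrow> real) \<Rightarrow> bool" where
  "square_integrable N f \<longleftrightarrow> f \<in> borel_measurable N \<and> integrable N (\<lambda>x. (f x)\<^sup>2)"

definition tendsto_L2 :: "'b measure \<Rightarrow> (nat \<Rightarrow> 'b \<Rightarrow> real) \<Rightarrow> ('b \<Rightarrow> real) \<Rightarrow> bool" where
  "tendsto_L2 N f g \<longleftrightarrow> (\<lambda>k. \<integral>\<^sup>+ x. ennreal ((f k x - g x)\<^sup>2) \<partial>N) \<longlonglongrightarrow> 0"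

section \<open>Ito integral\<close>

text \<open>The triple \<open>n\<close>, \<open>p\<close>, \<open>\<xi>\<close> encodes the simple process
  \<open>\<Sum>i<n. \<xi> i * indicator {p i<..p (Suc i)}\<close> on \<open>[0, t]\<close>, with bounded adapted coefficients.\<close>

definition simple_integrand ::
    "'a measure \<Rightarrow> (real \<Rightarrow> 'a \<Rightarrow> real) \<Rightarrow> real \<Rightarrow> nat \<Rightarrow> (nat \<Rightarrow> real) \<Rightarrow> (nat \<Rightarrow> 'a \<Rightarrow> real) \<Rightarrow> bool" where
  "simple_integrand P B t n p \<xi> \<longleftrightarrow>
     0 \<le> p 0 \<and> (\<forall>i<n. p i \<le> p (Suc i)) \<and> p n \<le> t \<and>
     (\<forall>i<n. \<xi> i \<in> borel_measurable (brownian_filtration P B (p i)) \<and>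
            (\<exists>C. \<forall>\<omega>\<in>space P. \<bar>\<xi> i \<omega>\<bar> \<le> C))"

definition simple_process ::
    "nat \<Rightarrow> (nat \<Rightarrow> real) \<Rightarrow> (nat \<Rightarrow> 'a \<Rightarrow> real) \<Rightarrow> real \<Rightarrow> 'a \<Rightarrow> real" where
  "simple_process n p \<xi> s \<omega> = (\<Sum>i<n. \<xi> i \<omega> * indicator {p i<..p (Suc i)} s)"

definition simple_integral ::
    "(real \<Rightarrow> 'a \<Rightarrow> real) \<Rightarrow> nat \<Rightarrow> (nat \<Rightarrow> real) \<Rightarrow> (nat \<Rightarrow> 'a \<Rightarrow> real) \<Rightarrow> 'a \<Rightarrow> real" where
  "simple_integral B n p \<xi> \<omega> = (\<Sum>i<n. \<xi> i \<omega> * (B (p (Suc i)) \<omega> - B (p i) \<omega>))"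

text \<open>\<open>has_ito_integral P B u t I\<close>: the process \<open>u\<close> is adapted and square integrable on
  \<open>[0, t]\<close>, and \<open>I\<close> is a version of its Ito integral over \<open>[0, t]\<close>.\<close>

definition has_ito_integral ::
    "'a measure \<Rightarrow> (real \<Rightarrow> 'a \<Rightarrow> real) \<Rightarrow> (real \<Rightarrow> 'a \<Rightarrow> real) \<Rightarrow> real \<Rightarrow> ('a \<Rightarrow> real) \<Rightarrow> bool" where
  "has_ito_integral P B u t I \<longleftrightarrow>
     (\<forall>s\<in>{0..t}. u s \<in> borel_measurable (brownian_filtration P B s)) \<and>
     square_integrable (leb t \<Otimes>\<^sub>M P) (\<lambda>(s, \<omega>). u s \<omega>) \<and>
     square_integrable P I \<and>
     (\<exists>n p \<xi>.
        (\<forall>k. simple_integrand P B t (n k) (p k) (\<xi> k)) \<and>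
        tendsto_L2 (leb t \<Otimes>\<^sub>M P)
          (\<lambda>k (s, \<omega>). simple_process (n k) (p k) (\<xi> k) s \<omega>) (\<lambda>(s, \<omega>). u s \<omega>) \<and>
        tendsto_L2 P (\<lambda>k. simple_integral B (n k) (p k) (\<xi> k)) I)"

section \<open>Malliavin derivative and Skorokhod integral\<close>

definition partial_derivative :: "nat \<Rightarrow> ((nat \<Rightarrow> real) \<Rightarrow> real) \<Rightarrow> (nat \<Rightarrow> real) \<Rightarrow> real" where
  "partial_derivative i f x = deriv (\<lambda>y. f (x(i := y))) (x i)"

text \<open>Smooth functions of the first \<open>n\<close> coordinates which, together with all their partial
  derivatives, have at most polynomial growth. A list of indices below \<open>n\<close> stands for the
  corresponding iterated partial derivative.\<close>

definition smooth_poly_growth :: "nat \<Rightarrow> ((nat \<Rightarrow> real) \<Rightarrow> real) set" where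
  "smooth_poly_growth n =
     {f. (\<forall>x y. (\<forall>i<n. x i = y i) \<longrightarrow> f x = f y) \<and>
         (\<forall>js\<in>lists {..<n}. let g = foldr partial_derivative js f in
            continuous_on UNIV g \<and>
            (\<exists>C m. \<forall>x. \<bar>g x\<bar> \<le> C * (1 + (\<Sum>i<n. \<bar>x i\<bar>)) ^ m) \<and>
            (\<forall>i<n. \<forall>x. (\<lambda>y. g (x(i := y))) field_differentiable at (x i)))}"

text \<open>A smooth functional \<open>f (W(h\<^sub>0), \<dots>, W(h\<^sub>n\<^sub>-\<^sub>1))\<close> of Wiener integrals of deterministic
  square integrable functions, and its derivative \<open>\<Sum>i<n. \<partial>\<^sub>i f (W(h\<^sub>0), \<dots>, W(h\<^sub>n\<^sub>-\<^sub>1)) * h\<^sub>i\<close>.\<close>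

definition smooth_functional ::
    "'a measure \<Rightarrow> (real \<Rightarrow> 'a \<Rightarrow> real) \<Rightarrow> real \<Rightarrow> ('a \<Rightarrow> real) \<Rightarrow> (real \<Rightarrow> 'a \<Rightarrow> real) \<Rightarrow> bool" where
  "smooth_functional P B T F DF \<longleftrightarrow>
     (\<exists>n f h W.
        f \<in> smooth_poly_growth n \<and>
        (\<forall>i<n. has_ito_integral P B (\<lambda>s _. h i s) T (W i)) \<and>
        F = (\<lambda>\<omega>. f (\<lambda>i. W i \<omega>)) \<and>
        DF = (\<lambda>s \<omega>. \<Sum>i<n. partial_derivative i f (\<lambda>j. W j \<omega>) * h i s))"

text \<open>\<open>F\<close> belongs to the domain \<open>D\<^sup>1\<^sup>,\<^sup>2\<close> of the closure of the derivative on smooth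
  functionals, and \<open>DF\<close> is its Malliavin derivative.\<close>

definition has_malliavin_derivative ::
    "'a measure \<Rightarrow> (real \<Rightarrow> 'a \<Rightarrow> real) \<Rightarrow> real \<Rightarrow> ('a \<Rightarrow> real) \<Rightarrow> (real \<Rightarrow> 'a \<Rightarrow> real) \<Rightarrow> bool" where
  "has_malliavin_derivative P B T F DF \<longleftrightarrow>
     square_integrable P F \<and>
     square_integrable (leb T \<Otimes>\<^sub>M P) (\<lambda>(s, \<omega>). DF s \<omega>) \<and>
     (\<exists>G DG.
        (\<forall>k. smooth_functional P B T (G k) (DG k)) \<and>
        tendsto_L2 P G F \<and>
        tendsto_L2 (leb T \<Otimes>\<^sub>M P) (\<lambda>k (s, \<omega>). DG k s \<omega>) (\<lambda>(s, \<omega>). DF s \<omega>))"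

text \<open>The duality determines \<open>I\<close> only among random variables measurable with respect to
  \<open>B\<close> on \<open>[0, T]\<close>; the underlying probability space is allowed to carry more randomness.\<close>

definition has_skorokhod_integral ::
    "'a measure \<Rightarrow> (real \<Rightarrow> 'a \<Rightarrow> real) \<Rightarrow> real \<Rightarrow> (real \<Rightarrow> 'a \<Rightarrow> real) \<Rightarrow> ('a \<Rightarrow> real) \<Rightarrow> bool" where
  "has_skorokhod_integral P B T u I \<longleftrightarrow>
     (\<lambda>(s, \<omega>). u s \<omega>) \<in> borel_measurable (leb T \<Otimes>\<^sub>M brownian_filtration P B T) \<and>
     square_integrable (leb T \<Otimes>\<^sub>M P) (\<lambda>(s, \<omega>). u s \<omega>) \<and>
     I \<in> borel_measurable (brownian_filtration P B T) \<and>
     square_integrable P I \<and>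
     (\<forall>F DF. has_malliavin_derivative P B T F DF \<longrightarrow>
        (\<integral>\<omega>. F \<omega> * I \<omega> \<partial>P) = (\<integral>\<omega>. (\<integral>s. DF s \<omega> * u s \<omega> \<partial>leb T) \<partial>P))"

section \<open>Russo-Vallois forward integral\<close>

definition has_forward_integral ::
    "'a measure \<Rightarrow> (real \<Rightarrow> 'a \<Rightarrow> real) \<Rightarrow> (real \<Rightarrow> 'a \<Rightarrow> real) \<Rightarrow> real \<Rightarrow> ('a \<Rightarrow> real) \<Rightarrow> bool" where
  "has_forward_integral P B \<phi> t I \<longleftrightarrow>
     (\<lambda>(s, \<omega>). \<phi> s \<omega>) \<in> borel_measurable (leb t \<Otimes>\<^sub>M P) \<and>
     (AE \<omega> in P. integrable (leb t) (\<lambda>s. \<phi> s \<omega>)) \<and>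
     I \<in> borel_measurable P \<and>
     (\<forall>\<eta>>0. ((\<lambda>\<epsilon>. measure P {\<omega> \<in> space P.
          \<eta> < \<bar>(\<integral>s. \<phi> s \<omega> * ((B (s + \<epsilon>) \<omega> - B s \<omega>) / \<epsilon>) \<partial>leb t) - I \<omega>\<bar>}) \<longlongrightarrow> 0) (at_right 0))"

section \<open>Linear equations\<close>

text \<open>\<open>X(t) = X(0) + \<mu> \<integral>\<^sub>0\<^sup>t X(s) ds + \<sigma> I\<close> almost surely for every \<open>t\<close>, where \<open>J t I\<close> says that
  \<open>I\<close> is the stochastic integral of \<open>X\<close> over \<open>[0, t]\<close> in the relevant sense.\<close>

definition linear_equation ::
    "'a measure \<Rightarrow> (real \<Rightarrow> ('a \<Rightarrow> real) \<Rightarrow> bool) \<Rightarrow> real \<Rightarrow> real \<Rightarrow> real \<Rightarrow> (real \<Rightarrow> 'a \<Rightarrow> real) \<Rightarrow> bool" where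
  "linear_equation P J \<mu> \<sigma> T X \<longleftrightarrow>
     (\<forall>t\<in>{0..T}. \<exists>I. J t I \<and>
        (AE \<omega> in P. X t \<omega> = X 0 \<omega> + \<mu> * (\<integral>s. X s \<omega> \<partial>leb t) + \<sigma> * I \<omega>))"

definition ito_solution ::
    "'a measure \<Rightarrow> (real \<Rightarrow> 'a \<Rightarrow> real) \<Rightarrow> real \<Rightarrow> real \<Rightarrow> real \<Rightarrow> (real \<Rightarrow> 'a \<Rightarrow> real) \<Rightarrow> bool" where
  "ito_solution P B \<mu> \<sigma> T X \<longleftrightarrow>
     (AE \<omega> in P. continuous_on {0..T} (\<lambda>t. X t \<omega>)) \<and>
     linear_equation P (has_ito_integral P B X) \<mu> \<sigma> T X"

definition skorokhod_solution ::
    "'a measure \<Rightarrow> (real \<Rightarrow> 'a \<Rightarrow> real) \<Rightarrow> real \<Rightarrow> real \<Rightarrow> real \<Rightarrow> (real \<Rightarrow> 'a \<Rightarrow> real) \<Rightarrow> bool" where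
  "skorokhod_solution P B \<mu> \<sigma> T X \<longleftrightarrow>
     linear_equation P
       (\<lambda>t. has_skorokhod_integral P B T (\<lambda>s \<omega>. indicator {0..t} s * X s \<omega>)) \<mu> \<sigma> T X"

text \<open>The initial value may depend on the whole Brownian path, so adaptedness is required with
  respect to the filtration initially enlarged by it. The forward integral coincides with a
  semimartingale integral in that filtration, and this makes the solution unique.\<close>

definition forward_solution ::
    "'a measure \<Rightarrow> (real \<Rightarrow> 'a \<Rightarrow> real) \<Rightarrow> real \<Rightarrow> real \<Rightarrow> real \<Rightarrow> (real \<Rightarrow> 'a \<Rightarrow> real) \<Rightarrow> bool" where
  "forward_solution P B \<mu> \<sigma> T X \<longleftrightarrow>
     (AE \<omega> in P. continuous_on {0..T} (\<lambda>t. X t \<omega>)) \<and>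
     (\<forall>t\<in>{0..T}. X t \<in> borel_measurable (enlarged_filtration P B (X 0) t)) \<and>
     linear_equation P (has_forward_integral P B X) \<mu> \<sigma> T X"

definition bond_solution ::
    "'a measure \<Rightarrow> real \<Rightarrow> real \<Rightarrow> (real \<Rightarrow> 'a \<Rightarrow> real) \<Rightarrow> bool" where
  "bond_solution P \<rho> T X \<longleftrightarrow>
     (\<forall>t\<in>{0..T}. X t \<in> borel_measurable P) \<and>
     (AE \<omega> in P. \<forall>t\<in>{0..T}.
        ((\<lambda>s. X s \<omega>) has_real_derivative \<rho> * X t \<omega>) (at t within {0..T}))"

end

theory Submission
  imports Defs
begin

text \<open>The Ito and the forward equation have the same solution \<open>X(t) = X(0) * Z(t)\<close> with
  \<open>Z(t) = exp ((\<mu> - \<sigma>\<^sup>2 / 2) * t + \<sigma> * B t)\<close>, whereas the Skorokhod integral has mean zero, so that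
  every Skorokhod solution satisfies \<open>E X(T) = exp (\<mu> * T) * E X(0)\<close>. Hence the insider with the forward
  integral ends with \<open>M * max (exp (\<rho> * T)) (Z T)\<close>, while the Skorokhod insider loses the factor
  \<open>exp ((\<mu> - \<rho>) * T)\<close> on the event \<open>Z T \<le> exp (\<rho> * T)\<close>, which has positive probability.

  No stochastic calculus is needed for uniqueness. For adapted \<open>u\<close> the average
  \<open>\<integral> u s * (B (s + e) - B s) / e ds\<close> has second moment at most \<open>2 * \<integral> E (u s)\<^sup>2 ds\<close>, because increments
  over disjoint intervals are orthogonal. This bound makes Ito integrals limits of such averages,
  makes \<open>Z\<close> a solution of the forward equation, and yields uniqueness for adapted integrands by Gronwall
  and localisation. An anticipating initial value that is constant on an event \<open>A\<close> determined by \<open>B T\<close> is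
  treated by replacing the solution on \<open>A\<close> by an adapted process: before \<open>T\<close>, an event of the filtration
  that is negligible on \<open>A\<close> is negligible.\<close>

section \<open>Second moments of time integrals\<close>

text \<open>The obstacle is the forward equation. Where the initial value equals a constant, the
  enlarged filtration has the same trace as the Brownian one, so there the solution agrees at each
  time with an adapted variable; elsewhere these variables are arbitrary and need not form
  continuous paths. The adapted process is therefore rebuilt from rational times alone, which
  preserves adaptedness and allows a localisation by countably many conditions. Averages look ahead
  by their width, so the limit event at a time \<open>t < T\<close> belongs to a slightly later
  sigma-algebra, still before \<open>T\<close>. The transfer has to stop before \<open>T\<close>,
  because an event determined by \<open>B T\<close> belongs to \<open>F T\<close>; the value at
  \<open>T\<close> comes from path continuity. Second moments matter only up to a constant factor,
  which Gronwall absorbs; an upper bound therefore takes the place of the Ito isometry.\<close>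

lemma nn_square_integral_le:
  fixes f :: "'b \<Rightarrow> real"
  assumes "finite_measure M" and f[measurable]: "f \<in> borel_measurable M"
  shows "ennreal ((\<integral>x. f x \<partial>M)\<^sup>2) \<le> emeasure M (space M) * (\<integral>\<^sup>+x. ennreal ((f x)\<^sup>2) \<partial>M)"
proof -
  have "ennreal ((\<integral>x. f x \<partial>M)\<^sup>2) = (ennreal \<bar>\<integral>x. f x \<partial>M\<bar>)\<^sup>2"
    by (simp add: ennreal_power)
  \<comment> \<open>A non-integrable \<open>f\<close> has Bochner integral 0, so the bound by the
    nonnegative integral holds in both cases.\<close>
  also have "ennreal \<bar>\<integral>x. f x \<partial>M\<bar> \<le> (\<integral>\<^sup>+x. ennreal \<bar>f x\<bar> \<partial>M)"
    using integral_norm_bound_ennreal[of M f]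
    by (cases "integrable M f") (auto simp: not_integrable_integral_eq)
  then have "(ennreal \<bar>\<integral>x. f x \<partial>M\<bar>)\<^sup>2 \<le> (\<integral>\<^sup>+x. ennreal \<bar>f x\<bar> * 1 \<partial>M)\<^sup>2"
    by (simp add: power_mono)
  also have "\<dots> \<le> (\<integral>\<^sup>+x. ennreal \<bar>f x\<bar> ^ 2 \<partial>M) * (\<integral>\<^sup>+x. 1 ^ 2 \<partial>M)"
    by (rule Cauchy_Schwarz_nn_integral) auto
  also have "\<dots> = emeasure M (space M) * (\<integral>\<^sup>+x. ennreal ((f x)\<^sup>2) \<partial>M)"
    by (simp add: ennreal_power mult.commute)
  finally show ?thesis .
qed

lemma abs_mult_le_half_squares: "\<bar>a * b\<bar> \<le> 1/2 * a\<^sup>2 + 1/2 * b\<^sup>2" for a b :: real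
  using sum_squares_bound[of "\<bar>a\<bar>" "\<bar>b\<bar>"] by (simp add: abs_mult)

lemma abs_mult_le_sum_squares: "\<bar>a * b\<bar> \<le> a\<^sup>2 + b\<^sup>2" for a b :: real
  using abs_mult_le_half_squares[of a b] zero_le_power2[of a] zero_le_power2[of b] by linarith

lemma finite_measure_leb: "finite_measure (leb t)"
  by (rule finite_measureI) (cases "0 \<le> t"; simp add: emeasure_restrict_space space_restrict_space)

lemma space_leb [simp]: "space (leb t) = {0..t}"
  by (simp add: space_restrict_space)

lemma emeasure_leb_space: "0 \<le> t \<Longrightarrow> emeasure (leb t) (space (leb t)) = ennreal t"
  by (simp add: emeasure_restrict_space)

lemma borel_measurable_leb [measurable (raw)]:
  "f \<in> borel_measurable borel \<Longrightarrow> f \<in> borel_measurable (leb t)"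
  by (rule measurable_restrict_space1) simp

lemma nn_integral_leb: "(\<integral>\<^sup>+x. f x \<partial>leb t) = (\<integral>\<^sup>+x. f x * indicator {0..t} x \<partial>lborel)"
  by (rule nn_integral_restrict_space) simp

lemma nn_integral_leb_window:
  assumes "0 \<le> e"
  shows "(\<integral>\<^sup>+r. indicator {r. \<bar>s - r\<bar> < e} r \<partial>leb t) \<le> ennreal (2 * e)"
proof -
  have "(\<integral>\<^sup>+r. indicator {r. \<bar>s - r\<bar> < e} r \<partial>leb t) \<le> (\<integral>\<^sup>+r. indicator {s - e..s + e} r \<partial>lborel)"
    unfolding nn_integral_leb by (intro nn_integral_mono) (auto simp: indicator_def)
  also have "\<dots> = ennreal (2 * e)"
    using assms by simp
  finally show ?thesis .
qed

text \<open>Only pairs of times at distance less than \<open>e\<close> contribute to the second moment of the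
  time integral.\<close>

lemma (in prob_space) second_moment_time_integral:
  fixes K :: "real \<Rightarrow> 'a \<Rightarrow> real"
  assumes K[measurable]: "(\<lambda>(s, \<omega>). K s \<omega>) \<in> borel_measurable (leb t \<Otimes>\<^sub>M M)"
    and t: "0 \<le> t" and e: "0 < e"
    and orth: "\<And>s r. 0 \<le> s \<Longrightarrow> r \<le> t \<Longrightarrow> s + e \<le> r \<Longrightarrow> integrable M (\<lambda>\<omega>. (K s \<omega>)\<^sup>2) \<Longrightarrow>
        integrable M (\<lambda>\<omega>. (K r \<omega>)\<^sup>2) \<Longrightarrow> (\<integral>\<omega>. K s \<omega> * K r \<omega> \<partial>M) = 0"
  shows "(\<integral>\<^sup>+\<omega>. ennreal ((\<integral>s. K s \<omega> \<partial>leb t)\<^sup>2) \<partial>M)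
    \<le> ennreal (2 * e) * (\<integral>\<^sup>+s. (\<integral>\<^sup>+\<omega>. ennreal ((K s \<omega>)\<^sup>2) \<partial>M) \<partial>leb t)"
proof (cases "(\<integral>\<^sup>+s. (\<integral>\<^sup>+\<omega>. ennreal ((K s \<omega>)\<^sup>2) \<partial>M) \<partial>leb t) = \<infinity>")
  case True
  then show ?thesis using e by (simp add: ennreal_mult_eq_top_iff)
next
  case False
  define k where "k s = (\<integral>\<^sup>+\<omega>. ennreal ((K s \<omega>)\<^sup>2) \<partial>M)" for s
  define R where "R \<omega> = (\<integral>s. K s \<omega> \<partial>leb t)" for \<omega>
  interpret L: finite_measure "leb t" by (rule finite_measure_leb)
  interpret LM: pair_sigma_finite "leb t" M ..
  have [measurable]: "(\<lambda>x. K (snd x) (fst x)) \<in> borel_measurable (M \<Otimes>\<^sub>M leb t)"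
    using measurable_compose[OF measurable_pair_swap' K] by (simp add: split_beta')
  have [measurable]: "(\<lambda>x. K (fst x) (snd x)) \<in> borel_measurable (leb t \<Otimes>\<^sub>M M)"
    using K by (simp add: split_beta')
  have k[measurable]: "k \<in> borel_measurable (leb t)"
    unfolding k_def by measurable
  have R[measurable]: "R \<in> borel_measurable M"
    unfolding R_def by measurable
  have Ks[measurable]: "K s \<in> borel_measurable M" if "s \<in> {0..t}" for s
    using measurable_compose[OF measurable_Pair1'[of s "leb t" M] K] that by simp
  have Kw[measurable]: "(\<lambda>s. K s w) \<in> borel_measurable (leb t)" if "w \<in> space M" for w
    using measurable_compose[OF measurable_Pair2'[of w M "leb t"] K] that by simp
  have kfin: "(\<integral>\<^sup>+s. k s \<partial>leb t) < \<infinity>"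
    using False by (simp add: k_def less_top)
  have kAE: "AE s in leb t. k s < \<infinity>"
    using nn_integral_PInf_AE[OF k] kfin by (auto simp: less_top)
  have Kint: "integrable M (\<lambda>\<omega>. (K s \<omega>)\<^sup>2)" if "s \<in> {0..t}" "k s < \<infinity>" for s
    using that by (intro integrableI_nonneg) (auto simp: k_def)
  have swap: "(\<integral>\<^sup>+\<omega>. (\<integral>\<^sup>+s. ennreal ((K s \<omega>)\<^sup>2) \<partial>leb t) \<partial>M) = (\<integral>\<^sup>+s. k s \<partial>leb t)"
    unfolding k_def by (rule LM.Fubini') measurable
  \<comment> \<open>A preliminary Cauchy-Schwarz bound, with the factor \<open>t\<close> in place of
    \<open>2 * e\<close>, makes \<open>R\<close> square integrable; this is what licenses Fubini for
    \<open>K s * R\<close> below.\<close>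
  have Rfin: "(\<integral>\<^sup>+\<omega>. ennreal ((R \<omega>)\<^sup>2) \<partial>M) < \<infinity>"
  proof -
    have "(\<integral>\<^sup>+\<omega>. ennreal ((R \<omega>)\<^sup>2) \<partial>M) \<le> (\<integral>\<^sup>+\<omega>. emeasure (leb t) (space (leb t)) * (\<integral>\<^sup>+s. ennreal ((K s \<omega>)\<^sup>2) \<partial>leb t) \<partial>M)"
      unfolding R_def by (intro nn_integral_mono nn_square_integral_le finite_measure_leb Kw)
    also have "\<dots> = ennreal t * (\<integral>\<^sup>+s. k s \<partial>leb t)"
      unfolding emeasure_leb_space[OF t] by (subst nn_integral_cmult) (auto simp: swap)
    also have "\<dots> < \<infinity>" using kfin by (simp add: ennreal_mult_less_top)
    finally show ?thesis .
  qed
  have R2: "integrable M (\<lambda>\<omega>. (R \<omega>)\<^sup>2)"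
    using Rfin by (intro integrableI_nonneg) auto
  have K2: "integrable (leb t \<Otimes>\<^sub>M M) (\<lambda>(s, \<omega>). (K s \<omega>)\<^sup>2)"
  proof (rule integrableI_nonneg)
    show "(\<integral>\<^sup>+x. ennreal (case x of (s, \<omega>) \<Rightarrow> (K s \<omega>)\<^sup>2) \<partial>(leb t \<Otimes>\<^sub>M M)) < \<infinity>"
      using kfin by (subst nn_integral_fst[symmetric]) (auto simp: k_def)
  qed auto
  have R2p: "integrable (leb t \<Otimes>\<^sub>M M) (\<lambda>(s, \<omega>). (R \<omega>)\<^sup>2)"
  proof (rule integrableI_nonneg)
    show "(\<integral>\<^sup>+x. ennreal (case x of (s, \<omega>) \<Rightarrow> (R \<omega>)\<^sup>2) \<partial>(leb t \<Otimes>\<^sub>M M)) < \<infinity>"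
      using Rfin by (subst nn_integral_fst[symmetric])
        (auto simp: emeasure_leb_space[OF t, simplified] ennreal_mult_less_top)
  qed auto
  have KR: "integrable (leb t \<Otimes>\<^sub>M M) (\<lambda>(s, \<omega>). K s \<omega> * R \<omega>)"
  proof (rule Bochner_Integration.integrable_bound)
    show "integrable (leb t \<Otimes>\<^sub>M M) (\<lambda>x. (case x of (s, \<omega>) \<Rightarrow> (K s \<omega>)\<^sup>2) + (case x of (s, \<omega>) \<Rightarrow> (R \<omega>)\<^sup>2))"
      using K2 R2p by (rule Bochner_Integration.integrable_add)
    from abs_mult_le_sum_squares show "AE x in leb t \<Otimes>\<^sub>M M. norm (case x of (s, \<omega>) \<Rightarrow> K s \<omega> * R \<omega>)
        \<le> norm ((case x of (s, \<omega>) \<Rightarrow> (K s \<omega>)\<^sup>2) + (case x of (s, \<omega>) \<Rightarrow> (R \<omega>)\<^sup>2))"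
      by auto
  qed measurable
  let ?w = "\<lambda>s r. indicator {r. \<bar>s - r\<bar> < e} r :: ennreal"
  have fst': "(\<lambda>x. fst x) \<in> borel_measurable (leb t \<Otimes>\<^sub>M leb t)"
    by (rule measurable_compose[OF measurable_fst]) (rule borel_measurable_leb, simp)
  have snd': "(\<lambda>x. snd x) \<in> borel_measurable (leb t \<Otimes>\<^sub>M leb t)"
    by (rule measurable_compose[OF measurable_snd]) (rule borel_measurable_leb, simp)
  note [measurable] = fst' snd'
  have w[measurable]: "(\<lambda>x. ?w (fst x) (snd x)) \<in> borel_measurable (leb t \<Otimes>\<^sub>M leb t)"
    unfolding indicator_def mem_Collect_eq by measurable
  have wk[measurable]: "(\<lambda>(s, r). ?w s r * (ennreal (1/2) * k r)) \<in> borel_measurable (leb t \<Otimes>\<^sub>M leb t)"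
    unfolding split_beta' by (intro borel_measurable_times_ennreal w measurable_const measurable_compose[OF measurable_snd k]) simp
  have wk'[measurable]: "(\<lambda>s. \<integral>\<^sup>+r. ?w s r * (ennreal (1/2) * k r) \<partial>leb t) \<in> borel_measurable (leb t)"
    using L.borel_measurable_nn_integral[OF wk] .
  \<comment> \<open>Only one factor of \<open>R * R\<close> is written as a time integral. For fixed
    \<open>s\<close>, Fubini in the other factor leaves mixed moments of \<open>K s\<close> and
    \<open>K r\<close>: they vanish outside the window of half-width \<open>e\<close> around
    \<open>s\<close>, and inside it each is at most half the sum of the two second moments.\<close>
  have key: "AE s in leb t. ennreal \<bar>\<integral>\<omega>. K s \<omega> * R \<omega> \<partial>M\<bar> \<le>
      ennreal e * k s + (\<integral>\<^sup>+r. ?w s r * (ennreal (1/2) * k r) \<partial>leb t)"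
    using kAE AE_space
  proof eventually_elim
    case (elim s)
    then have s: "s \<in> {0..t}" and ks: "k s < \<infinity>" by auto
    have K2s: "integrable (leb t \<Otimes>\<^sub>M M) (\<lambda>(r, \<omega>). (K s \<omega>)\<^sup>2)"
    proof (rule integrableI_nonneg)
      have [measurable]: "K s \<in> borel_measurable M" by (rule Ks[OF s])
      show "(\<lambda>(r, \<omega>). (K s \<omega>)\<^sup>2) \<in> borel_measurable (leb t \<Otimes>\<^sub>M M)" by measurable
      show "(\<integral>\<^sup>+x. ennreal (case x of (r, \<omega>) \<Rightarrow> (K s \<omega>)\<^sup>2) \<partial>(leb t \<Otimes>\<^sub>M M)) < \<infinity>"
        using ks by (subst nn_integral_fst[symmetric])
          (auto simp: emeasure_leb_space[OF t, simplified] ennreal_mult_less_top k_def)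
    qed auto
    have [measurable]: "K s \<in> borel_measurable M" by (rule Ks[OF s])
    have KK: "integrable (leb t \<Otimes>\<^sub>M M) (\<lambda>(r, \<omega>). K s \<omega> * K r \<omega>)"
    proof (rule Bochner_Integration.integrable_bound)
      show "integrable (leb t \<Otimes>\<^sub>M M) (\<lambda>x. (case x of (r, \<omega>) \<Rightarrow> (K s \<omega>)\<^sup>2) + (case x of (s, \<omega>) \<Rightarrow> (K s \<omega>)\<^sup>2))"
        using K2s K2 by (rule Bochner_Integration.integrable_add)
      from abs_mult_le_sum_squares show "AE x in leb t \<Otimes>\<^sub>M M. norm (case x of (r, \<omega>) \<Rightarrow> K s \<omega> * K r \<omega>)
        \<le> norm ((case x of (r, \<omega>) \<Rightarrow> (K s \<omega>)\<^sup>2) + (case x of (s, \<omega>) \<Rightarrow> (K s \<omega>)\<^sup>2))"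
        by auto
    qed measurable
    have "(\<integral>\<omega>. K s \<omega> * R \<omega> \<partial>M) = (\<integral>\<omega>. (\<integral>r. K s \<omega> * K r \<omega> \<partial>leb t) \<partial>M)"
      unfolding R_def by simp
    also have "\<dots> = (\<integral>r. (\<integral>\<omega>. K s \<omega> * K r \<omega> \<partial>M) \<partial>leb t)"
      by (rule LM.Fubini_integral) (use KK in auto)
    finally have "ennreal \<bar>\<integral>\<omega>. K s \<omega> * R \<omega> \<partial>M\<bar> = ennreal \<bar>\<integral>r. (\<integral>\<omega>. K s \<omega> * K r \<omega> \<partial>M) \<partial>leb t\<bar>" by simp
    also have "\<dots> \<le> (\<integral>\<^sup>+r. ennreal \<bar>\<integral>\<omega>. K s \<omega> * K r \<omega> \<partial>M\<bar> \<partial>leb t)"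
      using integral_norm_bound_ennreal[OF LM.integrable_fst'[OF KK]] by simp
    also have "\<dots> \<le> (\<integral>\<^sup>+r. ?w s r * (ennreal (1/2) * k s + ennreal (1/2) * k r) \<partial>leb t)"
    proof (rule nn_integral_mono_AE, use kAE AE_space in eventually_elim)
      case (elim r)
      then have r: "r \<in> {0..t}" and kr: "k r < \<infinity>" by auto
      show ?case
      proof (cases "\<bar>s - r\<bar> < e")
        case True
        have [measurable]: "K r \<in> borel_measurable M" by (rule Ks[OF r])
        have "ennreal \<bar>\<integral>\<omega>. K s \<omega> * K r \<omega> \<partial>M\<bar> \<le> (\<integral>\<^sup>+\<omega>. ennreal \<bar>K s \<omega> * K r \<omega>\<bar> \<partial>M)"
          using integral_norm_bound_ennreal[of M "\<lambda>\<omega>. K s \<omega> * K r \<omega>"]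
          by (cases "integrable M (\<lambda>\<omega>. K s \<omega> * K r \<omega>)") (auto simp: not_integrable_integral_eq)
        also have "\<dots> \<le> (\<integral>\<^sup>+\<omega>. ennreal (1/2) * ennreal ((K s \<omega>)\<^sup>2) + ennreal (1/2) * ennreal ((K r \<omega>)\<^sup>2) \<partial>M)"
        proof (rule nn_integral_mono)
          fix \<omega>
          from abs_mult_le_half_squares show "ennreal \<bar>K s \<omega> * K r \<omega>\<bar> \<le> ennreal (1/2) * ennreal ((K s \<omega>)\<^sup>2) + ennreal (1/2) * ennreal ((K r \<omega>)\<^sup>2)"
            by (subst (1 2) ennreal_mult[symmetric], simp, simp, simp, simp, subst ennreal_plus[symmetric])
               (auto intro!: ennreal_leI simp del: ennreal_plus)
        qed
        also have "\<dots> = ennreal (1/2) * k s + ennreal (1/2) * k r"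
          unfolding k_def by (subst nn_integral_add) (auto simp: nn_integral_cmult)
        finally show ?thesis using True by simp
      next
        case False
        then consider "s + e \<le> r" | "r + e \<le> s" by linarith
        then have "(\<integral>\<omega>. K s \<omega> * K r \<omega> \<partial>M) = 0"
        proof cases
          case 1 then show ?thesis using orth[of s r] Kint s r ks kr by auto
        next
          case 2 then show ?thesis using orth[of r s] Kint s r ks kr by (auto simp: mult.commute)
        qed
        then show ?thesis by simp
      qed
    qed
    also have "\<dots> = (\<integral>\<^sup>+r. ?w s r \<partial>leb t) * (ennreal (1/2) * k s) + (\<integral>\<^sup>+r. ?w s r * (ennreal (1/2) * k r) \<partial>leb t)"
      by (simp only: distrib_left) (subst nn_integral_add, auto simp: nn_integral_multc)
    also have "\<dots> \<le> ennreal (2 * e) * (ennreal (1/2) * k s) + (\<integral>\<^sup>+r. ?w s r * (ennreal (1/2) * k r) \<partial>leb t)"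
      using e by (intro add_right_mono mult_right_mono nn_integral_leb_window) auto
    also have "ennreal (2 * e) * (ennreal (1/2) * k s) = ennreal e * k s"
      using e by (simp add: mult.assoc[symmetric] ennreal_mult[symmetric] del: ennreal_half)
    finally show ?case .
  qed
  have "(\<integral>\<^sup>+\<omega>. ennreal ((R \<omega>)\<^sup>2) \<partial>M) = ennreal (\<integral>\<omega>. (R \<omega>)\<^sup>2 \<partial>M)"
    by (rule nn_integral_eq_integral[OF R2]) simp
  also have "(\<integral>\<omega>. (R \<omega>)\<^sup>2 \<partial>M) = (\<integral>\<omega>. (\<integral>s. K s \<omega> * R \<omega> \<partial>leb t) \<partial>M)"
    by (simp add: R_def power2_eq_square)
  also have "\<dots> = (\<integral>s. (\<integral>\<omega>. K s \<omega> * R \<omega> \<partial>M) \<partial>leb t)"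
    by (rule LM.Fubini_integral) (use KR in auto)
  also have "ennreal \<dots> \<le> ennreal \<bar>\<integral>s. (\<integral>\<omega>. K s \<omega> * R \<omega> \<partial>M) \<partial>leb t\<bar>"
    by (intro ennreal_leI) simp
  also have "\<dots> \<le> (\<integral>\<^sup>+s. ennreal \<bar>\<integral>\<omega>. K s \<omega> * R \<omega> \<partial>M\<bar> \<partial>leb t)"
    using integral_norm_bound_ennreal[OF LM.integrable_fst'[OF KR]] by simp
  also have "\<dots> \<le> (\<integral>\<^sup>+s. ennreal e * k s + (\<integral>\<^sup>+r. ?w s r * (ennreal (1/2) * k r) \<partial>leb t) \<partial>leb t)"
    by (rule nn_integral_mono_AE[OF key])
  also have "\<dots> = ennreal e * (\<integral>\<^sup>+s. k s \<partial>leb t) + (\<integral>\<^sup>+s. (\<integral>\<^sup>+r. ?w s r * (ennreal (1/2) * k r) \<partial>leb t) \<partial>leb t)"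
    using wk' by (subst nn_integral_add) (auto simp: nn_integral_cmult simp del: ennreal_half)
  \<comment> \<open>Interchanging the two time integrals moves the window onto \<open>s\<close>, so
    the half carried by \<open>k r\<close> contributes \<open>e\<close> times the integral of
    \<open>k\<close>, just as the half carried by \<open>k s\<close> did. Their sum is the factor
    \<open>2 * e\<close>.\<close>
  also have "(\<integral>\<^sup>+s. (\<integral>\<^sup>+r. ?w s r * (ennreal (1/2) * k r) \<partial>leb t) \<partial>leb t) =
      (\<integral>\<^sup>+r. (\<integral>\<^sup>+s. ?w s r * (ennreal (1/2) * k r) \<partial>leb t) \<partial>leb t)"
  proof -
    interpret LL: pair_sigma_finite "leb t" "leb t" ..
    have "(\<lambda>(r, s). ?w s r * (ennreal (1/2) * k r)) \<in> borel_measurable (leb t \<Otimes>\<^sub>M leb t)"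
      using measurable_compose[OF measurable_pair_swap' wk] by (simp add: split_beta')
    then show ?thesis by (rule LL.Fubini')
  qed
  also have "\<dots> \<le> (\<integral>\<^sup>+r. ennreal (2 * e) * (ennreal (1/2) * k r) \<partial>leb t)"
  proof (rule nn_integral_mono)
    fix r
    have "(\<integral>\<^sup>+s. ?w s r * (ennreal (1/2) * k r) \<partial>leb t) = (\<integral>\<^sup>+s. ?w s r \<partial>leb t) * (ennreal (1/2) * k r)"
      by (rule nn_integral_multc) measurable
    also have "(\<integral>\<^sup>+s. ?w s r \<partial>leb t) = (\<integral>\<^sup>+s. indicator {s. \<bar>r - s\<bar> < e} s \<partial>leb t)"
      by (intro nn_integral_cong) (auto simp: indicator_def)
    also have "\<dots> \<le> ennreal (2 * e)"
      using e by (intro nn_integral_leb_window) simp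
    finally show "(\<integral>\<^sup>+s. ?w s r * (ennreal (1/2) * k r) \<partial>leb t) \<le> ennreal (2 * e) * (ennreal (1/2) * k r)"
      by (simp add: mult_right_mono)
  qed
  also have "\<dots> = ennreal e * (\<integral>\<^sup>+s. k s \<partial>leb t)"
  proof -
    have "ennreal (2 * e) * (ennreal (1/2) * k r) = ennreal e * k r" for r
      using e by (simp add: mult.assoc[symmetric] ennreal_mult[symmetric] del: ennreal_half)
    then show ?thesis by (simp add: nn_integral_cmult)
  qed
  also have "ennreal e * (\<integral>\<^sup>+s. k s \<partial>leb t) + ennreal e * (\<integral>\<^sup>+s. k s \<partial>leb t) = ennreal (2 * e) * (\<integral>\<^sup>+s. k s \<partial>leb t)"
    using e by (simp add: distrib_right[symmetric] ennreal_plus[symmetric] del: ennreal_plus)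
  finally show ?thesis unfolding R_def k_def by simp
qed

section \<open>Gronwall, averages, and convergence in probability\<close>

lemma nn_integral_power_leb:
  assumes "0 \<le> t"
  shows "(\<integral>\<^sup>+s. ennreal (s ^ n / fact n) \<partial>leb t) = ennreal (t ^ Suc n / fact (Suc n))"
proof -
  have "(\<integral>\<^sup>+s. ennreal (s ^ n / fact n) * indicator {0..t} s \<partial>lborel) =
      ennreal (t ^ Suc n / fact (Suc n) - 0 ^ Suc n / fact (Suc n))"
  proof (rule nn_integral_FTC_Icc)
    fix x :: real
    show "((\<lambda>s. s ^ Suc n / fact (Suc n)) has_real_derivative x ^ n / fact n) (at x)"
      by (rule derivative_eq_intros refl | simp add: divide_simps)+
  qed (use assms in auto)
  then show ?thesis by (simp add: nn_integral_leb)
qed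

text \<open>Inserting the inequality into itself \<open>n\<close> times, starting from the bound
  \<open>b\<close>, gives the upper bound \<open>b * (C * t) ^ n / fact n\<close>, which tends to 0
  as a term of the exponential series.\<close>

lemma gronwall_zero:
  fixes g :: "real \<Rightarrow> ennreal"
  assumes le: "\<And>t. t \<in> {0..T} \<Longrightarrow> g t \<le> ennreal C * (\<integral>\<^sup>+s. g s \<partial>leb t)"
    and bd: "\<And>t. t \<in> {0..T} \<Longrightarrow> g t \<le> ennreal b" and "0 \<le> b" "0 \<le> C"
    and t: "t \<in> {0..T}"
  shows "g t = 0"
proof -
  have it: "g t \<le> ennreal (b * (C ^ n * (t ^ n / fact n)))" if "t \<in> {0..T}" for t n
    using that
  proof (induction n arbitrary: t)
    case 0
    then show ?case using bd by simp
  next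
    case (Suc n)
    have "g t \<le> ennreal C * (\<integral>\<^sup>+s. g s \<partial>leb t)"
      using le Suc.prems by simp
    also have "\<dots> \<le> ennreal C * (\<integral>\<^sup>+s. ennreal (b * C ^ n) * ennreal (s ^ n / fact n) \<partial>leb t)"
    proof (intro mult_left_mono nn_integral_mono)
      fix s assume "s \<in> space (leb t)"
      then have s: "s \<in> {0..T}" using Suc.prems by auto
      then show "g s \<le> ennreal (b * C ^ n) * ennreal (s ^ n / fact n)"
        using Suc.IH[OF s] \<open>0 \<le> b\<close> \<open>0 \<le> C\<close> by (simp add: ennreal_mult[symmetric] mult.assoc)
    qed simp
    also have "\<dots> = ennreal C * (ennreal (b * C ^ n) * ennreal (t ^ Suc n / fact (Suc n)))"
      using Suc.prems by (subst nn_integral_cmult) (auto simp: nn_integral_power_leb simp del: fact_Suc power_Suc)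
    also have "\<dots> = ennreal (b * (C ^ Suc n * (t ^ Suc n / fact (Suc n))))"
      using Suc.prems \<open>0 \<le> b\<close> \<open>0 \<le> C\<close>
      by (simp add: ennreal_mult[symmetric] mult_ac del: fact_Suc)
    finally show ?case .
  qed
  have "(\<lambda>n. b * ((C * t) ^ n / fact n)) \<longlonglongrightarrow> b * 0"
    using summable_LIMSEQ_zero[OF summable_exp[of "C * t"]]
    by (intro tendsto_mult tendsto_const) (simp add: divide_inverse mult.commute)
  then have "(\<lambda>n. ennreal (b * (C ^ n * (t ^ n / fact n)))) \<longlonglongrightarrow> ennreal 0"
    by (intro tendsto_ennrealI) (simp add: power_mult_distrib)
  then have "g t \<le> ennreal 0"
    by (rule LIMSEQ_le_const) (use it t in blast)
  then show ?thesis by simp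
qed

lemma lebesgue_integral_leb: "(\<integral>x. f x \<partial>leb t) = (LBINT x:{0..t}. (f x :: real))"
  unfolding set_lebesgue_integral_def by (rule integral_restrict_space) simp

lemma integrable_leb_iff: "integrable (leb t) (f :: real \<Rightarrow> real) \<longleftrightarrow> set_integrable lborel {0..t} f"
  unfolding set_integrable_def by (rule integrable_restrict_space) simp

lemma integrable_leb_continuous:
  "continuous_on {0..t} (f :: real \<Rightarrow> real) \<Longrightarrow> integrable (leb t) f"
  unfolding integrable_leb_iff by (rule borel_integrable_atLeastAtMost')

text \<open>The deterministic core of the forward integral: the average attached to the indicator of
  an interval tends to the increment over it. With a primitive \<open>G\<close> of \<open>f\<close>,
  a shift of the integration variable turns the average into the difference of two right difference
  quotients of \<open>G\<close>, at \<open>b\<close> and at \<open>a\<close>.\<close>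

lemma tendsto_average_difference:
  fixes f :: "real \<Rightarrow> real"
  assumes f: "continuous_on {0..} f" and ab: "0 \<le> a" "a \<le> b"
  shows "((\<lambda>e. LBINT s:{a..b}. (f (s + e) - f s) / e) \<longlongrightarrow> f b - f a) (at_right 0)"
proof -
  define G where "G x = integral {0..x} f" for x
  have fint: "f integrable_on {x..y}" if "0 \<le> x" for x y
    using that by (intro integrable_continuous_real continuous_on_subset[OF f]) auto
  have G: "integral {x..y} f = G y - G x" if "0 \<le> x" "x \<le> y" for x y
    unfolding G_def using Henstock_Kurzweil_Integration.integral_combine[OF that fint[of 0 y]] by (simp add: eq_diff_eq add.commute)
  have lim: "((\<lambda>e. (G (x + e) - G x) / e) \<longlongrightarrow> f x) (at_right 0)" if "0 \<le> x" for x
  proof -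
    have "(G has_real_derivative f x) (at x within {0..x + 1})"
      unfolding G_def
      by (rule integral_has_real_derivative) (use that in \<open>auto intro: continuous_on_subset[OF f]\<close>)
    then have "(G has_real_derivative f x) (at x within {x..x + 1})"
      by (rule DERIV_subset) (use that in auto)
    then have "((\<lambda>y. (G y - G x) / (y - x)) \<longlongrightarrow> f x) (at_right x)"
      by (simp add: has_field_derivative_iff at_within_Icc_at_right)
    then show ?thesis
      by (subst (asm) filterlim_at_right_to_0) (simp add: add.commute)
  qed
  have eq: "(LBINT s:{a..b}. (f (s + e) - f s) / e) = (G (b + e) - G b) / e - (G (a + e) - G a) / e"
    if "0 < e" for e
  proof -
    have c1: "continuous_on {a..b} (\<lambda>s. f (s + e))"
      using ab that by (intro continuous_on_compose2[OF f] continuous_intros) auto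
    have c2: "continuous_on {a..b} f"
      using ab by (intro continuous_on_subset[OF f]) auto
    have c: "continuous_on {a..b} (\<lambda>s. (f (s + e) - f s) / e)"
      using that by (intro continuous_intros c1 c2) auto
    have "(LBINT s:{a..b}. (f (s + e) - f s) / e) = integral {a..b} (\<lambda>s. (f (s + e) - f s) / e)"
      by (rule set_borel_integral_eq_integral(2)[OF borel_integrable_atLeastAtMost'[OF c]])
    also have "\<dots> = (integral {a..b} (\<lambda>s. f (s + e)) - integral {a..b} f) / e"
      using integrable_continuous_real[OF c1] integrable_continuous_real[OF c2]
      by (simp add: integral_diff)
    also have "integral {a..b} (\<lambda>s. f (s + e)) = integral {a + e..b + e} f"
      using integral_shift[of a e b f] ab that continuous_on_subset[OF f, of "{a + e..b + e}"]
      by (auto simp: o_def)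
    finally show ?thesis
      using ab that by (simp add: G diff_divide_distrib)
  qed
  have "((\<lambda>e. (G (b + e) - G b) / e - (G (a + e) - G a) / e) \<longlongrightarrow> f b - f a) (at_right 0)"
    using ab by (intro tendsto_diff lim) auto
  then show ?thesis
  proof (rule Lim_transform_eventually)
    show "\<forall>\<^sub>F e in at_right 0. (G (b + e) - G b) / e - (G (a + e) - G a) / e =
        (LBINT s:{a..b}. (f (s + e) - f s) / e)"
      using eventually_at_right_less[of "0::real"] by eventually_elim (rule eq[symmetric])
  qed
qed

text \<open>On a finite measure this is convergence in probability, encoded by the mean of the
  squared distance truncated at 1. In this form mean-square convergence implies it by monotonicity,
  almost sure convergence by domination, sums cost only a factor 2, and it is an L1 convergence,
  from which almost surely convergent subsequences follow.\<close>

definition tendsto_prob :: "'b measure \<Rightarrow> (nat \<Rightarrow> 'b \<Rightarrow> real) \<Rightarrow> ('b \<Rightarrow> real) \<Rightarrow> bool" where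
  "tendsto_prob N f g \<longleftrightarrow> (\<lambda>k. \<integral>\<^sup>+ x. ennreal (min 1 ((f k x - g x)\<^sup>2)) \<partial>N) \<longlonglongrightarrow> 0"

lemma min_one_square_add_le: "min 1 ((a + b)\<^sup>2) \<le> 2 * min 1 (a\<^sup>2) + 2 * min 1 (b\<^sup>2)" for a b :: real
proof -
  have "(a + b)\<^sup>2 \<le> 2 * a\<^sup>2 + 2 * b\<^sup>2"
    using zero_le_power2[of "a - b"] by (simp add: power2_eq_square algebra_simps)
  then show ?thesis using zero_le_power2[of a] zero_le_power2[of b] unfolding min_def by (smt (verit))
qed

lemma min_one_square_mult_le: "min 1 ((c * a)\<^sup>2) \<le> max 1 (c\<^sup>2) * min 1 (a\<^sup>2)" for a c :: real
proof (cases "a\<^sup>2 \<le> 1")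
  case True
  then show ?thesis by (simp add: power_mult_distrib min_le_iff_disj mult_right_mono)
next
  case False
  then show ?thesis by (simp add: min_le_iff_disj)
qed

lemma tendsto_prob_if_tendsto_L2: "tendsto_L2 N f g \<Longrightarrow> tendsto_prob N f g"
  unfolding tendsto_L2_def tendsto_prob_def
  by (rule tendsto_sandwich[OF _ _ tendsto_const, rotated 2], assumption)
     (auto intro!: always_eventually nn_integral_mono ennreal_leI)

lemma nn_integral_min_one_add_le:
  assumes "f \<in> borel_measurable N" "g \<in> borel_measurable N"
  shows "(\<integral>\<^sup>+ x. ennreal (min 1 ((f x + g x)\<^sup>2)) \<partial>N)
    \<le> 2 * (\<integral>\<^sup>+ x. ennreal (min 1 ((f x)\<^sup>2)) \<partial>N) + 2 * (\<integral>\<^sup>+ x. ennreal (min 1 ((g x)\<^sup>2)) \<partial>N)"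
proof -
  note [measurable] = assms
  have "(\<integral>\<^sup>+ x. ennreal (min 1 ((f x + g x)\<^sup>2)) \<partial>N) \<le>
      (\<integral>\<^sup>+ x. 2 * ennreal (min 1 ((f x)\<^sup>2)) + 2 * ennreal (min 1 ((g x)\<^sup>2)) \<partial>N)"
  proof (rule nn_integral_mono)
    fix x
    have "ennreal (min 1 ((f x + g x)\<^sup>2)) \<le> ennreal (2 * min 1 ((f x)\<^sup>2) + 2 * min 1 ((g x)\<^sup>2))"
      by (rule ennreal_leI[OF min_one_square_add_le])
    also have "\<dots> = 2 * ennreal (min 1 ((f x)\<^sup>2)) + 2 * ennreal (min 1 ((g x)\<^sup>2))"
      by (subst ennreal_plus) (auto simp: ennreal_mult)
    finally show "ennreal (min 1 ((f x + g x)\<^sup>2)) \<le> \<dots>" .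
  qed
  also have "\<dots> = 2 * (\<integral>\<^sup>+ x. ennreal (min 1 ((f x)\<^sup>2)) \<partial>N) + 2 * (\<integral>\<^sup>+ x. ennreal (min 1 ((g x)\<^sup>2)) \<partial>N)"
    by (subst nn_integral_add) (auto simp: nn_integral_cmult)
  finally show ?thesis .
qed

lemma tendsto_prob_add:
  assumes "tendsto_prob N f g" "tendsto_prob N f' g'"
    and [measurable]: "\<And>k. f k \<in> borel_measurable N" "\<And>k. f' k \<in> borel_measurable N"
      "g \<in> borel_measurable N" "g' \<in> borel_measurable N"
  shows "tendsto_prob N (\<lambda>k x. f k x + f' k x) (\<lambda>x. g x + g' x)"
  unfolding tendsto_prob_def
proof (rule tendsto_sandwich[OF _ _ tendsto_const])
  show "(\<lambda>k. 2 * (\<integral>\<^sup>+ x. ennreal (min 1 ((f k x - g x)\<^sup>2)) \<partial>N) +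
      2 * (\<integral>\<^sup>+ x. ennreal (min 1 ((f' k x - g' x)\<^sup>2)) \<partial>N)) \<longlonglongrightarrow> 0"
    using tendsto_add[OF tendsto_mult_ennreal[OF tendsto_const[of 2] assms(1)[unfolded tendsto_prob_def]]
      tendsto_mult_ennreal[OF tendsto_const[of 2] assms(2)[unfolded tendsto_prob_def]]] by simp
  have eq: "(f k x + f' k x) - (g x + g' x) = (f k x - g x) + (f' k x - g' x)" for k x by simp
  show "\<forall>\<^sub>F k in sequentially. (\<integral>\<^sup>+ x. ennreal (min 1 (((f k x + f' k x) - (g x + g' x))\<^sup>2)) \<partial>N)
      \<le> 2 * (\<integral>\<^sup>+ x. ennreal (min 1 ((f k x - g x)\<^sup>2)) \<partial>N) + 2 * (\<integral>\<^sup>+ x. ennreal (min 1 ((f' k x - g' x)\<^sup>2)) \<partial>N)"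
    unfolding eq by (intro always_eventually allI nn_integral_min_one_add_le) auto
qed auto

lemma tendsto_prob_cmult:
  assumes "tendsto_prob N f g"
    and [measurable]: "\<And>k. f k \<in> borel_measurable N" "g \<in> borel_measurable N"
  shows "tendsto_prob N (\<lambda>k x. c * f k x) (\<lambda>x. c * g x)"
  unfolding tendsto_prob_def
proof (rule tendsto_sandwich[OF _ _ tendsto_const])
  show "(\<lambda>k. ennreal (max 1 (c\<^sup>2)) * (\<integral>\<^sup>+ x. ennreal (min 1 ((f k x - g x)\<^sup>2)) \<partial>N)) \<longlonglongrightarrow> 0"
    using tendsto_mult_ennreal[OF tendsto_const[of "ennreal (max 1 (c\<^sup>2))"] assms(1)[unfolded tendsto_prob_def]] by simp
  have "(\<integral>\<^sup>+ x. ennreal (min 1 ((c * f k x - c * g x)\<^sup>2)) \<partial>N) \<le>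
      (\<integral>\<^sup>+ x. ennreal (max 1 (c\<^sup>2)) * ennreal (min 1 ((f k x - g x)\<^sup>2)) \<partial>N)" for k
  proof (rule nn_integral_mono)
    fix x
    show "ennreal (min 1 ((c * f k x - c * g x)\<^sup>2)) \<le> ennreal (max 1 (c\<^sup>2)) * ennreal (min 1 ((f k x - g x)\<^sup>2))"
      using ennreal_leI[OF min_one_square_mult_le[of c "f k x - g x"]]
      by (simp add: right_diff_distrib ennreal_mult)
  qed
  then show "\<forall>\<^sub>F k in sequentially. (\<integral>\<^sup>+ x. ennreal (min 1 ((c * f k x - c * g x)\<^sup>2)) \<partial>N)
      \<le> ennreal (max 1 (c\<^sup>2)) * (\<integral>\<^sup>+ x. ennreal (min 1 ((f k x - g x)\<^sup>2)) \<partial>N)"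
    by (intro always_eventually allI) (simp add: nn_integral_cmult)
qed auto

lemma tendsto_prob_cong_AE:
  assumes "\<And>k. AE x in N. f k x - g x = f' k x - g' x"
  shows "tendsto_prob N f g \<longleftrightarrow> tendsto_prob N f' g'"
proof -
  have "(\<integral>\<^sup>+ x. ennreal (min 1 ((f k x - g x)\<^sup>2)) \<partial>N) = (\<integral>\<^sup>+ x. ennreal (min 1 ((f' k x - g' x)\<^sup>2)) \<partial>N)" for k
    by (rule nn_integral_cong_AE) (use assms[of k] in auto)
  then show ?thesis unfolding tendsto_prob_def by simp
qed

text \<open>The truncated squares tend to 0 in mean, hence almost surely along a subsequence; once
  they are below 1 the truncation is inactive, and the squares themselves tend to 0.\<close>

lemma tendsto_prob_AE_subseq:
  assumes "finite_measure N" and f: "tendsto_prob N f g"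
    and [measurable]: "\<And>k. f k \<in> borel_measurable N" "g \<in> borel_measurable N"
  shows "\<exists>r::nat\<Rightarrow>nat. strict_mono r \<and> (AE x in N. (\<lambda>k. f (r k) x) \<longlonglongrightarrow> g x)"
proof -
  interpret finite_measure N by fact
  have i: "integrable N (\<lambda>x. min 1 ((f k x - g x)\<^sup>2))" for k
    by (rule integrable_const_bound[of _ 1]) auto
  have "(\<lambda>k. enn2real (\<integral>\<^sup>+ x. ennreal (min 1 ((f k x - g x)\<^sup>2)) \<partial>N)) \<longlonglongrightarrow> enn2real 0"
    using f unfolding tendsto_prob_def by (intro tendsto_enn2real) auto
  moreover have "enn2real (\<integral>\<^sup>+ x. ennreal (min 1 ((f k x - g x)\<^sup>2)) \<partial>N) = (\<integral>x. norm (min 1 ((f k x - g x)\<^sup>2)) \<partial>N)" for k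
    by (subst nn_integral_eq_integral[OF i]) auto
  ultimately have "(\<lambda>k. \<integral>x. norm (min 1 ((f k x - g x)\<^sup>2)) \<partial>N) \<longlonglongrightarrow> 0" by simp
  from tendsto_L1_AE_subseq[OF i this] obtain r where r: "strict_mono r"
    and ae: "AE x in N. (\<lambda>k. min 1 ((f (r k) x - g x)\<^sup>2)) \<longlonglongrightarrow> 0" by auto
  have "(\<lambda>k. f (r k) x) \<longlonglongrightarrow> g x" if lim: "(\<lambda>k. min 1 ((f (r k) x - g x)\<^sup>2)) \<longlonglongrightarrow> 0" for x
  proof -
    have "\<forall>\<^sub>F k in sequentially. min 1 ((f (r k) x - g x)\<^sup>2) < 1"
      using order_tendstoD(2)[OF lim, of 1] by simp
    then have "\<forall>\<^sub>F k in sequentially. min 1 ((f (r k) x - g x)\<^sup>2) = (f (r k) x - g x)\<^sup>2"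
      by eventually_elim (auto simp: min_def split: if_splits)
    then have "(\<lambda>k. (f (r k) x - g x)\<^sup>2) \<longlonglongrightarrow> 0"
      by (rule Lim_transform_eventually[OF lim])
    from tendsto_real_sqrt[OF this] have "(\<lambda>k. \<bar>f (r k) x - g x\<bar>) \<longlonglongrightarrow> 0" by simp
    then show ?thesis by (subst LIM_zero_iff[symmetric]) (simp add: tendsto_rabs_zero_iff)
  qed
  with ae have "AE x in N. (\<lambda>k. f (r k) x) \<longlonglongrightarrow> g x" by auto
  with r show ?thesis by blast
qed

lemma tendsto_prob_if_AE:
  assumes "finite_measure N" and ae: "AE x in N. (\<lambda>k. f k x) \<longlonglongrightarrow> g x"
    and [measurable]: "\<And>k. f k \<in> borel_measurable N" "g \<in> borel_measurable N"
  shows "tendsto_prob N f g"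
proof -
  interpret finite_measure N by fact
  have "(\<lambda>k. \<integral>\<^sup>+ x. ennreal (min 1 ((f k x - g x)\<^sup>2)) \<partial>N) \<longlonglongrightarrow> (\<integral>\<^sup>+ x. 0 \<partial>N)"
  proof (rule nn_integral_dominated_convergence[where w="\<lambda>_. 1"])
    show "(\<integral>\<^sup>+ x. 1 \<partial>N) < \<infinity>" using finite_emeasure_space by (simp add: less_top[symmetric])
    show "AE x in N. (\<lambda>k. ennreal (min 1 ((f k x - g x)\<^sup>2))) \<longlonglongrightarrow> 0"
      using ae
    proof eventually_elim
      case (elim x)
      have "(\<lambda>k. min 1 ((f k x - g x)\<^sup>2)) \<longlonglongrightarrow> min 1 ((g x - g x)\<^sup>2)"
        by (intro tendsto_intros elim)
      from tendsto_ennrealI[OF this] show ?case by simp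
    qed
  qed (auto intro!: ennreal_leI simp: ennreal_1[symmetric] simp del: ennreal_1)
  then show ?thesis unfolding tendsto_prob_def by simp
qed

section \<open>Rational times and traces of sigma-algebras\<close>

text \<open>The largest multiple of \<open>1 / (n + 1)\<close> not exceeding \<open>s\<close>.
  Rounding down keeps evaluations at grid times adapted, and rational values leave only countably
  many times to control.\<close>

definition grid :: "nat \<Rightarrow> real \<Rightarrow> real" where
  "grid n s = real_of_int \<lfloor>s * real (Suc n)\<rfloor> / real (Suc n)"

lemma grid_le: "grid n s \<le> s"
  unfolding grid_def by (subst pos_divide_le_eq) auto

lemma grid_nonneg: "0 \<le> s \<Longrightarrow> 0 \<le> grid n s"
  unfolding grid_def by simp

lemma grid_in_Rats: "grid n s \<in> \<rat>"
  unfolding grid_def by (intro Rats_divide) (auto intro: Rats_of_int)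

lemma grid_tendsto: "(\<lambda>n. grid n s) \<longlonglongrightarrow> s"
proof (rule tendsto_sandwich[OF _ _ _ tendsto_const])
  have "s - 1 / real (Suc n) \<le> grid n s" for n
  proof -
    have "s * real (Suc n) - 1 \<le> real_of_int \<lfloor>s * real (Suc n)\<rfloor>" by linarith
    then have "(s * real (Suc n) - 1) / real (Suc n) \<le> grid n s"
      unfolding grid_def by (rule divide_right_mono) simp
    then show ?thesis by (simp add: diff_divide_distrib)
  qed
  then show "\<forall>\<^sub>F n in sequentially. s - 1 / real (Suc n) \<le> grid n s" by simp
  have "(\<lambda>n. s - 1 / real (Suc n)) \<longlonglongrightarrow> s - 0"
    by (intro tendsto_diff tendsto_const LIMSEQ_Suc[OF lim_1_over_n])
  then show "(\<lambda>n. s - 1 / real (Suc n)) \<longlonglongrightarrow> s" by simp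
qed (auto simp: grid_le)

text \<open>For fixed \<open>n\<close> the rounded time takes countably many values, indexed by an
  integer floor, so measurability at each single time yields joint measurability. The shift
  \<open>a\<close> covers the look-ahead in \<open>B (s + a)\<close>.\<close>

lemma measurable_grid:
  fixes f :: "real \<Rightarrow> 'b \<Rightarrow> real"
  assumes f: "\<And>q. q \<in> {a..t + a} \<Longrightarrow> f q \<in> borel_measurable N"
  shows "(\<lambda>(s, \<omega>). f (grid n s + a) \<omega>) \<in> borel_measurable (leb t \<Otimes>\<^sub>M N)"
proof -
  \<comment> \<open>The floor formally ranges over all integers, while \<open>f\<close> is
    measurable only at times in the given interval; elsewhere the value 0 is inserted.\<close>
  define f' where "f' i \<omega> = (let q = real_of_int i / real (Suc n) + a in if q \<in> {a..t + a} then f q \<omega> else 0)" for i :: int and \<omega>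
  have f': "f' i \<in> borel_measurable N" for i
    unfolding f'_def Let_def using f by (cases "real_of_int i / real (Suc n) + a \<in> {a..t + a}") auto
  have fl: "(\<lambda>x. \<lfloor>fst x * real (Suc n)\<rfloor>) \<in> measurable (leb t \<Otimes>\<^sub>M N) (count_space UNIV)"
    by (rule measurable_compose[OF measurable_fst]) (intro measurable_restrict_space1, simp)
  have "(\<lambda>x. f' \<lfloor>fst x * real (Suc n)\<rfloor> (snd x)) \<in> borel_measurable (leb t \<Otimes>\<^sub>M N)"
    by (rule measurable_compose_countable[OF measurable_compose[OF measurable_snd f'] fl])
  also have "?this \<longleftrightarrow> ?thesis"
  proof (rule measurable_cong)
    fix x assume "x \<in> space (leb t \<Otimes>\<^sub>M N)"
    then have "0 \<le> fst x" "fst x \<le> t" by (auto simp: space_pair_measure)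
    then have "grid n (fst x) + a \<in> {a..t + a}"
      using grid_le[of n "fst x"] grid_nonneg[of "fst x" n] by auto
    then show "f' \<lfloor>fst x * real (Suc n)\<rfloor> (snd x) = (case x of (s, \<omega>) \<Rightarrow> f (grid n s + a) \<omega>)"
      unfolding f'_def Let_def grid_def[symmetric] by (simp add: split_beta')
  qed
  finally show ?thesis .
qed

text \<open>If \<open>V q\<close> has the same trace on \<open>A\<close> as the event that
  \<open>f\<close> is below \<open>q\<close>, then the infimum of the rationals \<open>q\<close>
  with \<open>x \<in> V q\<close> recovers \<open>f x\<close> on \<open>A\<close>. Extended reals
  are used because off \<open>A\<close> the sets \<open>V q\<close> are unrelated to each other and
  the infimum may be infinite.\<close>

lemma borel_measurable_trace_extension:
  fixes f :: "'b \<Rightarrow> real"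
  assumes tr: "\<And>U. U \<in> sets borel \<Longrightarrow> \<exists>V\<in>sets N. f -` U \<inter> A = V \<inter> A"
  shows "\<exists>g\<in>borel_measurable N. \<forall>x\<in>A \<inter> space N. g x = f x"
proof -
  have "\<exists>V\<in>sets N. f -` {..<q} \<inter> A = V \<inter> A" for q :: real
    by (rule tr) simp
  then obtain V where V: "\<And>q. V q \<in> sets N" "\<And>q. f -` {..<q} \<inter> A = V q \<inter> A" by metis
  define g where "g x = (INF q\<in>\<rat>. if x \<in> V q then ereal q else \<infinity>)" for x
  have [measurable]: "g \<in> borel_measurable N"
    unfolding g_def
  proof (rule borel_measurable_INF[OF countable_rat])
    fix q
    have [measurable]: "V q \<in> sets N" by (rule V)
    show "(\<lambda>x. if x \<in> V q then ereal q else \<infinity>) \<in> borel_measurable N" by measurable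
  qed
  have "g x = ereal (f x)" if x: "x \<in> A" for x
  proof -
    have iff: "x \<in> V q \<longleftrightarrow> f x < q" for q using V(2)[of q] x by auto
    show ?thesis
      unfolding g_def
    proof (rule INF_eqI)
      fix y assume y: "\<And>q. q \<in> \<rat> \<Longrightarrow> y \<le> (if x \<in> V q then ereal q else \<infinity>)"
      show "y \<le> ereal (f x)"
      proof (rule ccontr)
        assume "\<not> y \<le> ereal (f x)"
        then have "ereal (f x) < y" by simp
        from ereal_dense3[OF this] obtain r where "ereal (f x) < real_of_rat r" "real_of_rat r < y"
          by blast
        then show False using y[of "real_of_rat r"] iff by auto
      qed
    qed (auto simp: iff)
  qed
  then show ?thesis
    by (intro bexI[of _ "\<lambda>x. real_of_ereal (g x)"]) auto
qed

section \<open>Independence of increments from the augmented filtration\<close>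

locale brownian = prob_space P for P :: "'a measure" +
  fixes B :: "real \<Rightarrow> 'a \<Rightarrow> real"
  assumes bm: "brownian_motion P B"
begin

abbreviation F :: "real \<Rightarrow> 'a measure" where "F \<equiv> brownian_filtration P B"

definition inc :: "real \<Rightarrow> real \<Rightarrow> 'a \<Rightarrow> real" where
  "inc s h \<omega> = B (s + h) \<omega> - B s \<omega>"

lemma B_measurable: "0 \<le> t \<Longrightarrow> B t \<in> borel_measurable P"
  and B_zero: "\<omega> \<in> space P \<Longrightarrow> B 0 \<omega> = 0"
  and B_continuous: "\<omega> \<in> space P \<Longrightarrow> continuous_on {0..} (\<lambda>t. B t \<omega>)"
  using bm unfolding brownian_motion_def by auto

lemma inc_measurable: "0 \<le> s \<Longrightarrow> 0 \<le> h \<Longrightarrow> inc s h \<in> borel_measurable P"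
  unfolding inc_def[abs_def] by (intro borel_measurable_diff B_measurable) auto

lemma inc_distributed:
  assumes "0 \<le> s" "0 < h"
  shows "distributed P lborel (inc s h) (normal_density 0 (sqrt h))"
proof -
  have "distributed P lborel (\<lambda>\<omega>. B (s + h) \<omega> - B s \<omega>) (normal_density 0 (sqrt (s + h - s)))"
    using bm assms unfolding brownian_motion_def by (metis less_add_same_cancel1)
  then show ?thesis by (simp add: inc_def[abs_def])
qed

lemma F_generator: "null_sets P \<union> (\<Union>s\<in>{0..t}. {B s -` U \<inter> space P | U. U \<in> sets borel}) \<subseteq> sets P"
  using measurable_sets[OF B_measurable] by auto

lemma space_F [simp]: "space (F t) = space P"
  unfolding brownian_filtration_def by (simp add: space_measure_of_conv)

lemma sets_F: "sets (F t) = sigma_sets (space P) (null_sets P \<union> (\<Union>s\<in>{0..t}. {B s -` U \<inter> space P | U. U \<in> sets borel}))"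
  unfolding brownian_filtration_def
  using F_generator[of t] sets.space_closed[of P] by (intro sets_measure_of) blast

lemma sets_F_subset: "sets (F t) \<subseteq> sets P"
  unfolding sets_F by (rule sets.sigma_sets_subset[OF F_generator])

lemma sets_F_mono: "s \<le> t \<Longrightarrow> sets (F s) \<subseteq> sets (F t)"
  unfolding sets_F by (intro sigma_sets_mono') fastforce

lemma measurable_F: "f \<in> borel_measurable (F t) \<Longrightarrow> f \<in> borel_measurable P"
  by (rule measurable_from_subalg) (auto simp: subalgebra_def sets_F_subset)

lemma measurable_F_mono: "s \<le> t \<Longrightarrow> f \<in> borel_measurable (F s) \<Longrightarrow> f \<in> borel_measurable (F t)"
  by (rule measurable_from_subalg[rotated]) (use sets_F_mono[of s t] in \<open>auto simp: subalgebra_def\<close>)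

lemma B_adapted: "0 \<le> s \<Longrightarrow> s \<le> t \<Longrightarrow> B s \<in> borel_measurable (F t)"
  by (rule measurableI) (auto simp: sets_F intro!: sigma_sets.Basic)

text \<open>Finite-dimensional events up to time \<open>t\<close>: a class closed under intersection
  which, together with the null sets, generates the augmented filtration, so that independence of
  later increments can be checked on generators.\<close>

definition cylinders :: "real \<Rightarrow> 'a set set" where
  "cylinders t = {{\<omega>\<in>space P. \<forall>r\<in>R. B r \<omega> \<in> U r} | R U. finite R \<and> R \<subseteq> {0..t} \<and> (\<forall>r. U r \<in> sets borel)}"

lemma cylinder_events: "cylinders t \<subseteq> sets P"
proof
  fix A assume "A \<in> cylinders t"
  then obtain R U where A: "A = {\<omega>\<in>space P. \<forall>r\<in>R. B r \<omega> \<in> U r}" "finite R" "R \<subseteq> {0..t}" "\<And>r. U r \<in> sets borel"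
    unfolding cylinders_def by blast
  show "A \<in> sets P" unfolding A(1)
  proof (rule sets.sets_Collect_finite_All[OF _ \<open>finite R\<close>])
    fix r assume "r \<in> R"
    then have [measurable]: "B r \<in> borel_measurable P" using A(3) B_measurable by auto
    show "{\<omega>\<in>space P. B r \<omega> \<in> U r} \<in> sets P" using A(4)[of r] by measurable
  qed
qed

lemma cylinders_Int_stable: "Int_stable (cylinders t)"
proof (rule Int_stableI)
  fix a b assume "a \<in> cylinders t" "b \<in> cylinders t"
  then obtain R U R' U' where a: "a = {\<omega>\<in>space P. \<forall>r\<in>R. B r \<omega> \<in> U r}" "finite R" "R \<subseteq> {0..t}" "\<And>r. U r \<in> sets borel"
    and b: "b = {\<omega>\<in>space P. \<forall>r\<in>R'. B r \<omega> \<in> U' r}" "finite R'" "R' \<subseteq> {0..t}" "\<And>r. U' r \<in> sets borel"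
    unfolding cylinders_def by blast
  let ?V = "\<lambda>r. (if r \<in> R then U r else UNIV) \<inter> (if r \<in> R' then U' r else UNIV)"
  have "a \<inter> b = {\<omega>\<in>space P. \<forall>r\<in>R \<union> R'. B r \<omega> \<in> ?V r}"
    unfolding a(1) b(1) by auto
  moreover have "\<forall>r. ?V r \<in> sets borel" using a b by auto
  ultimately show "a \<inter> b \<in> cylinders t"
    unfolding cylinders_def using a b by (intro CollectI exI[of _ "R \<union> R'"] exI[of _ ?V]) auto
qed

text \<open>The values of \<open>B\<close> at finitely many times up to \<open>s\<close> are partial
  sums of increments over a common partition, because \<open>B 0\<close> vanishes. The event thus
  depends on increments before \<open>s\<close> only, and \<open>inc s h\<close> is one more member
  of the same independent family.\<close>

lemma cylinder_indep_inc:
  assumes s: "0 \<le> s" and h: "0 < h" and A: "A \<in> cylinders s" and V: "V \<in> sets borel"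
  shows "prob (A \<inter> (inc s h -` V \<inter> space P)) = prob A * prob (inc s h -` V \<inter> space P)"
proof -
  obtain R U where A: "A = {\<omega>\<in>space P. \<forall>r\<in>R. B r \<omega> \<in> U r}" "finite R" "R \<subseteq> {0..s}" "\<And>r. U r \<in> sets borel"
    using A unfolding cylinders_def by blast
  \<comment> \<open>Inserting 0 makes the telescoping sums start at \<open>B 0\<close>; inserting
    \<open>s\<close> makes the increment with index \<open>n\<close>, from \<open>xs ! n\<close> to
    \<open>s + h\<close>, exactly \<open>inc s h\<close>.\<close>
  define xs where "xs = sorted_list_of_set (insert 0 (insert s R))"
  have xs: "sorted xs" "distinct xs" "set xs = insert 0 (insert s R)"
    unfolding xs_def by (intro sorted_sorted_list_of_set distinct_sorted_list_of_set set_sorted_list_of_set finite.insertI A(2))+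
  define n where "n = length xs - 1"
  have len: "length xs = Suc n" using xs(3) unfolding n_def by (cases xs) auto
  have xs0: "xs ! 0 = 0"
  proof -
    obtain i where "i < length xs" "xs ! i = 0" using xs(3) by (metis in_set_conv_nth insertI1)
    moreover have "xs ! 0 \<le> xs ! i" using xs(1) \<open>i < length xs\<close> by (simp add: sorted_nth_mono)
    moreover have "0 \<le> xs ! 0" using xs(3) A(3) s nth_mem[of 0 xs] len by auto
    ultimately show ?thesis by simp
  qed
  have xsn: "xs ! n = s"
  proof -
    obtain i where "i < length xs" "xs ! i = s" using xs(3) by (metis in_set_conv_nth insertI1 insertI2)
    moreover have "xs ! i \<le> xs ! n" using xs(1) \<open>i < length xs\<close> len by (simp add: sorted_nth_mono)
    moreover have "xs ! n \<le> s" using xs(3) A(3) s nth_mem[of n xs] len by auto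
    ultimately show ?thesis by simp
  qed
  define p where "p i = (if i \<le> n then xs ! i else s + h)" for i
  have p0: "p 0 = 0" unfolding p_def using xs0 by simp
  have pmono: "p i \<le> p (Suc i)" if "i < Suc n" for i
    using that h xsn xs(1) len by (cases "i = n") (auto simp: p_def intro: sorted_nth_mono)
  let ?D = "\<lambda>i \<omega>. B (p (Suc i)) \<omega> - B (p i) \<omega>"
  have ind: "indep_vars (\<lambda>_. borel) ?D {..<Suc n}"
    using bm p0 pmono unfolding brownian_motion_def by auto
  have iv: "indep_var (PiM {..<n} (\<lambda>_. borel)) (\<lambda>\<omega>. restrict (\<lambda>i. ?D i \<omega>) {..<n})
     (PiM {n} (\<lambda>_. borel)) (\<lambda>\<omega>. restrict (\<lambda>i. ?D i \<omega>) {n})"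
    by (rule indep_var_restrict[OF ind]) auto
  have tele: "B (p j) \<omega> = (\<Sum>i<j. ?D i \<omega>)" if "\<omega> \<in> space P" for j \<omega>
    using sum_lessThan_telescope[of "\<lambda>i. B (p i) \<omega>" j] B_zero[OF that] p0 by simp
  define J where "J = {j. j \<le> n \<and> xs ! j \<in> R}"
  have J: "R = (\<lambda>j. xs ! j) ` J"
  proof safe
    fix r assume r: "r \<in> R"
    then obtain j where "j < length xs" "xs ! j = r" using xs(3) by (metis in_set_conv_nth insertI2)
    then show "r \<in> (!) xs ` J" using r len by (auto simp: J_def)
  qed (auto simp: J_def)
  define X where "X = {d \<in> space (PiM {..<n} (\<lambda>_. borel :: real measure)). \<forall>j\<in>J. (\<Sum>i<j. d i) \<in> U (xs ! j)}"
  have X: "X \<in> sets (PiM {..<n} (\<lambda>_. borel))"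
    unfolding X_def
  proof (rule sets.sets_Collect_finite_All)
    fix j assume j: "j \<in> J"
    have "(\<lambda>d. \<Sum>i<j. d i) \<in> borel_measurable (PiM {..<n} (\<lambda>_. borel :: real measure))"
      using j unfolding J_def by (intro borel_measurable_sum measurable_component_singleton) auto
    from measurable_sets[OF this A(4)[of "xs ! j"]]
    show "{d \<in> space (PiM {..<n} (\<lambda>_. borel)). (\<Sum>i<j. d i) \<in> U (xs ! j)} \<in> sets (PiM {..<n} (\<lambda>_. borel :: real measure))"
      by (simp add: vimage_def Int_def conj_commute)
  qed (simp add: J_def)
  define Y where "Y = {d \<in> space (PiM {n} (\<lambda>_. borel :: real measure)). d n \<in> V}"
  have Y: "Y \<in> sets (PiM {n} (\<lambda>_. borel))"
    unfolding Y_def using V by measurable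
  have eA: "(\<lambda>\<omega>. restrict (\<lambda>i. ?D i \<omega>) {..<n}) -` X \<inter> space P = A"
  proof -
    have "(\<forall>j\<in>J. (\<Sum>i<j. restrict (\<lambda>i. ?D i \<omega>) {..<n} i) \<in> U (xs ! j)) \<longleftrightarrow> (\<forall>r\<in>R. B r \<omega> \<in> U r)"
      if "\<omega> \<in> space P" for \<omega>
    proof -
      have "(\<Sum>i<j. restrict (\<lambda>i. ?D i \<omega>) {..<n} i) = B (xs ! j) \<omega>" if "j \<in> J" for j
      proof -
        have "(\<Sum>i<j. restrict (\<lambda>i. ?D i \<omega>) {..<n} i) = (\<Sum>i<j. ?D i \<omega>)"
          using that by (intro sum.cong) (auto simp: J_def)
        also have "\<dots> = B (xs ! j) \<omega>"
          using tele[OF \<open>\<omega> \<in> space P\<close>, of j] that by (simp add: p_def J_def)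
        finally show ?thesis .
      qed
      then show ?thesis unfolding J by auto
    qed
    then show ?thesis unfolding A(1) X_def by (auto simp: space_PiM)
  qed
  have eV: "(\<lambda>\<omega>. restrict (\<lambda>i. ?D i \<omega>) {n}) -` Y \<inter> space P = inc s h -` V \<inter> space P"
    unfolding Y_def using xsn by (auto simp: space_PiM p_def inc_def)
  have "(\<lambda>x. (restrict (\<lambda>i. ?D i x) {..<n}, restrict (\<lambda>i. ?D i x) {n})) -` (X \<times> Y) \<inter> space P
      = A \<inter> (inc s h -` V \<inter> space P)"
    using eA eV by blast
  then show ?thesis using indep_varD[OF iv X Y] eA eV by simp
qed

text \<open>A null set is independent of every event, and intersecting with it gives a null set
  again. Cylinders together with null sets therefore still form a pi-system, and independence
  extends to the sigma-algebra they generate.\<close>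

lemma F_indep_inc:
  assumes s: "0 \<le> s" and h: "0 < h"
  shows "indep_set (sets (F s)) {inc s h -` V \<inter> space P | V. V \<in> sets borel}"
proof -
  have inc: "inc s h \<in> borel_measurable P" using s h by (intro inc_measurable) auto
  let ?G = "null_sets P \<union> cylinders s"
  let ?H = "{inc s h -` V \<inter> space P | V. V \<in> sets borel}"
  have "indep_set ?G ?H"
  proof (rule indep_setI)
    show "?G \<subseteq> events" using cylinder_events by auto
    show "?H \<subseteq> events" using measurable_sets[OF inc] by auto
    fix a b assume "a \<in> ?G" and b: "b \<in> ?H"
    then consider "a \<in> null_sets P" | "a \<in> cylinders s" by auto
    then show "prob (a \<inter> b) = prob a * prob b"
    proof cases
      case 1
      have "a \<inter> b \<in> null_sets P" using 1 b measurable_sets[OF inc] by (auto intro: null_set_Int2)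
      then show ?thesis using 1 by (simp add: measure_eq_0_null_sets)
    next
      case 2
      then show ?thesis using cylinder_indep_inc[OF s h] b by blast
    qed
  qed
  moreover have "Int_stable ?G"
  proof (rule Int_stableI)
    fix a b assume "a \<in> ?G" "b \<in> ?G"
    then show "a \<inter> b \<in> ?G"
      using cylinder_events cylinders_Int_stable[of s]
      by (auto simp: Int_stable_def intro: null_set_Int1 null_set_Int2)
  qed
  moreover have "Int_stable ?H"
  proof (rule Int_stableI)
    fix a b assume "a \<in> ?H" "b \<in> ?H"
    then obtain V W where "a = inc s h -` V \<inter> space P" "b = inc s h -` W \<inter> space P" "V \<in> sets borel" "W \<in> sets borel" by auto
    then show "a \<inter> b \<in> ?H" by (intro CollectI exI[of _ "V \<inter> W"]) auto
  qed
  ultimately have *: "indep_set (sigma_sets (space P) ?G) (sigma_sets (space P) ?H)"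
    by (rule indep_set_sigma_sets)
  have "sets (F s) \<subseteq> sigma_sets (space P) ?G"
    unfolding sets_F
  proof (rule sigma_sets_mono)
    have "B r -` U \<inter> space P \<in> cylinders s" if "r \<in> {0..s}" "U \<in> sets borel" for r U
      unfolding cylinders_def using that by (intro CollectI exI[of _ "{r}"] exI[of _ "\<lambda>_. U"]) auto
    then show "null_sets P \<union> (\<Union>s\<in>{0..s}. {B s -` U \<inter> space P | U. U \<in> sets borel}) \<subseteq> sigma_sets (space P) ?G"
      by (auto intro: sigma_sets.Basic)
  qed
  moreover have "?H \<subseteq> sigma_sets (space P) ?H" by auto
  ultimately show ?thesis
    using * unfolding indep_sets2_eq by blast
qed

lemma indep_var_inc:
  assumes s: "0 \<le> s" and h: "0 < h" and f: "f \<in> borel_measurable (F s)" and \<psi>: "\<psi> \<in> borel_measurable borel"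
  shows "indep_var borel f borel (\<lambda>\<omega>. \<psi> (inc s h \<omega>) :: real)"
proof -
  have inc: "inc s h \<in> borel_measurable P" using s h by (intro inc_measurable) auto
  have "indep_var borel f borel (inc s h)"
    unfolding indep_var_eq
  proof (intro conjI)
    show "indep_set (sigma_sets (space P) {f -` A \<inter> space P |A. A \<in> sets borel})
     (sigma_sets (space P) {inc s h -` A \<inter> space P |A. A \<in> sets borel})"
    proof (rule indep_set_sigma_sets)
      have "{f -` A \<inter> space P |A. A \<in> sets borel} \<subseteq> sets (F s)"
        using measurable_sets[OF f] by auto
      then show "indep_set {f -` A \<inter> space P |A. A \<in> sets borel} {inc s h -` A \<inter> space P |A. A \<in> sets borel}"
        using F_indep_inc[OF s h] unfolding indep_sets2_eq by blast
      have "Int_stable {X -` A \<inter> space P |A. A \<in> sets borel}" for X :: "'a \<Rightarrow> real"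
      proof (rule Int_stableI)
        fix a b assume "a \<in> {X -` A \<inter> space P |A. A \<in> sets borel}" "b \<in> {X -` A \<inter> space P |A. A \<in> sets borel}"
        then obtain V W where "a = X -` V \<inter> space P" "b = X -` W \<inter> space P" "V \<in> sets borel" "W \<in> sets borel" by auto
        then show "a \<inter> b \<in> {X -` A \<inter> space P |A. A \<in> sets borel}" by (intro CollectI exI[of _ "V \<inter> W"]) auto
      qed
      then show "Int_stable {f -` A \<inter> space P |A. A \<in> sets borel}" "Int_stable {inc s h -` A \<inter> space P |A. A \<in> sets borel}" by auto
    qed
  qed (use measurable_F[OF f] inc in auto)
  from indep_var_compose[OF this, of id borel \<psi> borel] \<psi> show ?thesis
    by (simp add: o_def)
qed

end

section \<open>Products of independent variables and Gaussian exponential moments\<close>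

lemma (in prob_space) indep_var_nn_integral:
  fixes X Y :: "'a \<Rightarrow> ennreal"
  assumes "indep_var borel X borel Y"
  shows "(\<integral>\<^sup>+\<omega>. X \<omega> * Y \<omega> \<partial>M) = (\<integral>\<^sup>+\<omega>. X \<omega> \<partial>M) * (\<integral>\<^sup>+\<omega>. Y \<omega> \<partial>M)"
proof -
  have "indep_vars (\<lambda>_. borel) (case_bool X Y) UNIV"
  proof -
    have "(\<lambda>_. borel) = case_bool (borel :: ennreal measure) borel"
      by (rule ext) (simp split: bool.split)
    then show ?thesis using assms unfolding indep_var_def by simp
  qed
  from indep_vars_nn_integral[OF _ this] show ?thesis
    by (simp add: UNIV_bool mult.commute)
qed

text \<open>Absolute moments of independent variables factor, so an integrable product forces
  \<open>f\<close> to be integrable unless \<open>g\<close> vanishes almost surely, in which case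
  the claim is immediate. A product that is not integrable has Bochner integral 0 by
  convention.\<close>

lemma (in prob_space) expectation_indep_mult_zero:
  fixes f g :: "'a \<Rightarrow> real"
  assumes ind: "indep_var borel f borel g" and g: "integrable M g" "expectation g = 0"
  shows "expectation (\<lambda>\<omega>. f \<omega> * g \<omega>) = 0"
proof (cases "integrable M (\<lambda>\<omega>. f \<omega> * g \<omega>)")
  case True
  have [measurable]: "f \<in> borel_measurable M" "g \<in> borel_measurable M"
    using ind unfolding indep_var_eq by auto
  have "indep_var borel ((\<lambda>x. ennreal \<bar>x\<bar>) \<circ> f) borel ((\<lambda>x. ennreal \<bar>x\<bar>) \<circ> g)"
    by (rule indep_var_compose[OF ind]) auto
  from indep_var_nn_integral[OF this]
  have prod: "(\<integral>\<^sup>+\<omega>. ennreal \<bar>f \<omega> * g \<omega>\<bar> \<partial>M) = (\<integral>\<^sup>+\<omega>. ennreal \<bar>f \<omega>\<bar> \<partial>M) * (\<integral>\<^sup>+\<omega>. ennreal \<bar>g \<omega>\<bar> \<partial>M)"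
    by (simp add: abs_mult ennreal_mult)
  have fin: "(\<integral>\<^sup>+\<omega>. ennreal \<bar>f \<omega> * g \<omega>\<bar> \<partial>M) < \<infinity>"
    using True by (simp add: integrable_iff_bounded)
  show ?thesis
  proof (cases "(\<integral>\<^sup>+\<omega>. ennreal \<bar>g \<omega>\<bar> \<partial>M) = 0")
    case True
    then have "AE \<omega> in M. g \<omega> = 0" by (subst (asm) nn_integral_0_iff_AE) auto
    then have "AE \<omega> in M. f \<omega> * g \<omega> = 0" by auto
    then show ?thesis by (subst integral_cong_AE[where g="\<lambda>_. 0"]) auto
  next
    case False
    then have "(\<integral>\<^sup>+\<omega>. ennreal \<bar>f \<omega>\<bar> \<partial>M) < \<infinity>"
      using fin unfolding prod by (auto simp: ennreal_mult_less_top less_top[symmetric] ennreal_mult_eq_top_iff)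
    then have "integrable M f" by (simp add: integrable_iff_bounded)
    then show ?thesis using indep_var_lebesgue_integral[OF ind _ g(1)] g(2) by simp
  qed
qed (simp add: not_integrable_integral_eq)

text \<open>Completing the square: exponential tilting of a centred Gaussian moves its mean to
  \<open>c * h\<close> and keeps its variance. The exponential moments that follow are the mass and
  the mean of the shifted density.\<close>

lemma normal_density_exp:
  assumes h: "0 < h"
  shows "normal_density 0 (sqrt h) x * exp (c * x) = exp (c\<^sup>2 * h / 2) * normal_density (c * h) (sqrt h) x"
proof -
  have "-((x - 0)\<^sup>2) / (2 * h) + c * x = c\<^sup>2 * h / 2 + -((x - c * h)\<^sup>2) / (2 * h)"
    using h by (simp add: field_simps power2_eq_square)
  then have "exp (-((x - 0)\<^sup>2) / (2 * h)) * exp (c * x) = exp (c\<^sup>2 * h / 2) * exp (-((x - c * h)\<^sup>2) / (2 * h))"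
    by (simp only: exp_add[symmetric])
  then show ?thesis using h unfolding normal_density_def by simp
qed

lemma normal_moment_exp:
  assumes h: "0 < h"
  shows "has_bochner_integral lborel (\<lambda>x. normal_density 0 (sqrt h) x * exp (c * x)) (exp (c\<^sup>2 * h / 2))"
proof -
  have "has_bochner_integral lborel (normal_density (c * h) (sqrt h)) 1"
    using h by (simp add: has_bochner_integral_iff)
  from has_bochner_integral_mult_right[OF this, of "exp (c\<^sup>2 * h / 2)"]
  show ?thesis by (simp add: normal_density_exp[OF h])
qed

lemma normal_moment_mult_exp:
  assumes h: "0 < h"
  shows "has_bochner_integral lborel (\<lambda>x. normal_density 0 (sqrt h) x * (x * exp (c * x))) (c * h * exp (c\<^sup>2 * h / 2))"
proof -
  have "has_bochner_integral lborel (\<lambda>x. normal_density (c * h) (sqrt h) x * x) (c * h)"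
    using h by (intro normal_moment_nz_1) simp
  from has_bochner_integral_mult_right[OF this, of "exp (c\<^sup>2 * h / 2)"]
  have *: "has_bochner_integral lborel (\<lambda>x. exp (c\<^sup>2 * h / 2) * (normal_density (c * h) (sqrt h) x * x)) (c * h * exp (c\<^sup>2 * h / 2))"
    by (simp add: mult_ac)
  have "normal_density 0 (sqrt h) x * (x * exp (c * x)) = exp (c\<^sup>2 * h / 2) * (normal_density (c * h) (sqrt h) x * x)" for x
  proof -
    have "normal_density 0 (sqrt h) x * (x * exp (c * x)) = (normal_density 0 (sqrt h) x * exp (c * x)) * x" by simp
    then show ?thesis unfolding normal_density_exp[OF h] by simp
  qed
  with * show ?thesis by (simp only:)
qed

lemma normal_moment_2:
  assumes h: "0 < h"
  shows "has_bochner_integral lborel (\<lambda>x. normal_density 0 (sqrt h) x * x\<^sup>2) h"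
  using normal_moment_even[of "sqrt h" 0 1] h by (simp add: power2_eq_square)

lemma normal_moment_1:
  assumes h: "0 < h"
  shows "has_bochner_integral lborel (\<lambda>x. normal_density 0 (sqrt h) x * x) 0"
  using normal_moment_nz_1[of "sqrt h" 0] h by simp

section \<open>Averages of increments\<close>

context brownian
begin

lemma inc_has_integral:
  assumes "0 \<le> s" "0 < h" and [measurable]: "\<psi> \<in> borel_measurable borel"
    and "has_bochner_integral lborel (\<lambda>x. normal_density 0 (sqrt h) x * \<psi> x) (v :: real)"
  shows "has_bochner_integral P (\<lambda>\<omega>. \<psi> (inc s h \<omega>)) v"
  using distributed_integral[OF inc_distributed[OF assms(1,2)], of \<psi>]
    distributed_integrable[OF inc_distributed[OF assms(1,2)], of \<psi>] assms(4)
  by (auto simp: has_bochner_integral_iff)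

text \<open>By path continuity, \<open>B (s + a)\<close> is the limit of its values along the grid,
  which are jointly measurable. The measure \<open>N\<close> stands both for \<open>P\<close> and
  for a member \<open>F T\<close> of the filtration.\<close>

lemma B_joint:
  assumes sp: "space N = space P" and a: "0 \<le> a" and B: "\<And>r. r \<in> {a..t + a} \<Longrightarrow> B r \<in> borel_measurable N"
  shows "(\<lambda>(s, \<omega>). B (s + a) \<omega>) \<in> borel_measurable (leb t \<Otimes>\<^sub>M N)"
proof (rule borel_measurable_LIMSEQ_real)
  show "(\<lambda>(s, \<omega>). B (grid n s + a) \<omega>) \<in> borel_measurable (leb t \<Otimes>\<^sub>M N)" for n
    by (rule measurable_grid[OF B])
  fix x assume x: "x \<in> space (leb t \<Otimes>\<^sub>M N)"
  obtain s \<omega> where [simp]: "x = (s, \<omega>)" by (cases x)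
  have s: "0 \<le> s" "\<omega> \<in> space P" using x sp by (auto simp: space_pair_measure)
  have "(\<lambda>n. B (grid n s + a) \<omega>) \<longlonglongrightarrow> B (s + a) \<omega>"
    by (rule continuous_on_tendsto_compose[OF B_continuous[OF s(2)]])
       (use s a grid_nonneg[OF s(1)] in \<open>auto intro!: tendsto_add grid_tendsto\<close>)
  then show "(\<lambda>n. case x of (s, \<omega>) \<Rightarrow> B (grid n s + a) \<omega>) \<longlonglongrightarrow> (case x of (s, \<omega>) \<Rightarrow> B (s + a) \<omega>)"
    by simp
qed

lemma B_joint_F:
  assumes "0 \<le> a" "t + a \<le> T"
  shows "(\<lambda>(s, \<omega>). B (s + a) \<omega>) \<in> borel_measurable (leb t \<Otimes>\<^sub>M F T)"
  using assms by (intro B_joint) (auto intro: B_adapted)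

lemma B_joint_P:
  assumes "0 \<le> a"
  shows "(\<lambda>(s, \<omega>). B (s + a) \<omega>) \<in> borel_measurable (leb t \<Otimes>\<^sub>M P)"
  using assms by (intro B_joint) (auto intro: B_measurable)

lemma inc_joint_P:
  assumes "0 \<le> e"
  shows "(\<lambda>(s, \<omega>). inc s e \<omega>) \<in> borel_measurable (leb t \<Otimes>\<^sub>M P)"
  using borel_measurable_diff[OF B_joint_P[OF assms, of t] B_joint_P[of 0 t]]
  by (simp add: inc_def split_beta')

lemma inc_joint_F:
  assumes "0 \<le> e" "t + e \<le> T"
  shows "(\<lambda>(s, \<omega>). inc s e \<omega>) \<in> borel_measurable (leb t \<Otimes>\<^sub>M F T)"
  using borel_measurable_diff[OF B_joint_F[OF assms] B_joint_F[of 0 t T]] assms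
  by (simp add: inc_def split_beta')

lemma inc_continuous:
  assumes "0 \<le> e" "\<omega> \<in> space P"
  shows "continuous_on {0..t} (\<lambda>s. inc s e \<omega>)"
  unfolding inc_def using assms
  by (intro continuous_intros continuous_on_compose2[OF B_continuous[OF assms(2)]]) auto

text \<open>The kernel \<open>\<psi>\<close> is general because it occurs in two forms: the
  increment divided by \<open>e\<close>, and the centred remainder in the expansion of the
  exponential. For \<open>s + e \<le> r\<close> every factor but the last is known at time
  \<open>r\<close>, and the last is independent of \<open>F r\<close> with mean 0; this is the
  orthogonality behind the bound.\<close>

lemma second_moment_average:
  assumes u: "(\<lambda>(s, \<omega>). u s \<omega>) \<in> borel_measurable (leb t \<Otimes>\<^sub>M P)"
    and ad: "\<And>s. s \<in> {0..t} \<Longrightarrow> u s \<in> borel_measurable (F s)"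
    and t: "0 \<le> t" and e: "0 < e" and \<psi>[measurable]: "\<psi> \<in> borel_measurable borel"
    and m: "has_bochner_integral lborel (\<lambda>x. normal_density 0 (sqrt e) x * \<psi> x) 0"
    and v: "has_bochner_integral lborel (\<lambda>x. normal_density 0 (sqrt e) x * (\<psi> x)\<^sup>2) v"
  shows "(\<integral>\<^sup>+\<omega>. ennreal ((\<integral>s. u s \<omega> * \<psi> (inc s e \<omega>) \<partial>leb t)\<^sup>2) \<partial>P)
    \<le> ennreal (2 * e * v) * (\<integral>\<^sup>+s. (\<integral>\<^sup>+\<omega>. ennreal ((u s \<omega>)\<^sup>2) \<partial>P) \<partial>leb t)"
proof -
  have v0: "0 \<le> v"
    using v by (auto simp: has_bochner_integral_iff intro!: integral_nonneg)
  have "(\<integral>\<^sup>+\<omega>. ennreal ((\<integral>s. u s \<omega> * \<psi> (inc s e \<omega>) \<partial>leb t)\<^sup>2) \<partial>P)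
    \<le> ennreal (2 * e) * (\<integral>\<^sup>+s. (\<integral>\<^sup>+\<omega>. ennreal ((u s \<omega> * \<psi> (inc s e \<omega>))\<^sup>2) \<partial>P) \<partial>leb t)"
  proof (rule second_moment_time_integral[OF _ t e])
    show "(\<lambda>(s, \<omega>). u s \<omega> * \<psi> (inc s e \<omega>)) \<in> borel_measurable (leb t \<Otimes>\<^sub>M P)"
      using borel_measurable_times[OF u measurable_compose[OF inc_joint_P[of e t] \<psi>]] e
      by (simp add: split_beta')
    fix s r assume sr: "0 \<le> s" "r \<le> t" "s + e \<le> r"
    have "(\<lambda>\<omega>. \<psi> (inc s e \<omega>)) \<in> borel_measurable (F r)"
      unfolding inc_def using sr e
      by (intro measurable_compose[OF _ \<psi>] borel_measurable_diff B_adapted) auto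
    then have *: "(\<lambda>\<omega>. u s \<omega> * \<psi> (inc s e \<omega>) * u r \<omega>) \<in> borel_measurable (F r)"
      using sr e ad by (intro borel_measurable_times) (auto intro: measurable_F_mono[of s r])
    have "expectation (\<lambda>\<omega>. (u s \<omega> * \<psi> (inc s e \<omega>) * u r \<omega>) * \<psi> (inc r e \<omega>)) = 0"
      using inc_has_integral[OF _ e \<psi> m, of r] sr e
      by (intro expectation_indep_mult_zero indep_var_inc *) (auto simp: has_bochner_integral_iff)
    then show "expectation (\<lambda>\<omega>. u s \<omega> * \<psi> (inc s e \<omega>) * (u r \<omega> * \<psi> (inc r e \<omega>))) = 0"
      by (simp add: mult.assoc)
  qed
  also have "(\<integral>\<^sup>+s. (\<integral>\<^sup>+\<omega>. ennreal ((u s \<omega> * \<psi> (inc s e \<omega>))\<^sup>2) \<partial>P) \<partial>leb t)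
      = (\<integral>\<^sup>+s. ennreal v * (\<integral>\<^sup>+\<omega>. ennreal ((u s \<omega>)\<^sup>2) \<partial>P) \<partial>leb t)"
  proof (rule nn_integral_cong)
    fix s assume "s \<in> space (leb t)"
    then have s: "s \<in> {0..t}" by simp
    have "indep_var borel ((\<lambda>x. ennreal (x\<^sup>2)) \<circ> u s) borel ((\<lambda>x. ennreal (x\<^sup>2)) \<circ> (\<lambda>\<omega>. \<psi> (inc s e \<omega>)))"
      using s e by (intro indep_var_compose[OF indep_var_inc] ad) auto
    from indep_var_nn_integral[OF this]
    have "(\<integral>\<^sup>+\<omega>. ennreal ((u s \<omega> * \<psi> (inc s e \<omega>))\<^sup>2) \<partial>P) = (\<integral>\<^sup>+\<omega>. ennreal ((u s \<omega>)\<^sup>2) \<partial>P) * (\<integral>\<^sup>+\<omega>. ennreal ((\<psi> (inc s e \<omega>))\<^sup>2) \<partial>P)"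
      by (simp add: power_mult_distrib ennreal_mult)
    also have "(\<integral>\<^sup>+\<omega>. ennreal ((\<psi> (inc s e \<omega>))\<^sup>2) \<partial>P) = ennreal v"
      using inc_has_integral[OF _ e _ v, of s] s
      by (subst nn_integral_eq_integral) (auto simp: has_bochner_integral_iff)
    finally show "(\<integral>\<^sup>+\<omega>. ennreal ((u s \<omega> * \<psi> (inc s e \<omega>))\<^sup>2) \<partial>P) = ennreal v * (\<integral>\<^sup>+\<omega>. ennreal ((u s \<omega>)\<^sup>2) \<partial>P)"
      by (simp add: mult.commute)
  qed
  also have "\<dots> = ennreal v * (\<integral>\<^sup>+s. (\<integral>\<^sup>+\<omega>. ennreal ((u s \<omega>)\<^sup>2) \<partial>P) \<partial>leb t)"
  proof (rule nn_integral_cmult)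
    note [measurable] = u
    show "(\<lambda>s. \<integral>\<^sup>+\<omega>. ennreal ((u s \<omega>)\<^sup>2) \<partial>P) \<in> borel_measurable (leb t)" by measurable
  qed
  finally show ?thesis using e v0 by (simp add: ennreal_mult mult.assoc)
qed

text \<open>The averages that define the forward integral, at the widths \<open>1 / (k + 1)\<close>.
  Passing to a sequence of widths makes almost surely convergent subsequences available.\<close>

definition fwd :: "(real \<Rightarrow> 'a \<Rightarrow> real) \<Rightarrow> real \<Rightarrow> nat \<Rightarrow> 'a \<Rightarrow> real" where
  "fwd u t k \<omega> = (\<integral>s. u s \<omega> * (inc s (1 / real (Suc k)) \<omega> / (1 / real (Suc k))) \<partial>leb t)"

text \<open>An increment of width \<open>e\<close> divided by \<open>e\<close> has variance
  \<open>1 / e\<close>, which cancels the factor \<open>e\<close> of the window; hence the bound is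
  uniform in \<open>k\<close>.\<close>

lemma fwd_second_moment:
  assumes u: "(\<lambda>(s, \<omega>). u s \<omega>) \<in> borel_measurable (leb t \<Otimes>\<^sub>M P)"
    and ad: "\<And>s. s \<in> {0..t} \<Longrightarrow> u s \<in> borel_measurable (F s)"
    and t: "0 \<le> t"
  shows "(\<integral>\<^sup>+\<omega>. ennreal ((fwd u t k \<omega>)\<^sup>2) \<partial>P) \<le> 2 * (\<integral>\<^sup>+s. (\<integral>\<^sup>+\<omega>. ennreal ((u s \<omega>)\<^sup>2) \<partial>P) \<partial>leb t)"
proof -
  define e where "e = 1 / real (Suc k)"
  have e: "0 < e" by (simp add: e_def)
  have m: "has_bochner_integral lborel (\<lambda>x. normal_density 0 (sqrt e) x * (x / e)) 0"
    using has_bochner_integral_divide_zero[OF normal_moment_1[OF e], of e] by simp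
  have v: "has_bochner_integral lborel (\<lambda>x. normal_density 0 (sqrt e) x * (x / e)\<^sup>2) (1 / e)"
    using has_bochner_integral_divide_zero[OF normal_moment_2[OF e], of "e\<^sup>2"] e
    by (simp add: power_divide power2_eq_square)
  from second_moment_average[OF u ad t e _ m v] e show ?thesis
    unfolding fwd_def e_def[symmetric] by simp
qed

lemma fwd_measurable:
  assumes u: "(\<lambda>(s, \<omega>). u s \<omega>) \<in> borel_measurable (leb t \<Otimes>\<^sub>M P)"
  shows "fwd u t k \<in> borel_measurable P"
proof -
  interpret L: finite_measure "leb t" by (rule finite_measure_leb)
  have "(\<lambda>(s, \<omega>). u s \<omega> * (inc s (1 / real (Suc k)) \<omega> / (1 / real (Suc k)))) \<in> borel_measurable (leb t \<Otimes>\<^sub>M P)"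
    using borel_measurable_times[OF u borel_measurable_divide[OF inc_joint_P[of "1 / real (Suc k)" t] measurable_const[of "1 / real (Suc k)"]]]
    by (simp add: split_beta' del: of_nat_Suc)
  from measurable_compose[OF measurable_pair_swap' this]
  have "(\<lambda>(\<omega>, s). u s \<omega> * (inc s (1 / real (Suc k)) \<omega> / (1 / real (Suc k)))) \<in> borel_measurable (P \<Otimes>\<^sub>M leb t)"
    by (simp add: split_beta' del: of_nat_Suc)
  from L.borel_measurable_lebesgue_integral[OF this] show ?thesis
    unfolding fwd_def[abs_def] .
qed

end

section \<open>Geometric Brownian motion and uniqueness of the forward equation\<close>

lemma filterlim_inverse_Suc_at_right: "filterlim (\<lambda>k. 1 / real (Suc k)) (at_right 0) sequentially"
proof -
  have "(\<lambda>k. 1 / real (Suc k)) \<longlonglongrightarrow> 0"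
    by (rule LIMSEQ_Suc[OF lim_1_over_n])
  then show ?thesis
    by (auto simp: filterlim_at eventually_sequentially)
qed

lemma measurable_leb_subinterval:
  assumes "t \<le> T" and f: "f \<in> borel_measurable (leb T \<Otimes>\<^sub>M N)"
  shows "f \<in> borel_measurable (leb t \<Otimes>\<^sub>M N)"
proof -
  have "(\<lambda>s. s) \<in> measurable (leb t) (leb T)"
    by (rule measurable_restrict_space3) (use assms(1) in auto)
  then have "(\<lambda>x. (fst x, snd x)) \<in> measurable (leb t \<Otimes>\<^sub>M N) (leb T \<Otimes>\<^sub>M N)"
    by (intro measurable_Pair measurable_compose[OF measurable_fst] measurable_snd)
  from measurable_compose[OF this f] show ?thesis by simp
qed

context brownian
begin

section \<open>Geometric Brownian motion as a solution of the forward equation\<close>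

definition gbm :: "real \<Rightarrow> real \<Rightarrow> real \<Rightarrow> 'a \<Rightarrow> real" where
  "gbm \<mu> \<sigma> t \<omega> = exp ((\<mu> - \<sigma>\<^sup>2 / 2) * t + \<sigma> * B t \<omega>)"

lemma gbm_0: "\<omega> \<in> space P \<Longrightarrow> gbm \<mu> \<sigma> 0 \<omega> = 1"
  by (simp add: gbm_def B_zero)

lemma gbm_adapted: "0 \<le> s \<Longrightarrow> s \<le> t \<Longrightarrow> gbm \<mu> \<sigma> s \<in> borel_measurable (F t)"
  unfolding gbm_def[abs_def]
  by (rule measurable_compose[OF B_adapted[of s t]]) auto

lemma gbm_measurable: "0 \<le> s \<Longrightarrow> gbm \<mu> \<sigma> s \<in> borel_measurable P"
  using gbm_adapted[of s s] measurable_F by blast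

lemma gbm_continuous: "\<omega> \<in> space P \<Longrightarrow> continuous_on {0..} (\<lambda>s. gbm \<mu> \<sigma> s \<omega>)"
  unfolding gbm_def by (intro continuous_intros B_continuous)

lemma gbm_joint:
  assumes "0 \<le> a"
  shows "(\<lambda>(s, \<omega>). gbm \<mu> \<sigma> (s + a) \<omega>) \<in> borel_measurable (leb t \<Otimes>\<^sub>M P)"
proof -
  have "(\<lambda>x. B (fst x + a) (snd x)) \<in> borel_measurable (leb t \<Otimes>\<^sub>M P)"
    using B_joint_P[OF assms, of t] by (simp add: split_beta')
  moreover have "fst \<in> borel_measurable (leb t \<Otimes>\<^sub>M P)"
    by (rule measurable_compose[OF measurable_fst borel_measurable_leb[of "\<lambda>x. x"]]) simp
  ultimately show ?thesis
    unfolding gbm_def[abs_def] split_beta' by measurable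
qed

lemma B_exp_moment:
  assumes "0 \<le> t"
  shows "has_bochner_integral P (\<lambda>\<omega>. exp (c * B t \<omega>)) (exp (c\<^sup>2 * t / 2))"
proof (cases "t = 0")
  case True
  have "has_bochner_integral P (\<lambda>\<omega>. 1) (1 :: real)"
    by (simp add: has_bochner_integral_iff prob_space)
  also have "?this \<longleftrightarrow> ?thesis"
    by (rule has_bochner_integral_cong) (use True B_zero in auto)
  finally show ?thesis .
next
  case False
  then have t: "0 < t" using assms by simp
  have "has_bochner_integral P (\<lambda>\<omega>. exp (c * inc 0 t \<omega>)) (exp (c\<^sup>2 * t / 2))"
    by (rule inc_has_integral[OF _ t _ normal_moment_exp[OF t]]) auto
  also have "?this \<longleftrightarrow> ?thesis"
    by (rule has_bochner_integral_cong) (use B_zero in \<open>auto simp: inc_def\<close>)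
  finally show ?thesis .
qed

lemma gbm_expectation:
  assumes "0 \<le> t"
  shows "has_bochner_integral P (gbm \<mu> \<sigma> t) (exp (\<mu> * t))"
proof -
  have "has_bochner_integral P (\<lambda>\<omega>. exp ((\<mu> - \<sigma>\<^sup>2 / 2) * t) * exp (\<sigma> * B t \<omega>)) (exp ((\<mu> - \<sigma>\<^sup>2 / 2) * t) * exp (\<sigma>\<^sup>2 * t / 2))"
    by (intro has_bochner_integral_mult_right B_exp_moment assms)
  then show ?thesis
    by (simp add: gbm_def[abs_def] exp_add[symmetric]) (simp add: algebra_simps)
qed

lemma gbm_second_moment_finite:
  assumes "0 \<le> t"
  shows "(\<integral>\<^sup>+s. (\<integral>\<^sup>+\<omega>. ennreal ((gbm \<mu> \<sigma> s \<omega>)\<^sup>2) \<partial>P) \<partial>leb t) < \<infinity>"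
proof -
  \<comment> \<open>The second moment at time \<open>s\<close> equals
    \<open>exp ((2 * \<mu> + \<sigma>\<^sup>2) * s)\<close>; the absolute value makes the bound
    uniform up to \<open>t\<close> for either sign of the coefficient.\<close>
  define C where "C = exp (\<bar>2 * \<mu> + \<sigma>\<^sup>2\<bar> * t)"
  have "(\<integral>\<^sup>+\<omega>. ennreal ((gbm \<mu> \<sigma> s \<omega>)\<^sup>2) \<partial>P) \<le> ennreal C" if "s \<in> {0..t}" for s
  proof -
    have s: "0 \<le> s" using that by simp
    have "has_bochner_integral P (\<lambda>\<omega>. exp (2 * ((\<mu> - \<sigma>\<^sup>2 / 2) * s)) * exp ((2 * \<sigma>) * B s \<omega>)) (exp (2 * ((\<mu> - \<sigma>\<^sup>2 / 2) * s)) * exp ((2 * \<sigma>)\<^sup>2 * s / 2))"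
      by (intro has_bochner_integral_mult_right B_exp_moment s)
    also have "(\<lambda>\<omega>. exp (2 * ((\<mu> - \<sigma>\<^sup>2 / 2) * s)) * exp ((2 * \<sigma>) * B s \<omega>)) = (\<lambda>\<omega>. (gbm \<mu> \<sigma> s \<omega>)\<^sup>2)"
      by (simp add: gbm_def fun_eq_iff exp_add[symmetric] exp_double[symmetric] algebra_simps)
    also have "exp (2 * ((\<mu> - \<sigma>\<^sup>2 / 2) * s)) * exp ((2 * \<sigma>)\<^sup>2 * s / 2) = exp ((2 * \<mu> + \<sigma>\<^sup>2) * s)"
      by (simp add: exp_add[symmetric] algebra_simps power2_eq_square)
    finally have "(\<integral>\<^sup>+\<omega>. ennreal ((gbm \<mu> \<sigma> s \<omega>)\<^sup>2) \<partial>P) = ennreal (exp ((2 * \<mu> + \<sigma>\<^sup>2) * s))"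
      by (subst nn_integral_eq_integral) (auto simp: has_bochner_integral_iff)
    also have "(2 * \<mu> + \<sigma>\<^sup>2) * s \<le> \<bar>2 * \<mu> + \<sigma>\<^sup>2\<bar> * t"
      using that by (intro mult_mono) auto
    then have "ennreal (exp ((2 * \<mu> + \<sigma>\<^sup>2) * s)) \<le> ennreal C"
      unfolding C_def by (intro ennreal_leI) simp
    finally show ?thesis .
  qed
  then have "(\<integral>\<^sup>+s. (\<integral>\<^sup>+\<omega>. ennreal ((gbm \<mu> \<sigma> s \<omega>)\<^sup>2) \<partial>P) \<partial>leb t) \<le> (\<integral>\<^sup>+s. ennreal C \<partial>leb t)"
    by (intro nn_integral_mono) simp
  also have "\<dots> < \<infinity>"
    using emeasure_leb_space[OF assms] by (simp add: ennreal_mult_less_top)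
  finally show ?thesis .
qed

text \<open>A discrete form of the Ito formula: the difference quotient of \<open>Z\<close> splits
  into \<open>\<sigma> * Z s\<close> times the difference quotient of \<open>B\<close>, a drift
  \<open>c k * Z s\<close>, and \<open>Z s\<close> times a centred remainder. The averaged quotient
  of \<open>Z\<close> tends to \<open>Z t - 1\<close>, the coefficient \<open>c k\<close> tends to
  \<open>\<mu>\<close>, and the averaged remainder vanishes in mean square.\<close>

lemma gbm_forward:
  assumes t: "0 \<le> t"
  shows "tendsto_prob P (\<lambda>k \<omega>. \<sigma> * fwd (gbm \<mu> \<sigma>) t k \<omega>)
    (\<lambda>\<omega>. gbm \<mu> \<sigma> t \<omega> - 1 - \<mu> * (\<integral>s. gbm \<mu> \<sigma> s \<omega> \<partial>leb t))"
proof -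
  interpret L: finite_measure "leb t" by (rule finite_measure_leb)
  define Z where "Z = gbm \<mu> \<sigma>"
  define a where "a = \<mu> - \<sigma>\<^sup>2 / 2"
  define e where "e k = 1 / real (Suc k)" for k
  \<comment> \<open>Evaluated at an increment \<open>x\<close> of width \<open>e k\<close>,
    \<open>exp (a * e k + \<sigma> * x)\<close> has mean \<open>exp (\<mu> * e k)\<close>;
    subtracting this mean and the linear term \<open>\<sigma> * x\<close> leaves a centred
    remainder.\<close>
  define \<psi> where "\<psi> k x = (exp (a * e k) * exp (\<sigma> * x) - exp (\<mu> * e k) - \<sigma> * x) / e k" for k x
  define c where "c k = (exp (\<mu> * e k) - 1) / e k" for k
  define A where "A k \<omega> = (\<integral>s. (Z (s + e k) \<omega> - Z s \<omega>) / e k \<partial>leb t)" for k \<omega>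
  define R where "R k \<omega> = (\<integral>s. Z s \<omega> * \<psi> k (inc s (e k) \<omega>) \<partial>leb t)" for k \<omega>
  define I where "I \<omega> = (\<integral>s. Z s \<omega> \<partial>leb t)" for \<omega>
  \<comment> \<open>\<open>nu (e k)\<close> is the second moment of \<open>e k * \<psi> k\<close>:
    the variance of the exponential factor, minus twice its covariance with
    \<open>\<sigma> * x\<close>, plus the variance of \<open>\<sigma> * x\<close>.\<close>
  define nu where "nu x = exp (2 * \<mu> * x) * (exp (\<sigma>\<^sup>2 * x) - 1) - 2 * \<sigma>\<^sup>2 * x * exp (\<mu> * x) + \<sigma>\<^sup>2 * x" for x
  have e: "0 < e k" for k by (simp add: e_def)
  have elim: "filterlim e (at_right 0) sequentially"
    unfolding e_def by (rule filterlim_inverse_Suc_at_right)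
  have Zj: "(\<lambda>(s, \<omega>). Z s \<omega>) \<in> borel_measurable (leb t \<Otimes>\<^sub>M P)"
    using gbm_joint[of 0 \<mu> \<sigma> t] by (simp add: Z_def)
  have Zj': "(\<lambda>(s, \<omega>). Z (s + e k) \<omega>) \<in> borel_measurable (leb t \<Otimes>\<^sub>M P)" for k
    using gbm_joint[of "e k" \<mu> \<sigma> t] e[of k] by (simp add: Z_def)
  have Zc: "continuous_on {0..} (\<lambda>s. Z s \<omega>)" if "\<omega> \<in> space P" for \<omega>
    unfolding Z_def by (rule gbm_continuous[OF that])
  have Zct: "continuous_on {0..t} (\<lambda>s. Z s \<omega>)" if "\<omega> \<in> space P" for \<omega>
    by (rule continuous_on_subset[OF Zc[OF that]]) auto
  have mI: "I \<in> borel_measurable P"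
  proof -
    have "(\<lambda>(\<omega>, s). Z s \<omega>) \<in> borel_measurable (P \<Otimes>\<^sub>M leb t)"
      using measurable_compose[OF measurable_pair_swap' Zj] by (simp add: split_beta')
    from L.borel_measurable_lebesgue_integral[OF this] show ?thesis unfolding I_def[abs_def] .
  qed
  have mA: "A k \<in> borel_measurable P" for k
  proof -
    have "(\<lambda>x. (Z (fst x + e k) (snd x) - Z (fst x) (snd x)) / e k) \<in> borel_measurable (leb t \<Otimes>\<^sub>M P)"
      using Zj Zj'[of k] by (simp add: split_beta')
    from measurable_compose[OF measurable_pair_swap' this]
    have "(\<lambda>(\<omega>, s). (Z (s + e k) \<omega> - Z s \<omega>) / e k) \<in> borel_measurable (P \<Otimes>\<^sub>M leb t)"
      by (simp add: split_beta')
    from L.borel_measurable_lebesgue_integral[OF this] show ?thesis unfolding A_def[abs_def] .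
  qed
  have \<psi>m[measurable]: "\<psi> k \<in> borel_measurable borel" for k
    unfolding \<psi>_def[abs_def] by measurable
  have mR: "R k \<in> borel_measurable P" for k
  proof -
    have "(\<lambda>x. Z (fst x) (snd x) * \<psi> k (inc (fst x) (e k) (snd x))) \<in> borel_measurable (leb t \<Otimes>\<^sub>M P)"
      using borel_measurable_times[OF Zj measurable_compose[OF inc_joint_P[of "e k" t] \<psi>m[of k]]] e[of k]
      by (simp add: split_beta')
    from measurable_compose[OF measurable_pair_swap' this]
    have "(\<lambda>(\<omega>, s). Z s \<omega> * \<psi> k (inc s (e k) \<omega>)) \<in> borel_measurable (P \<Otimes>\<^sub>M leb t)"
      by (simp add: split_beta')
    from L.borel_measurable_lebesgue_integral[OF this] show ?thesis unfolding R_def[abs_def] .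
  qed
  have decomp: "\<sigma> * fwd Z t k \<omega> = A k \<omega> + (- R k \<omega>) + (- (c k * I \<omega>))" if w: "\<omega> \<in> space P" for k \<omega>
  proof -
    have ic: "continuous_on {0..t} (\<lambda>s. inc s (e k) \<omega>)"
      by (rule inc_continuous) (use e[of k] w in auto)
    have i1: "integrable (leb t) (\<lambda>s. Z s \<omega> * \<psi> k (inc s (e k) \<omega>))"
      unfolding \<psi>_def using e[of k]
      by (intro integrable_leb_continuous continuous_intros ic Zct w) auto
    have i2: "integrable (leb t) (\<lambda>s. Z s \<omega>)"
      by (intro integrable_leb_continuous Zct w)
    have i3: "integrable (leb t) (\<lambda>s. Z s \<omega> * (inc s (e k) \<omega> / e k))"
      using e[of k] by (intro integrable_leb_continuous continuous_intros ic Zct w) auto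
    have gen: "(\<integral>s. f s + b * g s + d * h s \<partial>leb t) = (\<integral>s. f s \<partial>leb t) + b * (\<integral>s. g s \<partial>leb t) + d * (\<integral>s. h s \<partial>leb t)"
      if "integrable (leb t) f" "integrable (leb t) g" "integrable (leb t) h" for f g h :: "real \<Rightarrow> real" and b d
      using that by simp
    have "(Z (s + e k) \<omega> - Z s \<omega>) / e k = Z s \<omega> * \<psi> k (inc s (e k) \<omega>) + c k * Z s \<omega> + \<sigma> * (Z s \<omega> * (inc s (e k) \<omega> / e k))" for s
    proof -
      have "Z (s + e k) \<omega> = Z s \<omega> * (exp (a * e k) * exp (\<sigma> * inc s (e k) \<omega>))"
        unfolding Z_def gbm_def inc_def a_def by (simp add: exp_add[symmetric] algebra_simps)
      then show ?thesis unfolding \<psi>_def c_def using e[of k]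
        by (simp add: field_simps)
    qed
    then have "A k \<omega> = (\<integral>s. Z s \<omega> * \<psi> k (inc s (e k) \<omega>) + c k * Z s \<omega> + \<sigma> * (Z s \<omega> * (inc s (e k) \<omega> / e k)) \<partial>leb t)"
      unfolding A_def by simp
    also have "\<dots> = R k \<omega> + c k * I \<omega> + \<sigma> * fwd Z t k \<omega>"
      unfolding R_def I_def fwd_def e_def[symmetric] by (rule gen[OF i1 i2 i3])
    finally show ?thesis by simp
  qed
  have tA: "tendsto_prob P A (\<lambda>\<omega>. Z t \<omega> - 1)"
  proof (rule tendsto_prob_if_AE[OF finite_measure_axioms _ mA])
    show "(\<lambda>\<omega>. Z t \<omega> - 1) \<in> borel_measurable P"
      using gbm_measurable[OF t] unfolding Z_def by simp
    have "(\<lambda>k. A k \<omega>) \<longlonglongrightarrow> Z t \<omega> - 1" if w: "\<omega> \<in> space P" for \<omega>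
      using filterlim_compose[OF tendsto_average_difference[OF Zc[OF w] _ t] elim] gbm_0[OF w, of \<mu> \<sigma>]
      by (simp add: A_def lebesgue_integral_leb Z_def)
    then show "AE \<omega> in P. (\<lambda>k. A k \<omega>) \<longlonglongrightarrow> Z t \<omega> - 1" by auto
  qed
  have climit: "c \<longlonglongrightarrow> \<mu>"
  proof -
    have "((\<lambda>x. exp (\<mu> * x)) has_real_derivative exp (\<mu> * 0) * \<mu>) (at 0)"
      by (auto intro!: derivative_eq_intros)
    then have "((\<lambda>x. (exp (\<mu> * x) - 1) / x) \<longlongrightarrow> \<mu>) (at 0)"
      by (simp add: has_field_derivative_iff)
    then have "((\<lambda>x. (exp (\<mu> * x) - 1) / x) \<longlongrightarrow> \<mu>) (at_right 0)"
      by (rule filterlim_mono[OF _ order_refl at_le]) simp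
    from filterlim_compose[OF this elim] show ?thesis unfolding c_def .
  qed
  have tC: "tendsto_prob P (\<lambda>k \<omega>. - (c k * I \<omega>)) (\<lambda>\<omega>. - (\<mu> * I \<omega>))"
    by (rule tendsto_prob_if_AE[OF finite_measure_axioms]) (use mI in \<open>auto intro!: tendsto_intros climit\<close>)
  \<comment> \<open>Both \<open>nu\<close> and its derivative vanish at 0, as the first-order parts
    of the three terms cancel; so the factor \<open>2 * nu (e k) / e k\<close> in the bound for the
    remainder tends to 0.\<close>
  have nulim: "(\<lambda>k. 2 * (nu (e k) / e k)) \<longlonglongrightarrow> 0"
  proof -
    have "(nu has_real_derivative 0) (at 0)"
      unfolding nu_def[abs_def] by (auto intro!: derivative_eq_intros simp: algebra_simps)
    then have "((\<lambda>x. nu x / x) \<longlongrightarrow> 0) (at 0)"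
      by (simp add: has_field_derivative_iff nu_def)
    then have "((\<lambda>x. nu x / x) \<longlongrightarrow> 0) (at_right 0)"
      by (rule filterlim_mono[OF _ order_refl at_le]) simp
    from tendsto_mult_right_zero[OF filterlim_compose[OF this elim], of 2] show ?thesis by simp
  qed
  have Rbound: "(\<integral>\<^sup>+\<omega>. ennreal ((R k \<omega>)\<^sup>2) \<partial>P) \<le> ennreal (2 * (nu (e k) / e k)) * (\<integral>\<^sup>+s. (\<integral>\<^sup>+\<omega>. ennreal ((Z s \<omega>)\<^sup>2) \<partial>P) \<partial>leb t)" for k
  proof -
    let ?n = "\<lambda>x. normal_density 0 (sqrt (e k)) x"
    have expq: "exp (a * e k) * exp (\<sigma>\<^sup>2 * e k / 2) = exp (\<mu> * e k)"
      unfolding a_def by (simp add: exp_add[symmetric] algebra_simps)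
    have one: "has_bochner_integral lborel ?n 1"
      using e[of k] by (simp add: has_bochner_integral_iff)
    note m1 = normal_moment_1[OF e[of k]] and m2 = normal_moment_2[OF e[of k]]
      and me = normal_moment_exp[OF e[of k], of \<sigma>] and me2 = normal_moment_exp[OF e[of k], of "2 * \<sigma>"]
      and mxe = normal_moment_mult_exp[OF e[of k], of \<sigma>]
    have mean: "has_bochner_integral lborel (\<lambda>x. ?n x * \<psi> k x) 0"
    proof -
      let ?L = "\<lambda>x. (exp (a * e k) * (?n x * exp (\<sigma> * x)) - exp (\<mu> * e k) * ?n x - \<sigma> * (?n x * x)) / e k"
      have "has_bochner_integral lborel ?L
          ((exp (a * e k) * exp (\<sigma>\<^sup>2 * e k / 2) - exp (\<mu> * e k) * 1 - \<sigma> * 0) / e k)"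
        using e[of k] by (intro has_bochner_integral_divide_zero has_bochner_integral_diff has_bochner_integral_mult_right me one m1)
      also have "?L = (\<lambda>x. ?n x * \<psi> k x)"
        unfolding \<psi>_def using e[of k] by (simp add: fun_eq_iff field_simps)
      finally show ?thesis unfolding expq by simp
    qed
    have var: "has_bochner_integral lborel (\<lambda>x. ?n x * (\<psi> k x)\<^sup>2) (nu (e k) / (e k)\<^sup>2)"
    proof -
      define q where "q = exp (a * e k)"
      define m where "m = exp (\<mu> * e k)"
      let ?L = "\<lambda>x. (q\<^sup>2 * (?n x * exp (2 * \<sigma> * x)) + m\<^sup>2 * ?n x + \<sigma>\<^sup>2 * (?n x * x\<^sup>2)
            - (2 * m * q) * (?n x * exp (\<sigma> * x)) - (2 * \<sigma> * q) * (?n x * (x * exp (\<sigma> * x))) + (2 * \<sigma> * m) * (?n x * x)) / (e k)\<^sup>2"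
      let ?R = "q\<^sup>2 * exp ((2 * \<sigma>)\<^sup>2 * e k / 2) + m\<^sup>2 * 1 + \<sigma>\<^sup>2 * e k - (2 * m * q) * exp (\<sigma>\<^sup>2 * e k / 2)
            - (2 * \<sigma> * q) * (\<sigma> * e k * exp (\<sigma>\<^sup>2 * e k / 2)) + (2 * \<sigma> * m) * 0"
      have "has_bochner_integral lborel ?L (?R / (e k)\<^sup>2)"
        by (intro has_bochner_integral_divide_zero has_bochner_integral_diff has_bochner_integral_add has_bochner_integral_mult_right me me2 mxe one m1 m2)
      also have "?L = (\<lambda>x. ?n x * (\<psi> k x)\<^sup>2)"
      proof
        fix x
        have "exp (2 * \<sigma> * x) = (exp (\<sigma> * x))\<^sup>2" by (simp add: exp_double[symmetric] mult.assoc)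
        then show "?L x = ?n x * (\<psi> k x)\<^sup>2"
          unfolding \<psi>_def q_def[symmetric] m_def[symmetric] power_divide
          by (simp add: algebra_simps power2_eq_square)
      qed
      also have "?R = nu (e k)"
      proof -
        have qm: "q * exp (\<sigma>\<^sup>2 * e k / 2) = m" using expq unfolding q_def m_def .
        have a1: "q\<^sup>2 * exp ((2 * \<sigma>)\<^sup>2 * e k / 2) = exp (2 * \<mu> * e k) * exp (\<sigma>\<^sup>2 * e k)"
          unfolding q_def a_def by (simp add: exp_double[symmetric] exp_add[symmetric] algebra_simps power2_eq_square)
        have a2: "m\<^sup>2 = exp (2 * \<mu> * e k)" unfolding m_def by (simp add: exp_double[symmetric] mult.assoc)
        have a3: "(2 * m * q) * exp (\<sigma>\<^sup>2 * e k / 2) = 2 * m\<^sup>2"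
          using qm by (simp add: power2_eq_square)
        have a4: "(2 * \<sigma> * q) * (\<sigma> * e k * exp (\<sigma>\<^sup>2 * e k / 2)) = 2 * \<sigma>\<^sup>2 * e k * m"
          unfolding qm[symmetric] by (simp add: power2_eq_square)
        show ?thesis
          by (simp only: a1 a3 a4) (simp add: nu_def m_def[symmetric] a2 algebra_simps)
      qed
      finally show ?thesis .
    qed
    have "2 * e k * (nu (e k) / (e k)\<^sup>2) = 2 * (nu (e k) / e k)"
      using e[of k] by (simp add: power2_eq_square)
    with second_moment_average[OF Zj _ t e[of k] \<psi>m mean var] gbm_adapted show ?thesis
      unfolding R_def Z_def by simp
  qed
  have tR: "tendsto_prob P (\<lambda>k \<omega>. - R k \<omega>) (\<lambda>_. 0)"
  proof (rule tendsto_prob_if_tendsto_L2)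
    let ?C = "\<integral>\<^sup>+s. (\<integral>\<^sup>+\<omega>. ennreal ((Z s \<omega>)\<^sup>2) \<partial>P) \<partial>leb t"
    have C: "?C < \<infinity>" unfolding Z_def by (rule gbm_second_moment_finite[OF t])
    have "(\<lambda>k. ?C * ennreal (2 * (nu (e k) / e k))) \<longlonglongrightarrow> ?C * ennreal 0"
      by (rule ennreal_tendsto_cmult[OF _ tendsto_ennrealI[OF nulim]]) (use C in simp)
    then have "(\<lambda>k. ennreal (2 * (nu (e k) / e k)) * ?C) \<longlonglongrightarrow> 0"
      by (simp add: mult.commute)
    then have "(\<lambda>k. \<integral>\<^sup>+\<omega>. ennreal ((R k \<omega>)\<^sup>2) \<partial>P) \<longlonglongrightarrow> 0"
      by (rule tendsto_sandwich[OF _ _ tendsto_const, rotated 2]) (use Rbound in auto)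
    then show "tendsto_L2 P (\<lambda>k \<omega>. - R k \<omega>) (\<lambda>_. 0)"
      unfolding tendsto_L2_def by simp
  qed
  have "tendsto_prob P (\<lambda>k \<omega>. A k \<omega> + (- R k \<omega>) + (- (c k * I \<omega>))) (\<lambda>\<omega>. (Z t \<omega> - 1) + 0 + (- (\<mu> * I \<omega>)))"
    using mA mR mI gbm_measurable[OF t, of \<mu> \<sigma>]
    by (intro tendsto_prob_add tA tR tC) (auto simp: Z_def)
  also have "?this \<longleftrightarrow> ?thesis"
    unfolding Z_def[symmetric] I_def[symmetric]
    by (rule tendsto_prob_cong_AE) (auto simp: decomp)
  finally show ?thesis .
qed

text \<open>Uniqueness for the linear equation started at 0. The events \<open>E N\<close> localise
  without stopping times: cutting \<open>D\<close> off outside \<open>E N\<close> gives a bounded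
  adapted process \<open>K\<close>, and since \<open>E N\<close> shrinks in time, on
  \<open>E N t\<close> it coincides with \<open>D\<close> throughout \<open>[0, t]\<close>. The
  second moment of \<open>K\<close> then satisfies a Gronwall inequality, and almost every path
  satisfies \<open>E N T\<close> for some \<open>N\<close>.\<close>

lemma linear_forward_zero:
  fixes D :: "real \<Rightarrow> 'a \<Rightarrow> real" and E :: "nat \<Rightarrow> real \<Rightarrow> 'a \<Rightarrow> bool"
  assumes D: "(\<lambda>(s, \<omega>). D s \<omega>) \<in> borel_measurable (leb T \<Otimes>\<^sub>M P)"
    and Dad: "\<And>s. s \<in> {0..T} \<Longrightarrow> D s \<in> borel_measurable (F s)"
    and E: "\<And>N. {x \<in> space (leb T \<Otimes>\<^sub>M P). E N (fst x) (snd x)} \<in> sets (leb T \<Otimes>\<^sub>M P)"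
    and Ead: "\<And>N s. s \<in> {0..T} \<Longrightarrow> {\<omega> \<in> space P. E N s \<omega>} \<in> sets (F s)"
    and Edec: "\<And>N s t \<omega>. 0 \<le> s \<Longrightarrow> s \<le> t \<Longrightarrow> E N t \<omega> \<Longrightarrow> E N s \<omega>"
    and bd: "\<And>N s \<omega>. E N s \<omega> \<Longrightarrow> \<bar>D s \<omega>\<bar> \<le> real N"
    and exh: "AE \<omega> in P. \<exists>N. E N T \<omega>"
    and eq: "\<And>t. t \<in> {0..T} \<Longrightarrow> \<exists>r::nat \<Rightarrow> nat. AE \<omega> in P.
        (\<lambda>k. \<sigma> * fwd D t (r k) \<omega>) \<longlonglongrightarrow> D t \<omega> - \<mu> * (\<integral>s. D s \<omega> \<partial>leb t)"
    and t: "t \<in> {0..T}"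
  shows "AE \<omega> in P. D t \<omega> = 0"
proof -
  have K0: "AE \<omega> in P. (if E N t \<omega> then D t \<omega> else 0) = 0" for N
  proof -
    define K where "K s \<omega> = (if E N s \<omega> then D s \<omega> else 0)" for s \<omega>
    define g where "g s = (\<integral>\<^sup>+\<omega>. ennreal ((K s \<omega>)\<^sup>2) \<partial>P)" for s
    have Kj: "(\<lambda>(s, \<omega>). K s \<omega>) \<in> borel_measurable (leb T \<Otimes>\<^sub>M P)"
      unfolding K_def split_beta' using D E[of N]
      by (intro measurable_If) (auto simp: split_beta')
    have Kad: "K s \<in> borel_measurable (F s)" if "s \<in> {0..T}" for s
      unfolding K_def[abs_def] using Dad[OF that] Ead[OF that, of N]
      by (intro measurable_If) auto
    have Kbd: "(K s \<omega>)\<^sup>2 \<le> (real N)\<^sup>2" for s \<omega>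
      using bd[of N s \<omega>] by (auto simp: K_def abs_le_square_iff[symmetric])
    \<comment> \<open>The constant collects \<open>2 * \<mu>\<^sup>2 * T\<close> from Cauchy-Schwarz
      in time and \<open>4 * \<sigma>\<^sup>2\<close> from the forward averages, with one factor 2
      from splitting the square and one from the second moment bound.\<close>
    have "g t = 0"
    proof (rule gronwall_zero[where T=T and C="2 * \<mu>\<^sup>2 * T + 4 * \<sigma>\<^sup>2" and b="(real N)\<^sup>2"])
      fix t assume t: "t \<in> {0..T}"
      then have t0: "0 \<le> t" by simp
      interpret L: finite_measure "leb t" by (rule finite_measure_leb)
      interpret LP: pair_sigma_finite "leb t" P ..
      have Kj': "(\<lambda>(s, \<omega>). K s \<omega>) \<in> borel_measurable (leb t \<Otimes>\<^sub>M P)"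
        by (rule measurable_leb_subinterval[OF _ Kj]) (use t in simp)
      have Kjs: "(\<lambda>(\<omega>, s). K s \<omega>) \<in> borel_measurable (P \<Otimes>\<^sub>M leb t)"
        using measurable_compose[OF measurable_pair_swap' Kj'] by (simp add: split_beta')
      have Kw: "(\<lambda>s. K s \<omega>) \<in> borel_measurable (leb t)" if "\<omega> \<in> space P" for \<omega>
        using measurable_compose[OF measurable_Pair2'[of \<omega> P "leb t"] Kj'] that by simp
      have KI[measurable]: "(\<lambda>\<omega>. \<integral>s. K s \<omega> \<partial>leb t) \<in> borel_measurable P"
        by (rule L.borel_measurable_lebesgue_integral[OF Kjs])
      have Kf[measurable]: "fwd K t k \<in> borel_measurable P" for k
        by (rule fwd_measurable[OF Kj'])
      obtain r :: "nat \<Rightarrow> nat" where r: "AE \<omega> in P. (\<lambda>k. \<sigma> * fwd D t (r k) \<omega>) \<longlonglongrightarrow> D t \<omega> - \<mu> * (\<integral>s. D s \<omega> \<partial>leb t)"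
        using eq[OF t] by blast
      let ?G = "\<integral>\<^sup>+s. g s \<partial>leb t"
      \<comment> \<open>The averages of \<open>K\<close> converge only on \<open>E N t\<close>,
        hence the liminf, to which Fatou applies below. Off \<open>E N t\<close> the left-hand side
        is 0.\<close>
      have "AE \<omega> in P. ennreal ((K t \<omega>)\<^sup>2) \<le> ennreal (2 * \<mu>\<^sup>2) * ennreal ((\<integral>s. K s \<omega> \<partial>leb t)\<^sup>2)
          + 2 * liminf (\<lambda>k. ennreal ((\<sigma> * fwd K t (r k) \<omega>)\<^sup>2))"
        using r
      proof eventually_elim
        case (elim \<omega>)
        show ?case
        proof (cases "E N t \<omega>")
          case True
          have KD: "K s \<omega> = D s \<omega>" if "s \<in> {0..t}" for s
            using Edec[of s t N \<omega>] True that by (simp add: K_def)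
          have "fwd K t k \<omega> = fwd D t k \<omega>" for k
            unfolding fwd_def by (rule Bochner_Integration.integral_cong) (auto simp: KD)
          moreover have I: "(\<integral>s. K s \<omega> \<partial>leb t) = (\<integral>s. D s \<omega> \<partial>leb t)"
            by (rule Bochner_Integration.integral_cong) (auto simp: KD)
          ultimately have "(\<lambda>k. \<sigma> * fwd K t (r k) \<omega>) \<longlonglongrightarrow> K t \<omega> - \<mu> * (\<integral>s. K s \<omega> \<partial>leb t)"
            using elim KD[of t] t0 by simp
          from tendsto_ennrealI[OF tendsto_power[OF this, of 2]]
          have "liminf (\<lambda>k. ennreal ((\<sigma> * fwd K t (r k) \<omega>)\<^sup>2)) = ennreal ((K t \<omega> - \<mu> * (\<integral>s. K s \<omega> \<partial>leb t))\<^sup>2)"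
            by (intro lim_imp_Liminf) auto
          \<comment> \<open>With \<open>x\<close> for \<open>K t\<close> and \<open>y\<close> for
            the drift term this reads
            \<open>x\<^sup>2 \<le> 2 * y\<^sup>2 + 2 * (x - y)\<^sup>2\<close>, which is
            \<open>0 \<le> (x - 2 * y)\<^sup>2\<close> rearranged.\<close>
          moreover have "(K t \<omega>)\<^sup>2 \<le> 2 * \<mu>\<^sup>2 * (\<integral>s. K s \<omega> \<partial>leb t)\<^sup>2 + 2 * (K t \<omega> - \<mu> * (\<integral>s. K s \<omega> \<partial>leb t))\<^sup>2"
            using zero_le_power2[of "K t \<omega> - 2 * \<mu> * (\<integral>s. K s \<omega> \<partial>leb t)"]
            by (simp add: power2_eq_square algebra_simps)
          from ennreal_leI[OF this] have "ennreal ((K t \<omega>)\<^sup>2) \<le> ennreal (2 * \<mu>\<^sup>2) * ennreal ((\<integral>s. K s \<omega> \<partial>leb t)\<^sup>2) + 2 * ennreal ((K t \<omega> - \<mu> * (\<integral>s. K s \<omega> \<partial>leb t))\<^sup>2)"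
            by (subst (asm) ennreal_plus) (auto simp: ennreal_mult)
          ultimately show ?thesis by simp
        qed (simp add: K_def)
      qed
      then have "g t \<le> (\<integral>\<^sup>+\<omega>. ennreal (2 * \<mu>\<^sup>2) * ennreal ((\<integral>s. K s \<omega> \<partial>leb t)\<^sup>2)
          + 2 * liminf (\<lambda>k. ennreal ((\<sigma> * fwd K t (r k) \<omega>)\<^sup>2)) \<partial>P)"
        unfolding g_def by (rule nn_integral_mono_AE)
      also have "\<dots> = ennreal (2 * \<mu>\<^sup>2) * (\<integral>\<^sup>+\<omega>. ennreal ((\<integral>s. K s \<omega> \<partial>leb t)\<^sup>2) \<partial>P)
          + 2 * (\<integral>\<^sup>+\<omega>. liminf (\<lambda>k. ennreal ((\<sigma> * fwd K t (r k) \<omega>)\<^sup>2)) \<partial>P)"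
        by (subst nn_integral_add) (auto simp: nn_integral_cmult)
      also have "(\<integral>\<^sup>+\<omega>. ennreal ((\<integral>s. K s \<omega> \<partial>leb t)\<^sup>2) \<partial>P) \<le> ennreal t * ?G"
      proof -
        have "(\<integral>\<^sup>+\<omega>. ennreal ((\<integral>s. K s \<omega> \<partial>leb t)\<^sup>2) \<partial>P) \<le> (\<integral>\<^sup>+\<omega>. emeasure (leb t) (space (leb t)) * (\<integral>\<^sup>+s. ennreal ((K s \<omega>)\<^sup>2) \<partial>leb t) \<partial>P)"
          by (intro nn_integral_mono nn_square_integral_le finite_measure_leb Kw)
        also have "\<dots> = ennreal t * (\<integral>\<^sup>+\<omega>. (\<integral>\<^sup>+s. ennreal ((K s \<omega>)\<^sup>2) \<partial>leb t) \<partial>P)"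
          unfolding emeasure_leb_space[OF t0] using Kjs by (subst nn_integral_cmult) auto
        also have "(\<integral>\<^sup>+\<omega>. (\<integral>\<^sup>+s. ennreal ((K s \<omega>)\<^sup>2) \<partial>leb t) \<partial>P) = ?G"
          unfolding g_def by (rule LP.Fubini') (use Kj' in measurable)
        finally show ?thesis .
      qed
      also have "(\<integral>\<^sup>+\<omega>. liminf (\<lambda>k. ennreal ((\<sigma> * fwd K t (r k) \<omega>)\<^sup>2)) \<partial>P)
          \<le> liminf (\<lambda>k. \<integral>\<^sup>+\<omega>. ennreal ((\<sigma> * fwd K t (r k) \<omega>)\<^sup>2) \<partial>P)"
        by (rule nn_integral_liminf) measurable
      also have "\<dots> \<le> ennreal (\<sigma>\<^sup>2) * (2 * ?G)"
      proof (rule Liminf_le)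
        have "(\<integral>\<^sup>+\<omega>. ennreal ((\<sigma> * fwd K t k \<omega>)\<^sup>2) \<partial>P) = ennreal (\<sigma>\<^sup>2) * (\<integral>\<^sup>+\<omega>. ennreal ((fwd K t k \<omega>)\<^sup>2) \<partial>P)" for k
          by (subst nn_integral_cmult[symmetric]) (auto simp: power_mult_distrib ennreal_mult)
        moreover have "(\<integral>\<^sup>+\<omega>. ennreal ((fwd K t k \<omega>)\<^sup>2) \<partial>P) \<le> 2 * ?G" for k
          unfolding g_def by (rule fwd_second_moment[OF Kj' _ t0]) (use Kad t in auto)
        ultimately show "\<forall>\<^sub>F k in sequentially. (\<integral>\<^sup>+\<omega>. ennreal ((\<sigma> * fwd K t (r k) \<omega>)\<^sup>2) \<partial>P) \<le> ennreal (\<sigma>\<^sup>2) * (2 * ?G)"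
          by (auto intro!: always_eventually mult_left_mono)
      qed simp
      also have "ennreal (2 * \<mu>\<^sup>2) * (ennreal t * ?G) + 2 * (ennreal (\<sigma>\<^sup>2) * (2 * ?G)) = ennreal (2 * \<mu>\<^sup>2 * t + 4 * \<sigma>\<^sup>2) * ?G"
      proof -
        have "2 * (ennreal (\<sigma>\<^sup>2) * (2 * ?G)) = ennreal (4 * \<sigma>\<^sup>2) * ?G"
          by (simp add: ennreal_mult mult_ac)
        moreover have "ennreal (2 * \<mu>\<^sup>2) * (ennreal t * ?G) = ennreal (2 * \<mu>\<^sup>2 * t) * ?G"
          using t0 by (simp add: ennreal_mult mult.assoc)
        ultimately show ?thesis using t0 by (simp add: distrib_right[symmetric])
      qed
      also have "\<dots> \<le> ennreal (2 * \<mu>\<^sup>2 * T + 4 * \<sigma>\<^sup>2) * ?G"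
        using t by (intro mult_right_mono ennreal_leI add_right_mono mult_left_mono) auto
      finally show "g t \<le> ennreal (2 * \<mu>\<^sup>2 * T + 4 * \<sigma>\<^sup>2) * ?G"
        by (blast intro: add_left_mono add_right_mono mult_left_mono zero_le)
    next
      fix t show "g t \<le> ennreal ((real N)\<^sup>2)"
      proof -
        have "g t \<le> (\<integral>\<^sup>+\<omega>. ennreal ((real N)\<^sup>2) \<partial>P)"
          unfolding g_def by (intro nn_integral_mono ennreal_leI Kbd)
        then show ?thesis by (simp add: emeasure_space_1)
      qed
    qed (use t in auto)
    then have "AE \<omega> in P. K t \<omega> = 0"
      unfolding g_def using measurable_F[OF Kad[OF t]] by (subst (asm) nn_integral_0_iff_AE) auto
    then show ?thesis by (simp add: K_def)
  qed
  have "AE \<omega> in P. \<forall>N. (if E N t \<omega> then D t \<omega> else 0) = 0"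
    using K0 by (simp add: AE_all_countable)
  with exh show ?thesis
  proof eventually_elim
    case (elim \<omega>)
    then obtain N where "E N T \<omega>" by blast
    then have "E N t \<omega>" using Edec[of t T N \<omega>] t by simp
    then show ?case using elim(2) by metis
  qed
qed

end

section \<open>Regularisation from rational times\<close>

lemma sets_Collect_tendsto:
  fixes f :: "nat \<Rightarrow> 'b \<Rightarrow> real"
  assumes [measurable]: "\<And>k. f k \<in> borel_measurable N" "l \<in> borel_measurable N"
  shows "{x \<in> space N. (\<lambda>k. f k x) \<longlonglongrightarrow> l x} \<in> sets N"
proof -
  have "(\<lambda>k. f k x) \<longlonglongrightarrow> l x \<longleftrightarrow> (\<forall>m::nat. \<exists>n. \<forall>k\<ge>n. \<bar>f k x - l x\<bar> < 1 / real (Suc m))" for x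
  proof
    assume "(\<lambda>k. f k x) \<longlonglongrightarrow> l x"
    then show "\<forall>m::nat. \<exists>n. \<forall>k\<ge>n. \<bar>f k x - l x\<bar> < 1 / real (Suc m)"
      unfolding LIMSEQ_def dist_real_def by auto
  next
    assume *: "\<forall>m::nat. \<exists>n. \<forall>k\<ge>n. \<bar>f k x - l x\<bar> < 1 / real (Suc m)"
    show "(\<lambda>k. f k x) \<longlonglongrightarrow> l x"
      unfolding LIMSEQ_def dist_real_def
    proof safe
      fix e :: real assume "0 < e"
      then obtain m where "1 / real (Suc m) < e" using nat_approx_posE by blast
      then show "\<exists>no. \<forall>n\<ge>no. \<bar>f n x - l x\<bar> < e" using * by (meson less_trans)
    qed
  qed
  then show ?thesis by simp
qed

text \<open>Only values at rational times up to \<open>s\<close> enter, so that a bound at those countably many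
  times, which is an event of the filtration, bounds the value at \<open>s\<close> for every path.\<close>

definition left_reg :: "(real \<Rightarrow> 'a \<Rightarrow> real) \<Rightarrow> real \<Rightarrow> 'a \<Rightarrow> real" where
  "left_reg d s \<omega> = (if Cauchy (\<lambda>n. d (grid n s) \<omega>) then lim (\<lambda>n. d (grid n s) \<omega>) else 0)"

lemma left_reg_joint:
  assumes d: "\<And>q. q \<in> {0..t} \<Longrightarrow> d q \<in> borel_measurable N"
  shows "(\<lambda>(s, \<omega>). left_reg d s \<omega>) \<in> borel_measurable (leb t \<Otimes>\<^sub>M N)"
proof -
  have [measurable]: "(\<lambda>x. d (grid n (fst x)) (snd x)) \<in> borel_measurable (leb t \<Otimes>\<^sub>M N)" for n
    using measurable_grid[of 0 t d N n] d by (simp add: split_beta')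
  show ?thesis unfolding left_reg_def split_beta' by measurable
qed

lemma left_reg_measurable:
  assumes s: "0 \<le> s" and d: "\<And>q. q \<in> {0..s} \<Longrightarrow> d q \<in> borel_measurable N"
  shows "left_reg d s \<in> borel_measurable N"
proof -
  have [measurable]: "d (grid n s) \<in> borel_measurable N" for n
    by (rule d) (use s grid_le grid_nonneg in auto)
  show ?thesis unfolding left_reg_def[abs_def] by measurable
qed

lemma left_reg_bound:
  assumes "\<And>q. q \<in> \<rat> \<Longrightarrow> q \<le> s \<Longrightarrow> \<bar>d q \<omega>\<bar> \<le> C" "0 \<le> C"
  shows "\<bar>left_reg d s \<omega>\<bar> \<le> C"
proof (cases "Cauchy (\<lambda>n. d (grid n s) \<omega>)")
  case True
  then have "(\<lambda>n. d (grid n s) \<omega>) \<longlonglongrightarrow> left_reg d s \<omega>"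
    unfolding left_reg_def by (simp add: Cauchy_convergent_iff convergent_LIMSEQ_iff)
  then have "(\<lambda>n. \<bar>d (grid n s) \<omega>\<bar>) \<longlonglongrightarrow> \<bar>left_reg d s \<omega>\<bar>"
    by (rule tendsto_rabs)
  then show ?thesis
    by (rule LIMSEQ_le_const2) (use assms(1) grid_in_Rats grid_le in blast)
qed (simp add: left_reg_def assms)

lemma left_reg_eq:
  assumes "(\<lambda>n. d (grid n s) \<omega>) \<longlonglongrightarrow> l"
  shows "left_reg d s \<omega> = l"
  unfolding left_reg_def using assms LIMSEQ_imp_Cauchy limI by auto

context brownian
begin

text \<open>An average of width \<open>1 / (k + 1)\<close> up to time \<open>t\<close> reads
  \<open>B\<close> up to time \<open>t + 1 / (k + 1)\<close>. This look-ahead decides in which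
  member of the filtration a limit of averages lies.\<close>

lemma fwd_measurable_F:
  assumes u: "(\<lambda>(s, \<omega>). u s \<omega>) \<in> borel_measurable (leb t \<Otimes>\<^sub>M F T)" and T: "t + 1 / real (Suc k) \<le> T"
  shows "fwd u t k \<in> borel_measurable (F T)"
proof -
  interpret L: finite_measure "leb t" by (rule finite_measure_leb)
  have "(\<lambda>(s, \<omega>). u s \<omega> * (inc s (1 / real (Suc k)) \<omega> / (1 / real (Suc k)))) \<in> borel_measurable (leb t \<Otimes>\<^sub>M F T)"
    using borel_measurable_times[OF u borel_measurable_divide[OF inc_joint_F[OF _ T] measurable_const[of "1 / real (Suc k)"]]]
    by (simp add: split_beta' del: of_nat_Suc)
  from measurable_compose[OF measurable_pair_swap' this]
  have "(\<lambda>(\<omega>, s). u s \<omega> * (inc s (1 / real (Suc k)) \<omega> / (1 / real (Suc k)))) \<in> borel_measurable (F T \<Otimes>\<^sub>M leb t)"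
    by (simp add: split_beta' del: of_nat_Suc)
  from L.borel_measurable_lebesgue_integral[OF this] show ?thesis
    unfolding fwd_def[abs_def] .
qed

text \<open>The equation is transferred from \<open>A\<close> to the whole space, where the increments of \<open>B\<close> are
  independent of the past: all events involved are in \<open>F t\<close> for some \<open>t < T\<close>, and no such event
  can be negligible on \<open>A\<close> without being negligible.\<close>

lemma forward_unique:
  fixes X :: "real \<Rightarrow> 'a \<Rightarrow> real"
  assumes T: "0 < T"
    and tr: "\<And>t N. 0 \<le> t \<Longrightarrow> t < T \<Longrightarrow> N \<in> sets (F t) \<Longrightarrow> AE \<omega> in P. \<omega> \<in> A \<longrightarrow> \<omega> \<in> N \<Longrightarrow> AE \<omega> in P. \<omega> \<in> N"
    and Xj: "(\<lambda>(s, \<omega>). X s \<omega>) \<in> borel_measurable (leb T \<Otimes>\<^sub>M P)"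
    and Xg: "\<And>t. t \<in> {0..T} \<Longrightarrow> \<exists>g\<in>borel_measurable (F t). AE \<omega> in P. \<omega> \<in> A \<longrightarrow> g \<omega> = X t \<omega>"
    and Xc: "AE \<omega> in P. continuous_on {0..T} (\<lambda>t. X t \<omega>)"
    and X0: "AE \<omega> in P. \<omega> \<in> A \<longrightarrow> X 0 \<omega> = x0"
    and eq: "\<And>t. t \<in> {0..T} \<Longrightarrow> \<exists>I\<in>borel_measurable P. tendsto_prob P (fwd X t) I \<and>
        (AE \<omega> in P. X t \<omega> = X 0 \<omega> + \<mu> * (\<integral>s. X s \<omega> \<partial>leb t) + \<sigma> * I \<omega>)"
  shows "AE \<omega> in P. \<omega> \<in> A \<longrightarrow> X T \<omega> = x0 * gbm \<mu> \<sigma> T \<omega>"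
proof -
  obtain g where g: "\<And>t. t \<in> {0..T} \<Longrightarrow> g t \<in> borel_measurable (F t)"
    "\<And>t. t \<in> {0..T} \<Longrightarrow> AE \<omega> in P. \<omega> \<in> A \<longrightarrow> g t \<omega> = X t \<omega>"
    using Xg by metis
  define Z where "Z = gbm \<mu> \<sigma>"
  \<comment> \<open>The difference between the solution and the candidate, formed with the adapted
    versions \<open>g q\<close>. It is the true difference only on \<open>A\<close>, for almost
    every path at all rational times of \<open>{0..T}\<close> at once.\<close>
  define d where "d q \<omega> = (if q \<in> {0..T} then g q \<omega> - x0 * Z q \<omega> else 0)" for q \<omega>
  define D where "D = left_reg d"
  \<comment> \<open>Quantifying over rational times up to \<open>s\<close> makes this an event of
    \<open>F s\<close> that shrinks as \<open>s\<close> grows.\<close>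
  define E where "E N s \<omega> \<longleftrightarrow> (\<forall>q\<in>\<rat>. 0 \<le> q \<and> q \<le> s \<longrightarrow> \<bar>d q \<omega>\<bar> \<le> real N)" for N :: nat and s \<omega>
  have dm: "d q \<in> borel_measurable (F t)" if "0 \<le> q" "q \<le> t" for q t
  proof (cases "q \<le> T")
    case True
    have "g q \<in> borel_measurable (F t)" "Z q \<in> borel_measurable (F t)"
      using g(1)[of q] True that measurable_F_mono[of q t] gbm_adapted[of q t] by (auto simp: Z_def)
    then show ?thesis unfolding d_def[abs_def] by simp
  qed (simp add: d_def[abs_def])
  have dmP: "d q \<in> borel_measurable P" for q
    using dm[of q q] measurable_F by (cases "0 \<le> q") (auto simp: d_def[abs_def])
  define good where "good \<omega> \<longleftrightarrow> \<omega> \<in> space P \<and> continuous_on {0..T} (\<lambda>t. X t \<omega>) \<and>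
    (\<omega> \<in> A \<longrightarrow> X 0 \<omega> = x0 \<and> (\<forall>q\<in>\<rat>. q \<in> {0..T} \<longrightarrow> g q \<omega> = X q \<omega>))" for \<omega>
  have good: "AE \<omega> in P. good \<omega>"
  proof -
    have "AE \<omega> in P. \<omega> \<in> A \<longrightarrow> q \<in> {0..T} \<longrightarrow> g q \<omega> = X q \<omega>" for q
      using g(2)[of q] by (cases "q \<in> {0..T}") auto
    then have "AE \<omega> in P. \<forall>q\<in>\<rat>. \<omega> \<in> A \<longrightarrow> q \<in> {0..T} \<longrightarrow> g q \<omega> = X q \<omega>"
      by (intro iffD2[OF AE_ball_countable[OF countable_rat]] ballI)
    with Xc X0 AE_space show ?thesis
      by eventually_elim (auto simp: good_def)
  qed
  have cD: "continuous_on {0..T} (\<lambda>s. X s \<omega> - x0 * Z s \<omega>)" if "good \<omega>" for \<omega>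
    using that gbm_continuous[of \<omega> \<mu> \<sigma>] unfolding good_def Z_def
    by (auto intro!: continuous_intros intro: continuous_on_subset)
  have dX: "d q \<omega> = X q \<omega> - x0 * Z q \<omega>" if "good \<omega>" "\<omega> \<in> A" "q \<in> \<rat>" "q \<in> {0..T}" for q \<omega>
    using that by (auto simp: good_def d_def)
  \<comment> \<open>On a good path in \<open>A\<close> the difference \<open>X - x0 * Z\<close> is
    continuous and agrees with \<open>d\<close> at rational times, so the limit along the grid
    returns it at every time.\<close>
  have DX: "D s \<omega> = X s \<omega> - x0 * Z s \<omega>" if w: "good \<omega>" "\<omega> \<in> A" and s: "s \<in> {0..T}" for s \<omega>
    unfolding D_def
  proof (rule left_reg_eq)
    have gr: "grid n s \<in> {0..T}" for n using grid_le[of n s] grid_nonneg[of s n] s by auto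
    have "(\<lambda>n. X (grid n s) \<omega> - x0 * Z (grid n s) \<omega>) \<longlonglongrightarrow> X s \<omega> - x0 * Z s \<omega>"
      by (rule continuous_on_tendsto_compose[OF cD[OF w(1)] grid_tendsto s]) (use gr in simp)
    then show "(\<lambda>n. d (grid n s) \<omega>) \<longlonglongrightarrow> X s \<omega> - x0 * Z s \<omega>"
      using dX[OF w grid_in_Rats gr] by simp
  qed
  have Ebound: "\<exists>N. E N T \<omega>" if w: "good \<omega>" "\<omega> \<in> A" for \<omega>
  proof -
    have "bounded ((\<lambda>s. X s \<omega> - x0 * Z s \<omega>) ` {0..T})"
      by (intro compact_imp_bounded compact_continuous_image cD w) simp
    then obtain C where C: "\<forall>s\<in>{0..T}. \<bar>X s \<omega> - x0 * Z s \<omega>\<bar> \<le> C"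
      by (auto simp: bounded_iff)
    obtain N :: nat where "C \<le> real N" using real_arch_simple by blast
    then have "E N T \<omega>" unfolding E_def using dX[OF w] C by (metis atLeastAtMost_iff order_trans)
    then show ?thesis ..
  qed
  have Dzero: "AE \<omega> in P. D t1 \<omega> = 0" if t1: "0 \<le> t1" "t1 < T" for t1
  proof (rule linear_forward_zero[where E=E and T=t1 and \<mu>=\<mu> and \<sigma>=\<sigma>])
    show "(\<lambda>(s, \<omega>). D s \<omega>) \<in> borel_measurable (leb t1 \<Otimes>\<^sub>M P)"
      unfolding D_def by (rule left_reg_joint[OF dmP])
    show "D s \<in> borel_measurable (F s)" if "s \<in> {0..t1}" for s
      unfolding D_def using that by (intro left_reg_measurable dm) auto
    show "{x \<in> space (leb t1 \<Otimes>\<^sub>M P). E N (fst x) (snd x)} \<in> sets (leb t1 \<Otimes>\<^sub>M P)" for N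
      unfolding E_def
    proof (rule sets.sets_Collect_countable_All'[OF _ countable_rat])
      fix q :: real
      have "(\<lambda>x. fst x) \<in> borel_measurable (leb t1 \<Otimes>\<^sub>M P)"
        by (rule measurable_compose[OF measurable_fst borel_measurable_leb[of "\<lambda>x. x"]]) simp
      moreover have "(\<lambda>x. d q (snd x)) \<in> borel_measurable (leb t1 \<Otimes>\<^sub>M P)"
        by (rule measurable_compose[OF measurable_snd dmP])
      ultimately show "{x \<in> space (leb t1 \<Otimes>\<^sub>M P). 0 \<le> q \<and> q \<le> fst x \<longrightarrow> \<bar>d q (snd x)\<bar> \<le> real N} \<in> sets (leb t1 \<Otimes>\<^sub>M P)"
        by measurable
    qed
    have Em: "{\<omega> \<in> space P. E N s \<omega>} \<in> sets (F s)" for N s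
    proof -
      have "{\<omega> \<in> space (F s). \<forall>q\<in>\<rat>. 0 \<le> q \<and> q \<le> s \<longrightarrow> \<bar>d q \<omega>\<bar> \<le> real N} \<in> sets (F s)"
      proof (rule sets.sets_Collect_countable_All'[OF _ countable_rat])
        fix q :: real
        show "{\<omega> \<in> space (F s). 0 \<le> q \<and> q \<le> s \<longrightarrow> \<bar>d q \<omega>\<bar> \<le> real N} \<in> sets (F s)"
        proof (cases "0 \<le> q \<and> q \<le> s")
          case True
          then have [measurable]: "d q \<in> borel_measurable (F s)" using dm by simp
          show ?thesis by measurable
        next
          case False
          then show ?thesis by (simp only: simp_thms) (metis (no_types, lifting) Collect_cong sets.top Collect_mem_eq)
        qed
      qed
      then show ?thesis by (simp add: E_def)
    qed
    then show "{\<omega> \<in> space P. E N s \<omega>} \<in> sets (F s)" if "s \<in> {0..t1}" for N s .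
    show "E N t \<omega> \<Longrightarrow> E N s \<omega>" if "0 \<le> s" "s \<le> t" for N s t \<omega>
      using that by (auto simp: E_def)
    show "\<bar>D s \<omega>\<bar> \<le> real N" if "E N s \<omega>" for N s \<omega>
      unfolding D_def
    proof (rule left_reg_bound)
      fix q :: real assume "q \<in> \<rat>" "q \<le> s"
      then show "\<bar>d q \<omega>\<bar> \<le> real N" using that by (cases "0 \<le> q") (auto simp: E_def d_def)
    qed simp
    \<comment> \<open>Continuity bounds the difference only on \<open>A\<close>. The union of the
      events over \<open>N\<close> lies in \<open>F t1\<close>, so the transfer removes this
      restriction.\<close>
    show "AE \<omega> in P. \<exists>N. E N t1 \<omega>"
    proof -
      have "{\<omega> \<in> space P. \<exists>N. E N t1 \<omega>} = (\<Union>N. {\<omega> \<in> space P. E N t1 \<omega>})" by auto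
      also have "\<dots> \<in> sets (F t1)" using Em by auto
      finally have "AE \<omega> in P. \<omega> \<in> {\<omega> \<in> space P. \<exists>N. E N t1 \<omega>}"
      proof (rule tr[OF t1])
        show "AE \<omega> in P. \<omega> \<in> A \<longrightarrow> \<omega> \<in> {\<omega> \<in> space P. \<exists>N. E N t1 \<omega>}"
          using good
        proof eventually_elim
          case (elim \<omega>)
          have "\<exists>N. E N t1 \<omega>" if "\<omega> \<in> A"
            using Ebound[OF elim that] t1 unfolding E_def by (meson less_imp_le order_trans)
          then show ?case using elim by (auto simp: good_def)
        qed
      qed
      then show ?thesis by auto
    qed
    show "\<exists>r::nat \<Rightarrow> nat. AE \<omega> in P. (\<lambda>k. \<sigma> * fwd D t (r k) \<omega>) \<longlonglongrightarrow> D t \<omega> - \<mu> * (\<integral>s. D s \<omega> \<partial>leb t)"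
      if t: "t \<in> {0..t1}" for t
    proof -
      have tT: "t \<in> {0..T}" "0 \<le> t" "t \<le> T" using t t1 by auto
      interpret L: finite_measure "leb t" by (rule finite_measure_leb)
      obtain I where I[measurable]: "I \<in> borel_measurable P" and lim: "tendsto_prob P (fwd X t) I"
        and Xeq: "AE \<omega> in P. X t \<omega> = X 0 \<omega> + \<mu> * (\<integral>s. X s \<omega> \<partial>leb t) + \<sigma> * I \<omega>"
        using eq[OF tT(1)] by blast
      define LZ where "LZ \<omega> = Z t \<omega> - 1 - \<mu> * (\<integral>s. Z s \<omega> \<partial>leb t)" for \<omega>
      have Zj: "(\<lambda>(s, \<omega>). Z s \<omega>) \<in> borel_measurable (leb t \<Otimes>\<^sub>M P)"
        using gbm_joint[of 0 \<mu> \<sigma> t] by (simp add: Z_def)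
      have mLZ[measurable]: "LZ \<in> borel_measurable P"
      proof -
        have "(\<lambda>(\<omega>, s). Z s \<omega>) \<in> borel_measurable (P \<Otimes>\<^sub>M leb t)"
          using measurable_compose[OF measurable_pair_swap' Zj] by (simp add: split_beta')
        from L.borel_measurable_lebesgue_integral[OF this] show ?thesis
          unfolding LZ_def[abs_def] using gbm_measurable[OF tT(2), of \<mu> \<sigma>] by (simp add: Z_def)
      qed
      have mfX[measurable]: "fwd X t k \<in> borel_measurable P" for k
        by (rule fwd_measurable[OF measurable_leb_subinterval[OF tT(3) Xj]])
      have mfZ[measurable]: "fwd Z t k \<in> borel_measurable P" for k
        by (rule fwd_measurable[OF Zj])
      have "tendsto_prob P (\<lambda>k \<omega>. \<sigma> * fwd X t k \<omega> + (- x0) * (\<sigma> * fwd Z t k \<omega>)) (\<lambda>\<omega>. \<sigma> * I \<omega> + (- x0) * LZ \<omega>)"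
      proof (intro tendsto_prob_add tendsto_prob_cmult lim)
        show "tendsto_prob P (\<lambda>k \<omega>. \<sigma> * fwd Z t k \<omega>) LZ"
          using gbm_forward[OF tT(2), of \<sigma> \<mu>] by (simp add: Z_def LZ_def[abs_def])
      qed auto
      from tendsto_prob_AE_subseq[OF finite_measure_axioms this] obtain r :: "nat \<Rightarrow> nat"
        where r: "strict_mono r" and
        rlim: "AE \<omega> in P. (\<lambda>k. \<sigma> * fwd X t (r k) \<omega> + (- x0) * (\<sigma> * fwd Z t (r k) \<omega>)) \<longlonglongrightarrow> \<sigma> * I \<omega> + (- x0) * LZ \<omega>"
        by auto
      \<comment> \<open>An intermediate horizon: the transfer needs the averages up to
        \<open>t \<le> t1\<close> to be measurable at a time before \<open>T\<close>, and discarding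
        the first \<open>k0\<close> indices keeps their look-ahead within \<open>T'\<close>.\<close>
      define T' where "T' = (t1 + T) / 2"
      have T': "t1 < T'" "T' < T" "0 \<le> T'" using t1 by (auto simp: T'_def)
      obtain k0 where k0: "1 / real (Suc k0) < T' - t" using nat_approx_posE[of "T' - t"] T' t by auto
      define r' where "r' k = r (k + k0)" for k
      have step: "t + 1 / real (Suc (r' k)) \<le> T'" for k
      proof -
        have "k0 \<le> r' k" unfolding r'_def using seq_suble[OF r, of "k + k0"] by simp
        then have "1 / real (Suc (r' k)) \<le> 1 / real (Suc k0)" by (simp add: frac_le)
        then show ?thesis using k0 by simp
      qed
      have DjF: "(\<lambda>(s, \<omega>). D s \<omega>) \<in> borel_measurable (leb t \<Otimes>\<^sub>M F T')"
        unfolding D_def by (rule left_reg_joint, rule dm) (use t T' in auto)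
      have fD: "fwd D t (r' k) \<in> borel_measurable (F T')" for k
        by (rule fwd_measurable_F[OF DjF step])
      have iD: "(\<lambda>\<omega>. \<integral>s. D s \<omega> \<partial>leb t) \<in> borel_measurable (F T')"
      proof -
        have "(\<lambda>(\<omega>, s). D s \<omega>) \<in> borel_measurable (F T' \<Otimes>\<^sub>M leb t)"
          using measurable_compose[OF measurable_pair_swap' DjF] by (simp add: split_beta')
        from L.borel_measurable_lebesgue_integral[OF this] show ?thesis .
      qed
      have Dt: "D t \<in> borel_measurable (F T')"
        unfolding D_def by (rule left_reg_measurable[OF tT(2)], rule dm) (use t T' in auto)
      let ?C = "{\<omega> \<in> space (F T'). (\<lambda>k. \<sigma> * fwd D t (r' k) \<omega>) \<longlonglongrightarrow> D t \<omega> - \<mu> * (\<integral>s. D s \<omega> \<partial>leb t)}"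
      have lset: "?C \<in> sets (F T')"
        using fD iD Dt by (intro sets_Collect_tendsto) auto
      \<comment> \<open>On \<open>A\<close> the required convergence is the equation for
        \<open>X\<close> minus the one for \<open>x0 * Z\<close>; the initial values cancel since
        both start at \<open>x0\<close>. The transfer then yields it almost everywhere.\<close>
      have "AE \<omega> in P. \<omega> \<in> ?C"
      proof (rule tr[OF T'(3,2) lset], use good Xeq rlim in eventually_elim, rule impI)
        fix \<omega> assume w: "good \<omega>" "\<omega> \<in> A" and xeq: "X t \<omega> = X 0 \<omega> + \<mu> * (\<integral>s. X s \<omega> \<partial>leb t) + \<sigma> * I \<omega>"
          and lim: "(\<lambda>k. \<sigma> * fwd X t (r k) \<omega> + (- x0) * (\<sigma> * fwd Z t (r k) \<omega>)) \<longlonglongrightarrow> \<sigma> * I \<omega> + (- x0) * LZ \<omega>"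
        have wP: "\<omega> \<in> space P" using w by (simp add: good_def)
        have cX: "continuous_on {0..t} (\<lambda>s. X s \<omega>)" and cZ: "continuous_on {0..t} (\<lambda>s. Z s \<omega>)"
          using w tT gbm_continuous[OF wP, of \<mu> \<sigma>] unfolding good_def Z_def
          by (auto intro: continuous_on_subset)
        have DXt: "D s \<omega> = X s \<omega> - x0 * Z s \<omega>" if "s \<in> {0..t}" for s
          using DX[OF w, of s] that tT by simp
        have intD: "(\<integral>s. D s \<omega> \<partial>leb t) = (\<integral>s. X s \<omega> \<partial>leb t) - x0 * (\<integral>s. Z s \<omega> \<partial>leb t)"
        proof -
          have "(\<integral>s. D s \<omega> \<partial>leb t) = (\<integral>s. X s \<omega> - x0 * Z s \<omega> \<partial>leb t)"
            by (rule Bochner_Integration.integral_cong) (auto simp: DXt)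
          then show ?thesis using integrable_leb_continuous[OF cX] integrable_leb_continuous[OF cZ] by simp
        qed
        have fwdD: "fwd D t k \<omega> = fwd X t k \<omega> - x0 * fwd Z t k \<omega>" for k
        proof -
          let ?h = "\<lambda>s. inc s (1 / real (Suc k)) \<omega> / (1 / real (Suc k))"
          have ch: "continuous_on {0..t} ?h"
            by (intro continuous_intros inc_continuous wP) auto
          have i: "integrable (leb t) (\<lambda>s. X s \<omega> * ?h s)" "integrable (leb t) (\<lambda>s. Z s \<omega> * ?h s)"
            by (intro integrable_leb_continuous continuous_on_mult cX cZ ch)+
          have "fwd D t k \<omega> = (\<integral>s. X s \<omega> * ?h s - x0 * (Z s \<omega> * ?h s) \<partial>leb t)"
            unfolding fwd_def by (rule Bochner_Integration.integral_cong) (auto simp: DXt algebra_simps)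
          also have "\<dots> = (\<integral>s. X s \<omega> * ?h s \<partial>leb t) - (\<integral>s. x0 * (Z s \<omega> * ?h s) \<partial>leb t)"
            by (rule Bochner_Integration.integral_diff[OF i(1) integrable_mult_right[OF i(2)]])
          finally show ?thesis unfolding fwd_def by simp
        qed
        have "(\<lambda>k. \<sigma> * fwd X t (r' k) \<omega> + (- x0) * (\<sigma> * fwd Z t (r' k) \<omega>)) \<longlonglongrightarrow> \<sigma> * I \<omega> + (- x0) * LZ \<omega>"
          unfolding r'_def using LIMSEQ_ignore_initial_segment[OF lim, of k0] .
        moreover have "\<sigma> * fwd X t (r' k) \<omega> + (- x0) * (\<sigma> * fwd Z t (r' k) \<omega>) = \<sigma> * fwd D t (r' k) \<omega>" for k
          unfolding fwdD by (simp add: algebra_simps)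
        moreover have "\<sigma> * I \<omega> + (- x0) * LZ \<omega> = D t \<omega> - \<mu> * (\<integral>s. D s \<omega> \<partial>leb t)"
          unfolding intD LZ_def using xeq DXt[of t] tT w by (simp add: good_def algebra_simps)
        ultimately show "\<omega> \<in> ?C"
          using wP by simp
      qed
      then show ?thesis by (intro exI[of _ r']) auto
    qed
  qed (use t1 in auto)
  \<comment> \<open>At these times, which increase to \<open>T\<close>, the difference vanishes on
    \<open>A\<close>; continuity carries this to \<open>T\<close> itself, which the transfer cannot
    reach.\<close>
  define tn where "tn n = T * (1 - 1 / real (Suc n))" for n
  have tn: "0 \<le> tn n" "tn n < T" for n using T by (auto simp: tn_def field_simps)
  have tnlim: "tn \<longlonglongrightarrow> T"
  proof -
    have "tn \<longlonglongrightarrow> T * (1 - 0)"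
      unfolding tn_def[abs_def] by (intro tendsto_intros LIMSEQ_Suc[OF lim_1_over_n])
    then show ?thesis by simp
  qed
  have "AE \<omega> in P. \<forall>n. D (tn n) \<omega> = 0"
    using Dzero[OF tn] by (simp add: AE_all_countable)
  with good show ?thesis
  proof eventually_elim
    case (elim \<omega>)
    show ?case
    proof
      assume w: "\<omega> \<in> A"
      have tT: "tn n \<in> {0..T}" for n using tn[of n] by simp
      have "(\<lambda>n. X (tn n) \<omega> - x0 * Z (tn n) \<omega>) \<longlonglongrightarrow> X T \<omega> - x0 * Z T \<omega>"
        by (rule continuous_on_tendsto_compose[OF cD[OF elim(1)] tnlim]) (use T tT in auto)
      then have "(\<lambda>n. 0) \<longlonglongrightarrow> X T \<omega> - x0 * Z T \<omega>"
        using DX[OF elim(1) w tT] elim(2) by simp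
      then show "X T \<omega> = x0 * gbm \<mu> \<sigma> T \<omega>"
        by (simp add: LIMSEQ_const_iff Z_def)
    qed
  qed
qed

end

section \<open>Ito and forward integrals as limits of averages\<close>

lemma nn_integral_pos_lborel:
  fixes f :: "real \<Rightarrow> real"
  assumes f: "\<And>x. 0 < f x" and [measurable]: "f \<in> borel_measurable borel" "V \<in> sets borel"
    and V: "emeasure lborel V \<noteq> 0"
  shows "(\<integral>\<^sup>+x. ennreal (f x) * indicator V x \<partial>lborel) \<noteq> 0"
proof
  assume "(\<integral>\<^sup>+x. ennreal (f x) * indicator V x \<partial>lborel) = 0"
  then have "AE x in lborel. ennreal (f x) * indicator V x = 0"
    by (subst (asm) nn_integral_0_iff_AE) auto
  then have "AE x in lborel. x \<notin> V"
    using f by (auto simp: less_le_not_le indicator_def ennreal_eq_0_iff split: if_splits elim!: eventually_mono)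
  then have "V \<in> null_sets lborel"
    by (subst (asm) AE_iff_null_sets[symmetric]) auto
  then show False using V by auto
qed

lemma exp_ode_unique:
  fixes f :: "real \<Rightarrow> real"
  assumes T: "0 \<le> T" and f: "\<And>t. t \<in> {0..T} \<Longrightarrow> (f has_real_derivative \<rho> * f t) (at t within {0..T})"
  shows "f T = f 0 * exp (\<rho> * T)"
proof -
  have "((\<lambda>t. f t * exp (- \<rho> * t)) has_real_derivative 0) (at t within {0..T})" if "t \<in> {0..T}" for t
    using f[OF that] by (auto intro!: derivative_eq_intros)
  from has_field_derivative_zero_constant[OF _ this] obtain c
    where "\<And>t. t \<in> {0..T} \<Longrightarrow> f t * exp (- \<rho> * t) = c" by auto
  from this[of 0] this[of T] T have "f T * exp (- \<rho> * T) = f 0" by simp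
  then show ?thesis by (simp add: exp_minus field_simps)
qed

lemma integral_leb_indicator:
  fixes f :: "real \<Rightarrow> real"
  assumes "t \<le> T"
  shows "(\<integral>s. indicator {0..t} s * f s \<partial>leb T) = (\<integral>s. f s \<partial>leb t)"
proof -
  have eq: "indicat_real {0..T} s *\<^sub>R (indicator {0..t} s * f s) = indicat_real {0..t} s *\<^sub>R f s" for s
    using assms by (auto simp: indicator_def)
  show ?thesis
    unfolding lebesgue_integral_leb set_lebesgue_integral_def eq ..
qed

text \<open>A solution of the integral equation that is merely integrable has to be identified. Its
  difference \<open>d\<close> to the exponential satisfies the equation with initial value 0, so the
  iterated inequality applies to the absolute value of \<open>d\<close>.\<close>

lemma gronwall_exp:
  fixes m :: "real \<Rightarrow> real"
  assumes T: "0 \<le> T" and \<mu>: "0 \<le> \<mu>" and m: "integrable (leb T) m"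
    and eq: "\<And>t. t \<in> {0..T} \<Longrightarrow> m t = m0 + \<mu> * (\<integral>s. m s \<partial>leb t)"
  shows "m T = m0 * exp (\<mu> * T)"
proof -
  have mt: "integrable (leb t) m" if "t \<in> {0..T}" for t
    using set_integrable_subset[of lborel "{0..T}" m "{0..t}"] m that unfolding integrable_leb_iff by auto
  define d where "d t = m t - m0 * exp (\<mu> * t)" for t
  have ie: "integrable (leb t) (\<lambda>s. exp (\<mu> * s))" for t
    by (intro integrable_leb_continuous continuous_intros)
  have expint: "\<mu> * (\<integral>s. exp (\<mu> * s) \<partial>leb t) = exp (\<mu> * t) - 1" if "0 \<le> t" for t
  proof -
    have "(\<integral>s. \<mu> * exp (\<mu> * s) \<partial>leb t) = (\<integral>s. (\<mu> * exp (\<mu> * s)) * indicator {0..t} s \<partial>lborel)"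
      unfolding lebesgue_integral_leb set_lebesgue_integral_def by (simp add: mult.commute)
    also have "\<dots> = exp (\<mu> * t) - exp (\<mu> * 0)"
      by (rule integral_FTC_Icc_nonneg) (use that \<mu> in \<open>auto intro!: derivative_eq_intros\<close>)
    finally show ?thesis by simp
  qed
  have deq: "d t = \<mu> * (\<integral>s. d s \<partial>leb t)" if t: "t \<in> {0..T}" for t
  proof -
    have "(\<integral>s. d s \<partial>leb t) = (\<integral>s. m s \<partial>leb t) - m0 * (\<integral>s. exp (\<mu> * s) \<partial>leb t)"
      unfolding d_def using mt[OF t] ie by simp
    then have 1: "\<mu> * (\<integral>s. d s \<partial>leb t) = \<mu> * (\<integral>s. m s \<partial>leb t) - m0 * (\<mu> * (\<integral>s. exp (\<mu> * s) \<partial>leb t))"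
      by (metis right_diff_distrib mult.left_commute)
    have "d t = (m0 + \<mu> * (\<integral>s. m s \<partial>leb t)) - m0 * (\<mu> * (\<integral>s. exp (\<mu> * s) \<partial>leb t) + 1)"
      using eq[OF t] expint[of t] t by (simp add: d_def)
    also have "\<dots> = \<mu> * (\<integral>s. m s \<partial>leb t) - m0 * (\<mu> * (\<integral>s. exp (\<mu> * s) \<partial>leb t))"
      by (simp add: distrib_left)
    finally show ?thesis using 1 by simp
  qed
  have id: "integrable (leb t) d" if "t \<in> {0..T}" for t
    unfolding d_def[abs_def] using mt[OF that] ie by simp
  have le: "ennreal \<bar>d t\<bar> \<le> ennreal \<mu> * (\<integral>\<^sup>+s. ennreal \<bar>d s\<bar> \<partial>leb t)" if t: "t \<in> {0..T}" for t
  proof -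
    have "ennreal \<bar>d t\<bar> = ennreal \<mu> * ennreal \<bar>\<integral>s. d s \<partial>leb t\<bar>"
      using deq[OF t] \<mu> by (simp add: abs_mult ennreal_mult[symmetric])
    also have "\<dots> \<le> ennreal \<mu> * (\<integral>\<^sup>+s. ennreal \<bar>d s\<bar> \<partial>leb t)"
      using integral_norm_bound_ennreal[OF id[OF t]] by (intro mult_left_mono) auto
    finally show ?thesis .
  qed
  \<comment> \<open>The uniform bound that starts the iteration comes from the equation itself,
    through the L1 norm of \<open>d\<close> on \<open>{0..T}\<close>.\<close>
  have bd: "ennreal \<bar>d t\<bar> \<le> ennreal (\<mu> * (\<integral>s. \<bar>d s\<bar> \<partial>leb T))" if t: "t \<in> {0..T}" for t
  proof -
    note le[OF t]
    also have "(\<integral>\<^sup>+s. ennreal \<bar>d s\<bar> \<partial>leb t) \<le> (\<integral>\<^sup>+s. ennreal \<bar>d s\<bar> \<partial>leb T)"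
      unfolding nn_integral_leb using t by (intro nn_integral_mono) (auto simp: indicator_def)
    also have "\<dots> = ennreal (\<integral>s. \<bar>d s\<bar> \<partial>leb T)"
      using T id by (intro nn_integral_eq_integral) auto
    finally show ?thesis using \<mu> by (simp add: ennreal_mult mult_left_mono)
  qed
  have "ennreal \<bar>d T\<bar> = 0"
    by (rule gronwall_zero[OF le bd]) (use T \<mu> in \<open>auto intro!: mult_nonneg_nonneg integral_nonneg\<close>)
  then show ?thesis by (simp add: d_def)
qed

context brownian
begin

section \<open>Transfer of almost sure statements from events determined by
  \<open>B T\<close>\<close>

lemma inc_prob_pos:
  assumes "0 \<le> s" "0 < h" and [measurable]: "V \<in> sets borel" and "emeasure lborel V \<noteq> 0"
  shows "0 < prob (inc s h -` V \<inter> space P)"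
proof -
  have "emeasure P (inc s h -` V \<inter> space P) = (\<integral>\<^sup>+x. ennreal (normal_density 0 (sqrt h) x) * indicator V x \<partial>lborel)"
    by (rule distributed_emeasure[OF inc_distributed[OF assms(1,2)]]) simp
  also have "\<dots> \<noteq> 0"
    by (rule nn_integral_pos_lborel) (use assms in \<open>auto intro!: normal_density_pos\<close>)
  finally show ?thesis
    by (simp add: emeasure_eq_measure zero_less_measure_iff)
qed

text \<open>The increment after \<open>s\<close> is independent of \<open>F s\<close>, and its
  Gaussian law charges every set of positive Lebesgue measure; so the joint event can be negligible
  only if \<open>N\<close> is.\<close>

lemma null_if_inc_avoids:
  assumes s: "0 \<le> s" "0 < h" and V: "V \<in> sets borel" "emeasure lborel V \<noteq> 0"
    and N: "N \<in> sets (F s)" and ae: "AE \<omega> in P. \<not> (\<omega> \<in> N \<and> inc s h \<omega> \<in> V)"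
  shows "AE \<omega> in P. \<omega> \<notin> N"
proof -
  have inc: "inc s h \<in> borel_measurable P" using s by (intro inc_measurable) auto
  have NP: "N \<in> sets P" using N sets_F_subset by blast
  have ev: "inc s h -` V \<inter> space P \<in> sets P" using measurable_sets[OF inc V(1)] .
  have "AE \<omega> in P. \<omega> \<notin> N \<inter> (inc s h -` V \<inter> space P)"
    using ae by eventually_elim auto
  then have "prob (N \<inter> (inc s h -` V \<inter> space P)) = 0"
    using NP ev by (subst prob_eq_0) auto
  moreover have "prob (N \<inter> (inc s h -` V \<inter> space P)) = prob N * prob (inc s h -` V \<inter> space P)"
    by (rule indep_setD[OF F_indep_inc[OF s] N]) (use V in auto)
  ultimately have "prob N = 0" using inc_prob_pos[OF s V] by simp
  then show ?thesis using NP by (subst (asm) prob_eq_0) auto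
qed

text \<open>From any level above \<open>c - m\<close>, an increment larger than \<open>m\<close>
  lifts the path above \<open>c\<close> at time \<open>T\<close>. Increments between
  \<open>m\<close> and \<open>m + 1\<close> have positive probability whatever the past, so
  \<open>N\<close> cannot fail with positive probability where \<open>c - m < B t\<close>; letting
  \<open>m\<close> grow exhausts the space.\<close>

lemma AE_transfer_above:
  assumes t: "0 \<le> t" "t < T" and N: "N \<in> sets (F t)"
    and ae: "AE \<omega> in P. c < B T \<omega> \<longrightarrow> \<omega> \<in> N"
  shows "AE \<omega> in P. \<omega> \<in> N"
proof -
  have [measurable]: "B t \<in> borel_measurable (F t)" using t by (intro B_adapted) auto
  have [measurable]: "N \<in> sets (F t)" by fact
  let ?N = "\<lambda>m::nat. {\<omega> \<in> space (F t). \<omega> \<notin> N \<and> c - real m < B t \<omega>}"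
  have "AE \<omega> in P. \<omega> \<notin> ?N m" for m :: nat
  proof (rule null_if_inc_avoids[where h="T - t" and V="{real m<..<real m + 1}"])
    show "?N m \<in> sets (F t)" by measurable
    show "AE \<omega> in P. \<not> (\<omega> \<in> ?N m \<and> inc t (T - t) \<omega> \<in> {real m<..<real m + 1})"
      using ae by eventually_elim (auto simp: inc_def)
  qed (use t in auto)
  then have "AE \<omega> in P. \<forall>m. \<omega> \<notin> ?N m"
    by (intro iffD2[OF AE_all_countable] allI)
  with AE_space show ?thesis
  proof eventually_elim
    case (elim \<omega>)
    obtain m :: nat where "c - B t \<omega> < real m" using reals_Archimedean2 by blast
    then show ?case using elim by (auto dest!: spec[of _ m])
  qed
qed

text \<open>The mirror image: from any level below \<open>c + m\<close>, an increment between
  \<open>- m - 1\<close> and \<open>- m\<close> brings the path below \<open>c\<close> at time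
  \<open>T\<close>.\<close>

lemma AE_transfer_below:
  assumes t: "0 \<le> t" "t < T" and N: "N \<in> sets (F t)"
    and ae: "AE \<omega> in P. B T \<omega> \<le> c \<longrightarrow> \<omega> \<in> N"
  shows "AE \<omega> in P. \<omega> \<in> N"
proof -
  have [measurable]: "B t \<in> borel_measurable (F t)" using t by (intro B_adapted) auto
  have [measurable]: "N \<in> sets (F t)" by fact
  let ?N = "\<lambda>m::nat. {\<omega> \<in> space (F t). \<omega> \<notin> N \<and> B t \<omega> < c + real m}"
  have "AE \<omega> in P. \<omega> \<notin> ?N m" for m :: nat
  proof (rule null_if_inc_avoids[where h="T - t" and V="{- real m - 1<..<- real m}"])
    show "?N m \<in> sets (F t)" by measurable
    show "AE \<omega> in P. \<not> (\<omega> \<in> ?N m \<and> inc t (T - t) \<omega> \<in> {- real m - 1<..<- real m})"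
      using ae by eventually_elim (auto simp: inc_def)
  qed (use t in auto)
  then have "AE \<omega> in P. \<forall>m. \<omega> \<notin> ?N m"
    by (intro iffD2[OF AE_all_countable] allI)
  with AE_space show ?thesis
  proof eventually_elim
    case (elim \<omega>)
    obtain m :: nat where "B t \<omega> - c < real m" using reals_Archimedean2 by blast
    then show ?case using elim by (auto dest!: spec[of _ m])
  qed
qed

text \<open>The truncated square is at most \<open>\<eta>\<^sup>2\<close> plus the indicator of a
  deviation larger than \<open>\<eta>\<close>, so vanishing deviation probabilities force its mean
  to 0.\<close>

lemma forward_integral_tendsto_prob:
  assumes "has_forward_integral P B \<phi> t I"
  shows "tendsto_prob P (fwd \<phi> t) I"
proof -
  have \<phi>: "(\<lambda>(s, \<omega>). \<phi> s \<omega>) \<in> borel_measurable (leb t \<Otimes>\<^sub>M P)" and I[measurable]: "I \<in> borel_measurable P"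
    and lim: "\<And>\<eta>. 0 < \<eta> \<Longrightarrow> ((\<lambda>\<epsilon>. measure P {\<omega> \<in> space P.
          \<eta> < \<bar>(\<integral>s. \<phi> s \<omega> * ((B (s + \<epsilon>) \<omega> - B s \<omega>) / \<epsilon>) \<partial>leb t) - I \<omega>\<bar>}) \<longlongrightarrow> 0) (at_right 0)"
    using assms unfolding has_forward_integral_def by auto
  have f[measurable]: "fwd \<phi> t k \<in> borel_measurable P" for k by (rule fwd_measurable[OF \<phi>])
  let ?a = "\<lambda>k. \<integral>\<^sup>+ \<omega>. ennreal (min 1 ((fwd \<phi> t k \<omega> - I \<omega>)\<^sup>2)) \<partial>P"
  have bound: "?a k \<le> ennreal (\<eta>\<^sup>2 + prob {\<omega> \<in> space P. \<eta> < \<bar>fwd \<phi> t k \<omega> - I \<omega>\<bar>})" if "0 < \<eta>" for \<eta> k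
  proof -
    have "?a k \<le> (\<integral>\<^sup>+ \<omega>. ennreal (\<eta>\<^sup>2) + indicator {\<omega> \<in> space P. \<eta> < \<bar>fwd \<phi> t k \<omega> - I \<omega>\<bar>} \<omega> \<partial>P)"
    proof (rule nn_integral_mono)
      fix \<omega> assume w: "\<omega> \<in> space P"
      show "ennreal (min 1 ((fwd \<phi> t k \<omega> - I \<omega>)\<^sup>2)) \<le> ennreal (\<eta>\<^sup>2) + indicator {\<omega> \<in> space P. \<eta> < \<bar>fwd \<phi> t k \<omega> - I \<omega>\<bar>} \<omega>"
      proof (cases "\<eta> < \<bar>fwd \<phi> t k \<omega> - I \<omega>\<bar>")
        case True
        have "ennreal (min 1 ((fwd \<phi> t k \<omega> - I \<omega>)\<^sup>2)) \<le> 1"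
          by (simp add: ennreal_le_1)
        then show ?thesis using True w by (simp add: add_increasing)
      next
        case False
        then have "(fwd \<phi> t k \<omega> - I \<omega>)\<^sup>2 \<le> \<eta>\<^sup>2"
          using that by (simp add: abs_le_square_iff[symmetric])
        then show ?thesis using False by (auto intro!: ennreal_leI simp: min_le_iff_disj)
      qed
    qed
    also have "\<dots> = ennreal (\<eta>\<^sup>2) + emeasure P {\<omega> \<in> space P. \<eta> < \<bar>fwd \<phi> t k \<omega> - I \<omega>\<bar>}"
      by (subst nn_integral_add) (auto simp: emeasure_space_1)
    finally show ?thesis by (simp add: emeasure_eq_measure)
  qed
  have "?a \<longlonglongrightarrow> 0"
  proof (rule order_tendstoI)
    fix x :: ennreal assume "0 < x"
    then obtain z where z: "0 < z" "z < x" using dense by blast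
    define y where "y = enn2real z"
    have "z < top" using z(2) by (rule less_le_trans) simp
    then have y: "0 < ennreal y" "ennreal y < x"
      using z by (simp_all add: y_def)
    then have y0: "0 < y" by simp
    \<comment> \<open>With this choice the squared term and, eventually, the deviation probability
      each take at most half of \<open>y\<close>.\<close>
    define \<eta> where "\<eta> = sqrt (y / 2)"
    have \<eta>: "0 < \<eta>" "\<eta>\<^sup>2 = y / 2" using y0 by (auto simp: \<eta>_def)
    have "(\<lambda>k. prob {\<omega> \<in> space P. \<eta> < \<bar>fwd \<phi> t k \<omega> - I \<omega>\<bar>}) \<longlonglongrightarrow> 0"
      using filterlim_compose[OF lim[OF \<eta>(1)] filterlim_inverse_Suc_at_right]
      unfolding fwd_def inc_def .
    then have "\<forall>\<^sub>F k in sequentially. prob {\<omega> \<in> space P. \<eta> < \<bar>fwd \<phi> t k \<omega> - I \<omega>\<bar>} < y / 2"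
      using y0 by (intro order_tendstoD) auto
    then show "\<forall>\<^sub>F k in sequentially. ?a k < x"
    proof eventually_elim
      case (elim k)
      have "?a k \<le> ennreal (\<eta>\<^sup>2 + prob {\<omega> \<in> space P. \<eta> < \<bar>fwd \<phi> t k \<omega> - I \<omega>\<bar>})"
        by (rule bound[OF \<eta>(1)])
      also have "\<dots> \<le> ennreal y" using elim \<eta> by (intro ennreal_leI) auto
      finally show ?case using y by simp
    qed
  qed simp
  then show ?thesis unfolding tendsto_prob_def .
qed

section \<open>Averages of simple processes and of Ito integrands\<close>

lemma simple_integrand_bounds:
  assumes "simple_integrand P B t n p \<xi>"
  shows "i < n \<Longrightarrow> 0 \<le> p i" "i < n \<Longrightarrow> p i \<le> p (Suc i)" "i < n \<Longrightarrow> p (Suc i) \<le> t"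
proof -
  have p: "0 \<le> p 0" "\<And>i. i < n \<Longrightarrow> p i \<le> p (Suc i)" "p n \<le> t"
    using assms unfolding simple_integrand_def by auto
  show "i < n \<Longrightarrow> p i \<le> p (Suc i)" by (rule p(2))
  have "0 \<le> p i" if "i \<le> n" for i
    using that p(1,2) by (induction i) (auto intro: order_trans)
  then show "i < n \<Longrightarrow> 0 \<le> p i" by simp
  have "p i \<le> p n" if "i \<le> n" for i
    using that by (induction rule: inc_induct) (auto intro: order_trans p(2))
  then show "i < n \<Longrightarrow> p (Suc i) \<le> t" using p(3) by (meson Suc_leI order_trans)
qed

lemma simple_process_adapted:
  assumes "simple_integrand P B t n p \<xi>"
  shows "simple_process n p \<xi> s \<in> borel_measurable (F s)"
  unfolding simple_process_def[abs_def]
proof (rule borel_measurable_sum)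
  fix i assume "i \<in> {..<n}"
  then have \<xi>: "\<xi> i \<in> borel_measurable (F (p i))" using assms unfolding simple_integrand_def by auto
  show "(\<lambda>\<omega>. \<xi> i \<omega> * indicator {p i<..p (Suc i)} s) \<in> borel_measurable (F s)"
  proof (cases "p i < s")
    case True
    then have "\<xi> i \<in> borel_measurable (F s)" using measurable_F_mono[OF _ \<xi>] by simp
    then show ?thesis by simp
  qed simp
qed

lemma simple_process_joint:
  assumes "simple_integrand P B t n p \<xi>"
  shows "(\<lambda>(s, \<omega>). simple_process n p \<xi> s \<omega>) \<in> borel_measurable (leb t \<Otimes>\<^sub>M P)"
  unfolding simple_process_def split_beta'
proof (rule borel_measurable_sum)
  fix i assume "i \<in> {..<n}"
  then have "\<xi> i \<in> borel_measurable P" using assms measurable_F unfolding simple_integrand_def by auto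
  then have "(\<lambda>x. \<xi> i (snd x)) \<in> borel_measurable (leb t \<Otimes>\<^sub>M P)"
    by (rule measurable_compose[OF measurable_snd])
  moreover have "(\<lambda>x. indicator {p i<..p (Suc i)} (fst x) :: real) \<in> borel_measurable (leb t \<Otimes>\<^sub>M P)"
    by (rule measurable_compose[OF measurable_fst borel_measurable_leb]) simp
  ultimately show "(\<lambda>x. \<xi> i (snd x) * indicator {p i<..p (Suc i)} (fst x)) \<in> borel_measurable (leb t \<Otimes>\<^sub>M P)"
    by (rule borel_measurable_times)
qed

lemma integrable_mult_inc:
  assumes w: "\<omega> \<in> space P" and f: "integrable (leb t) f" and e: "0 < e"
  shows "integrable (leb t) (\<lambda>s. f s * (inc s e \<omega> / e))"
proof -
  have c: "continuous_on {0..t} (\<lambda>s. inc s e \<omega> / e)"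
    using e w by (intro continuous_intros inc_continuous) auto
  then have "bounded ((\<lambda>s. inc s e \<omega> / e) ` {0..t})"
    by (intro compact_imp_bounded compact_continuous_image) auto
  then obtain C where C: "\<forall>s\<in>{0..t}. \<bar>inc s e \<omega> / e\<bar> \<le> C"
    by (auto simp: bounded_iff)
  have m: "(\<lambda>s. inc s e \<omega> / e) \<in> borel_measurable (leb t)"
    using integrable_leb_continuous[OF c] by (rule borel_measurable_integrable)
  show ?thesis
  proof (rule Bochner_Integration.integrable_bound[OF integrable_mult_left[OF f, of C]])
    show "(\<lambda>s. f s * (inc s e \<omega> / e)) \<in> borel_measurable (leb t)"
      using f m by (intro borel_measurable_times) auto
    have "\<bar>f s\<bar> * \<bar>inc s e \<omega> / e\<bar> \<le> \<bar>f s\<bar> * \<bar>C\<bar>" if "s \<in> {0..t}" for s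
      using C that by (intro mult_left_mono) (auto intro: order_trans[OF _ abs_ge_self])
    then show "AE s in leb t. norm (f s * (inc s e \<omega> / e)) \<le> norm (f s * C)"
      by (intro AE_I2) (simp add: abs_mult)
  qed
qed

lemma simple_process_integrable: "integrable (leb t) (\<lambda>s. simple_process n p \<xi> s \<omega>)"
  unfolding simple_process_def
proof (rule Bochner_Integration.integrable_sum, rule integrable_mult_right)
  fix i
  interpret finite_measure "leb t" by (rule finite_measure_leb)
  show "integrable (leb t) (indicat_real {p i<..p (Suc i)})"
    by (rule integrable_const_bound[of _ 1]) (auto simp: indicator_def)
qed

text \<open>By linearity this is the convergence of averages on each partition interval. The
  half-open intervals of the simple process and the closed intervals of the averaging result differ
  by the left endpoint, a null set.\<close>

lemma fwd_simple_process:
  assumes si: "simple_integrand P B t n p \<xi>" and w: "\<omega> \<in> space P"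
  shows "(\<lambda>k. fwd (simple_process n p \<xi>) t k \<omega>) \<longlonglongrightarrow> simple_integral B n p \<xi> \<omega>"
proof -
  interpret finite_measure "leb t" by (rule finite_measure_leb)
  have eq: "fwd (simple_process n p \<xi>) t k \<omega> = (\<Sum>i<n. \<xi> i \<omega> * (LBINT s:{p i..p (Suc i)}. (B (s + 1 / real (Suc k)) \<omega> - B s \<omega>) / (1 / real (Suc k))))" for k
  proof -
    define e where "e = 1 / real (Suc k)"
    have e: "0 < e" by (simp add: e_def)
    have ind: "integrable (leb t) (indicat_real {p i<..p (Suc i)})" for i
      by (rule integrable_const_bound[of _ 1]) (auto simp: indicator_def)
    have int: "integrable (leb t) (\<lambda>s. indicat_real {p i<..p (Suc i)} s * (inc s e \<omega> / e))" for i
      by (rule integrable_mult_inc[OF w ind e])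
    have "fwd (simple_process n p \<xi>) t k \<omega> = (\<integral>s. (\<Sum>i<n. \<xi> i \<omega> * (indicat_real {p i<..p (Suc i)} s * (inc s e \<omega> / e))) \<partial>leb t)"
      unfolding fwd_def e_def[symmetric] simple_process_def by (simp only: sum_distrib_right mult.assoc)
    also have "\<dots> = (\<Sum>i<n. \<integral>s. \<xi> i \<omega> * (indicat_real {p i<..p (Suc i)} s * (inc s e \<omega> / e)) \<partial>leb t)"
      by (rule Bochner_Integration.integral_sum) (intro integrable_mult_right int)
    also have "\<dots> = (\<Sum>i<n. \<xi> i \<omega> * (LBINT s:{p i..p (Suc i)}. (B (s + e) \<omega> - B s \<omega>) / e))"
    proof (rule sum.cong)
      fix i assume "i \<in> {..<n}"
      then have i: "0 \<le> p i" "p i \<le> p (Suc i)" "p (Suc i) \<le> t" using simple_integrand_bounds[OF si] by auto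
      have "(\<integral>s. indicat_real {p i<..p (Suc i)} s * (inc s e \<omega> / e) \<partial>leb t) = (\<integral>s. indicat_real {p i<..p (Suc i)} s *\<^sub>R (inc s e \<omega> / e) \<partial>lborel)"
        unfolding lebesgue_integral_leb set_lebesgue_integral_def
        by (rule Bochner_Integration.integral_cong) (use i in \<open>auto simp: indicator_def\<close>)
      also have "\<dots> = (LBINT s:{p i..p (Suc i)}. (B (s + e) \<omega> - B s \<omega>) / e)"
        unfolding set_lebesgue_integral_def inc_def
      proof (rule integral_cong_AE)
        let ?b = "\<lambda>s. (B (s + e) \<omega> - B s \<omega>) / e"
        have c: "continuous_on {p i..p (Suc i)} ?b"
          using i e B_continuous[OF w]
          by (intro continuous_intros continuous_on_compose2[OF B_continuous[OF w]]) auto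
        have si: "set_integrable lborel {p i..p (Suc i)} ?b"
          by (rule borel_integrable_atLeastAtMost'[OF c])
        then show "(\<lambda>s. indicat_real {p i..p (Suc i)} s *\<^sub>R ?b s) \<in> borel_measurable lborel"
          unfolding set_integrable_def by (rule borel_measurable_integrable)
        have "set_integrable lborel {p i<..p (Suc i)} ?b"
          by (rule set_integrable_subset[OF si]) auto
        then show "(\<lambda>s. indicat_real {p i<..p (Suc i)} s *\<^sub>R ?b s) \<in> borel_measurable lborel"
          unfolding set_integrable_def by (rule borel_measurable_integrable)
        show "AE s in lborel. indicat_real {p i<..p (Suc i)} s *\<^sub>R ?b s = indicat_real {p i..p (Suc i)} s *\<^sub>R ?b s"
          using AE_lborel_singleton[of "p i"] by eventually_elim (auto simp: indicator_def)
      qed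
      finally show "(\<integral>s. \<xi> i \<omega> * (indicat_real {p i<..p (Suc i)} s * (inc s e \<omega> / e)) \<partial>leb t) = \<xi> i \<omega> * (LBINT s:{p i..p (Suc i)}. (B (s + e) \<omega> - B s \<omega>) / e)"
        by (simp only: integral_mult_right_zero)
    qed simp
    finally show ?thesis unfolding e_def .
  qed
  have "(\<lambda>k. LBINT s:{p i..p (Suc i)}. (B (s + 1 / real (Suc k)) \<omega> - B s \<omega>) / (1 / real (Suc k))) \<longlonglongrightarrow> B (p (Suc i)) \<omega> - B (p i) \<omega>"
    if "i < n" for i
    by (rule filterlim_compose[OF tendsto_average_difference[OF B_continuous[OF w]] filterlim_inverse_Suc_at_right])
       (use simple_integrand_bounds[OF si that] in auto)
  then show ?thesis
    unfolding eq simple_integral_def by (intro tendsto_sum tendsto_mult tendsto_const) auto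
qed

text \<open>A three-term estimate: the averages of \<open>u\<close> and of a simple approximation
  \<open>v j\<close> are close uniformly in the width by the second moment bound, the averages of
  \<open>v j\<close> tend to its simple integral, and the simple integrals tend to \<open>I\<close>.
  The width goes to 0 for fixed \<open>j\<close>, and only then does \<open>j\<close> grow.\<close>

lemma ito_integral_tendsto_prob:
  assumes t: "0 \<le> t" and ito: "has_ito_integral P B u t I"
  shows "tendsto_prob P (fwd u t) I"
proof -
  interpret L: finite_measure "leb t" by (rule finite_measure_leb)
  interpret LP: pair_sigma_finite "leb t" P ..
  have uad: "\<And>s. s \<in> {0..t} \<Longrightarrow> u s \<in> borel_measurable (F s)"
    and uj: "(\<lambda>(s, \<omega>). u s \<omega>) \<in> borel_measurable (leb t \<Otimes>\<^sub>M P)"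
    and u2: "integrable (leb t \<Otimes>\<^sub>M P) (\<lambda>x. (case x of (s, \<omega>) \<Rightarrow> u s \<omega>)\<^sup>2)"
    and I[measurable]: "I \<in> borel_measurable P"
    using ito unfolding has_ito_integral_def square_integrable_def by auto
  obtain n p \<xi> where si: "\<And>k. simple_integrand P B t (n k) (p k) (\<xi> k)"
    and l1: "tendsto_L2 (leb t \<Otimes>\<^sub>M P) (\<lambda>k (s, \<omega>). simple_process (n k) (p k) (\<xi> k) s \<omega>) (\<lambda>(s, \<omega>). u s \<omega>)"
    and l2: "tendsto_L2 P (\<lambda>k. simple_integral B (n k) (p k) (\<xi> k)) I"
    using ito unfolding has_ito_integral_def by blast
  define v where "v j = simple_process (n j) (p j) (\<xi> j)" for j
  define S where "S j = simple_integral B (n j) (p j) (\<xi> j)" for j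
  have vad: "v j s \<in> borel_measurable (F s)" for j s
    unfolding v_def by (rule simple_process_adapted[OF si])
  have vj: "(\<lambda>(s, \<omega>). v j s \<omega>) \<in> borel_measurable (leb t \<Otimes>\<^sub>M P)" for j
    unfolding v_def by (rule simple_process_joint[OF si])
  have dj: "(\<lambda>(s, \<omega>). u s \<omega> - v j s \<omega>) \<in> borel_measurable (leb t \<Otimes>\<^sub>M P)" for j
    using borel_measurable_diff[OF uj vj[of j]] by (simp add: split_beta')
  have fm[measurable]: "fwd u t k \<in> borel_measurable P" "fwd (v j) t k \<in> borel_measurable P"
    "fwd (\<lambda>s \<omega>. u s \<omega> - v j s \<omega>) t k \<in> borel_measurable P" for j k
    by (rule fwd_measurable[OF uj], rule fwd_measurable[OF vj], rule fwd_measurable[OF dj])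
  have vS: "(\<lambda>k. fwd (v j) t k \<omega>) \<longlonglongrightarrow> S j \<omega>" if "\<omega> \<in> space P" for j \<omega>
    unfolding v_def S_def by (rule fwd_simple_process[OF si that])
  have Sm[measurable]: "S j \<in> borel_measurable P" for j
    by (rule borel_measurable_LIMSEQ_real[OF vS]) auto
  \<comment> \<open>Additivity of the averages requires path integrals that exist. Square
    integrability on a finite product measure makes almost every path of \<open>u\<close>
    integrable.\<close>
  have uint: "AE \<omega> in P. integrable (leb t) (\<lambda>s. u s \<omega>)"
  proof -
    have "finite_measure (leb t \<Otimes>\<^sub>M P)"
      by (rule finite_measure_pair_measure) (unfold_locales)
    then interpret LPf: finite_measure "leb t \<Otimes>\<^sub>M P" .
    have "integrable (leb t \<Otimes>\<^sub>M P) (\<lambda>(s, \<omega>). u s \<omega>)"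
      by (rule LPf.square_integrable_imp_integrable[OF uj u2])
    then show ?thesis by (rule LP.AE_integrable_snd)
  qed
  define \<alpha> where "\<alpha> j = (\<integral>\<^sup>+x. ennreal (((case x of (s, \<omega>) \<Rightarrow> v j s \<omega>) - (case x of (s, \<omega>) \<Rightarrow> u s \<omega>))\<^sup>2) \<partial>(leb t \<Otimes>\<^sub>M P))" for j
  define \<gamma> where "\<gamma> j = (\<integral>\<^sup>+\<omega>. ennreal ((S j \<omega> - I \<omega>)\<^sup>2) \<partial>P)" for j
  define \<beta> where "\<beta> j k = (\<integral>\<^sup>+\<omega>. ennreal (min 1 ((fwd (v j) t k \<omega> - S j \<omega>)\<^sup>2)) \<partial>P)" for j k
  define a where "a k = (\<integral>\<^sup>+\<omega>. ennreal (min 1 ((fwd u t k \<omega> - I \<omega>)\<^sup>2)) \<partial>P)" for k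
  have \<alpha>: "\<alpha> \<longlonglongrightarrow> 0" using l1 unfolding tendsto_L2_def \<alpha>_def v_def .
  have \<gamma>: "\<gamma> \<longlonglongrightarrow> 0" using l2 unfolding tendsto_L2_def \<gamma>_def S_def .
  have \<beta>: "(\<lambda>k. \<beta> j k) \<longlonglongrightarrow> 0" for j
    using tendsto_prob_if_AE[OF finite_measure_axioms, of "fwd (v j) t" "S j"] vS
    unfolding tendsto_prob_def \<beta>_def by auto
  have fd: "(\<integral>\<^sup>+\<omega>. ennreal (min 1 ((fwd u t k \<omega> - fwd (v j) t k \<omega>)\<^sup>2)) \<partial>P) \<le> 2 * \<alpha> j" for j k
  proof -
    have "AE \<omega> in P. fwd u t k \<omega> - fwd (v j) t k \<omega> = fwd (\<lambda>s \<omega>. u s \<omega> - v j s \<omega>) t k \<omega>"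
      using uint AE_space
    proof eventually_elim
      case (elim \<omega>)
      let ?h = "\<lambda>s. inc s (1 / real (Suc k)) \<omega> / (1 / real (Suc k))"
      have "integrable (leb t) (\<lambda>s. u s \<omega> * ?h s)" "integrable (leb t) (\<lambda>s. v j s \<omega> * ?h s)"
        unfolding v_def by (intro integrable_mult_inc elim simple_process_integrable; simp)+
      from Bochner_Integration.integral_diff[OF this] show ?case
        unfolding fwd_def by (simp only: left_diff_distrib)
    qed
    then have "(\<integral>\<^sup>+\<omega>. ennreal (min 1 ((fwd u t k \<omega> - fwd (v j) t k \<omega>)\<^sup>2)) \<partial>P)
        \<le> (\<integral>\<^sup>+\<omega>. ennreal ((fwd (\<lambda>s \<omega>. u s \<omega> - v j s \<omega>) t k \<omega>)\<^sup>2) \<partial>P)"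
      by (intro nn_integral_mono_AE) (auto elim!: eventually_mono intro!: ennreal_leI)
    also have "\<dots> \<le> 2 * (\<integral>\<^sup>+s. (\<integral>\<^sup>+\<omega>. ennreal ((u s \<omega> - v j s \<omega>)\<^sup>2) \<partial>P) \<partial>leb t)"
      by (rule fwd_second_moment[OF dj _ t]) (intro borel_measurable_diff uad vad)
    also have "(\<integral>\<^sup>+s. (\<integral>\<^sup>+\<omega>. ennreal ((u s \<omega> - v j s \<omega>)\<^sup>2) \<partial>P) \<partial>leb t) = (\<integral>\<^sup>+x. ennreal ((u (fst x) (snd x) - v j (fst x) (snd x))\<^sup>2) \<partial>(leb t \<Otimes>\<^sub>M P))"
      using dj[of j] by (subst nn_integral_fst[symmetric]) (auto simp: split_beta')
    also have "\<dots> = \<alpha> j"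
      unfolding \<alpha>_def by (simp add: split_beta' power2_commute)
    finally show ?thesis by (simp add: mult_left_mono)
  qed
  \<comment> \<open>The constants 4 come from two uses of the truncated two-term inequality, each
    with factor 2, the \<open>\<alpha>\<close> term receiving its second factor from the second
    moment bound.\<close>
  have bound: "a k \<le> 4 * \<alpha> j + (4 * \<beta> j k + 4 * \<gamma> j)" for j k
  proof -
    have "a k = (\<integral>\<^sup>+\<omega>. ennreal (min 1 (((fwd u t k \<omega> - fwd (v j) t k \<omega>) + (fwd (v j) t k \<omega> - I \<omega>))\<^sup>2)) \<partial>P)"
      unfolding a_def by simp
    also have "\<dots> \<le> 2 * (\<integral>\<^sup>+\<omega>. ennreal (min 1 ((fwd u t k \<omega> - fwd (v j) t k \<omega>)\<^sup>2)) \<partial>P)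
        + 2 * (\<integral>\<^sup>+\<omega>. ennreal (min 1 ((fwd (v j) t k \<omega> - I \<omega>)\<^sup>2)) \<partial>P)"
      by (rule nn_integral_min_one_add_le) auto
    also have "(\<integral>\<^sup>+\<omega>. ennreal (min 1 ((fwd (v j) t k \<omega> - I \<omega>)\<^sup>2)) \<partial>P) = (\<integral>\<^sup>+\<omega>. ennreal (min 1 (((fwd (v j) t k \<omega> - S j \<omega>) + (S j \<omega> - I \<omega>))\<^sup>2)) \<partial>P)"
      by simp
    also have "\<dots> \<le> 2 * \<beta> j k + 2 * (\<integral>\<^sup>+\<omega>. ennreal (min 1 ((S j \<omega> - I \<omega>)\<^sup>2)) \<partial>P)"
      unfolding \<beta>_def by (rule nn_integral_min_one_add_le) auto
    also have "(\<integral>\<^sup>+\<omega>. ennreal (min 1 ((S j \<omega> - I \<omega>)\<^sup>2)) \<partial>P) \<le> \<gamma> j"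
      unfolding \<gamma>_def by (intro nn_integral_mono ennreal_leI) simp
    also have "(\<integral>\<^sup>+\<omega>. ennreal (min 1 ((fwd u t k \<omega> - fwd (v j) t k \<omega>)\<^sup>2)) \<partial>P) \<le> 2 * \<alpha> j" by (rule fd)
    finally have "a k \<le> 2 * (2 * \<alpha> j) + 2 * (2 * \<beta> j k + 2 * \<gamma> j)"
      by (blast intro: add_left_mono add_right_mono mult_left_mono zero_le)
    also have "\<dots> = 4 * \<alpha> j + (4 * \<beta> j k + 4 * \<gamma> j)"
      by (simp add: distrib_left mult.assoc[symmetric])
    finally show ?thesis .
  qed
  have "limsup a \<le> 4 * \<alpha> j + 4 * \<gamma> j" for j
  proof -
    have "limsup a \<le> limsup (\<lambda>k. 4 * \<alpha> j + (4 * \<beta> j k + 4 * \<gamma> j))"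
      by (intro Limsup_mono always_eventually allI bound)
    also have "(\<lambda>k. 4 * \<alpha> j + (4 * \<beta> j k + 4 * \<gamma> j)) \<longlonglongrightarrow> 4 * \<alpha> j + (4 * 0 + 4 * \<gamma> j)"
      by (intro tendsto_add tendsto_const ennreal_tendsto_cmult \<beta>) simp
    then have "limsup (\<lambda>k. 4 * \<alpha> j + (4 * \<beta> j k + 4 * \<gamma> j)) = 4 * \<alpha> j + 4 * \<gamma> j"
      by (intro lim_imp_Limsup) auto
    finally show ?thesis .
  qed
  moreover have "(\<lambda>j. 4 * \<alpha> j + 4 * \<gamma> j) \<longlonglongrightarrow> 4 * 0 + 4 * 0"
    by (intro tendsto_add ennreal_tendsto_cmult \<alpha> \<gamma>) simp_all
  ultimately have "limsup a \<le> 0"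
    by (intro LIMSEQ_le_const[where X="\<lambda>j. 4 * \<alpha> j + 4 * \<gamma> j"]) auto
  then have "a \<longlonglongrightarrow> 0"
    by (intro tendsto_0_if_Limsup_eq_0_ennreal) simp
  then show ?thesis unfolding tendsto_prob_def a_def .
qed

end

section \<open>Expected final wealth\<close>

context brownian
begin

text \<open>The uniqueness result with the whole space as \<open>A\<close>: the transfer is trivial,
  the solution is its own adapted version, and its Ito integrals are limits in probability of the
  averages.\<close>

lemma ito_solution_eq_gbm:
  assumes T: "0 < T" and X: "ito_solution P B \<mu> \<sigma> T X" and X0: "AE \<omega> in P. X 0 \<omega> = x0"
  shows "AE \<omega> in P. X T \<omega> = x0 * gbm \<mu> \<sigma> T \<omega>"
proof -
  have c: "AE \<omega> in P. continuous_on {0..T} (\<lambda>t. X t \<omega>)"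
    and eq: "\<And>t. t \<in> {0..T} \<Longrightarrow> \<exists>I. has_ito_integral P B X t I \<and>
      (AE \<omega> in P. X t \<omega> = X 0 \<omega> + \<mu> * (\<integral>s. X s \<omega> \<partial>leb t) + \<sigma> * I \<omega>)"
    using X unfolding ito_solution_def linear_equation_def by auto
  obtain I where I: "has_ito_integral P B X T I" using eq[of T] T by auto
  have "AE \<omega> in P. \<omega> \<in> space P \<longrightarrow> X T \<omega> = x0 * gbm \<mu> \<sigma> T \<omega>"
  proof (rule forward_unique[OF T])
    show "AE \<omega> in P. \<omega> \<in> N" if "AE \<omega> in P. \<omega> \<in> space P \<longrightarrow> \<omega> \<in> N" for N
      using that AE_space by eventually_elim auto
    show "(\<lambda>(s, \<omega>). X s \<omega>) \<in> borel_measurable (leb T \<Otimes>\<^sub>M P)"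
      using I unfolding has_ito_integral_def square_integrable_def by auto
    show "\<exists>g\<in>borel_measurable (F t). AE \<omega> in P. \<omega> \<in> space P \<longrightarrow> g \<omega> = X t \<omega>" if "t \<in> {0..T}" for t
      using I that unfolding has_ito_integral_def by (intro bexI[of _ "X t"]) auto
    show "\<exists>I\<in>borel_measurable P. tendsto_prob P (fwd X t) I \<and>
        (AE \<omega> in P. X t \<omega> = X 0 \<omega> + \<mu> * (\<integral>s. X s \<omega> \<partial>leb t) + \<sigma> * I \<omega>)" if t: "t \<in> {0..T}" for t
    proof -
      obtain J where J: "has_ito_integral P B X t J"
        and "AE \<omega> in P. X t \<omega> = X 0 \<omega> + \<mu> * (\<integral>s. X s \<omega> \<partial>leb t) + \<sigma> * J \<omega>"
        using eq[OF t] by blast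
      then show ?thesis
        using ito_integral_tendsto_prob[OF _ J] t
        by (intro bexI[of _ J]) (auto simp: has_ito_integral_def square_integrable_def)
    qed
  qed (use c X0 in auto)
  then show ?thesis by auto
qed

text \<open>Where \<open>\<xi>\<close> equals \<open>x\<close>, an event that prescribes
  \<open>\<xi> \<in> U\<close> is everything or nothing, according to whether
  \<open>x \<in> U\<close>. The enlargement therefore adds nothing to the trace on this level set, a
  property stable under complements and countable unions.\<close>

lemma enlarged_filtration_trace:
  assumes "G \<in> sets (enlarged_filtration P B \<xi> t)"
  shows "\<exists>V\<in>sets (F t). G \<inter> {\<omega> \<in> space P. \<xi> \<omega> = x} = V \<inter> {\<omega> \<in> space P. \<xi> \<omega> = x}"
proof -
  have "sets (F t) \<union> {\<xi> -` U \<inter> space P | U. U \<in> sets borel} \<subseteq> Pow (space P)"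
    using sets.space_closed[of "F t"] by auto
  then have "G \<in> sigma_sets (space P) (sets (F t) \<union> {\<xi> -` U \<inter> space P | U. U \<in> sets borel})"
    using assms unfolding enlarged_filtration_def by (simp add: sets_measure_of)
  then show ?thesis
  proof (induction rule: sigma_sets.induct)
    case (Basic a)
    then consider "a \<in> sets (F t)" | U where "a = \<xi> -` U \<inter> space P" by auto
    then show ?case
    proof cases
      case 2
      show ?thesis
      proof (cases "x \<in> U")
        case True
        then show ?thesis using 2 sets.top[of "F t"] by (intro bexI[of _ "space P"]) auto
      next
        case False
        then show ?thesis using 2 by (intro bexI[of _ "{}"]) auto
      qed
    qed auto
  next
    case (Compl a)
    then obtain V where V: "V \<in> sets (F t)" "a \<inter> {\<omega> \<in> space P. \<xi> \<omega> = x} = V \<inter> {\<omega> \<in> space P. \<xi> \<omega> = x}" by auto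
    have "space P - V \<in> sets (F t)" using sets.compl_sets[OF V(1)] by simp
    then show ?case using V(2) by (intro bexI[of _ "space P - V"]) auto
  next
    case (Union a)
    then obtain V where "\<And>i. V i \<in> sets (F t)" "\<And>i. a i \<inter> {\<omega> \<in> space P. \<xi> \<omega> = x} = V i \<inter> {\<omega> \<in> space P. \<xi> \<omega> = x}"
      by metis
    then show ?case by (intro bexI[of _ "\<Union>i. V i"]) auto
  qed auto
qed

text \<open>Where the initial value equals \<open>x0\<close>, the measurable extension from the
  trace supplies an adapted version of each \<open>X t\<close>. The transfer property
  \<open>tr\<close> stays a hypothesis because its proof depends on which event carries the value
  \<open>x0\<close>.\<close>

lemma forward_solution_eq_gbm:
  assumes T: "0 < T" and X: "forward_solution P B \<mu> \<sigma> T X"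
    and tr: "\<And>t N. 0 \<le> t \<Longrightarrow> t < T \<Longrightarrow> N \<in> sets (F t) \<Longrightarrow>
      AE \<omega> in P. X 0 \<omega> = x0 \<longrightarrow> \<omega> \<in> N \<Longrightarrow> AE \<omega> in P. \<omega> \<in> N"
  shows "AE \<omega> in P. X 0 \<omega> = x0 \<longrightarrow> X T \<omega> = x0 * gbm \<mu> \<sigma> T \<omega>"
proof -
  have c: "AE \<omega> in P. continuous_on {0..T} (\<lambda>t. X t \<omega>)"
    and ad: "\<And>t. t \<in> {0..T} \<Longrightarrow> X t \<in> borel_measurable (enlarged_filtration P B (X 0) t)"
    and eq: "\<And>t. t \<in> {0..T} \<Longrightarrow> \<exists>I. has_forward_integral P B X t I \<and>
      (AE \<omega> in P. X t \<omega> = X 0 \<omega> + \<mu> * (\<integral>s. X s \<omega> \<partial>leb t) + \<sigma> * I \<omega>)"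
    using X unfolding forward_solution_def linear_equation_def by auto
  let ?A = "{\<omega> \<in> space P. X 0 \<omega> = x0}"
  obtain I where I: "has_forward_integral P B X T I" using eq[of T] T by auto
  have "AE \<omega> in P. \<omega> \<in> ?A \<longrightarrow> X T \<omega> = x0 * gbm \<mu> \<sigma> T \<omega>"
  proof (rule forward_unique[OF T])
    fix t N assume t: "0 \<le> t" "t < T" "N \<in> sets (F t)" and ae: "AE \<omega> in P. \<omega> \<in> ?A \<longrightarrow> \<omega> \<in> N"
    have "AE \<omega> in P. X 0 \<omega> = x0 \<longrightarrow> \<omega> \<in> N" using ae AE_space by eventually_elim auto
    then show "AE \<omega> in P. \<omega> \<in> N" by (rule tr[OF t])
  next
    show "(\<lambda>(s, \<omega>). X s \<omega>) \<in> borel_measurable (leb T \<Otimes>\<^sub>M P)"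
      using I unfolding has_forward_integral_def by auto
    show "\<exists>g\<in>borel_measurable (F t). AE \<omega> in P. \<omega> \<in> ?A \<longrightarrow> g \<omega> = X t \<omega>" if t: "t \<in> {0..T}" for t
    proof -
      have sp: "space (enlarged_filtration P B (X 0) t) = space P"
        unfolding enlarged_filtration_def by (simp add: space_measure_of_conv)
      have "\<exists>g\<in>borel_measurable (F t). \<forall>\<omega>\<in>?A \<inter> space (F t). g \<omega> = X t \<omega>"
      proof (rule borel_measurable_trace_extension)
        fix U :: "real set" assume "U \<in> sets borel"
        then have "X t -` U \<inter> space P \<in> sets (enlarged_filtration P B (X 0) t)"
          using measurable_sets[OF ad[OF t]] sp by simp
        from enlarged_filtration_trace[OF this, of x0]
        show "\<exists>V\<in>sets (F t). X t -` U \<inter> ?A = V \<inter> ?A"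
          by (auto simp: Int_assoc Int_absorb1 cong: rev_conj_cong)
      qed
      then obtain g where "g \<in> borel_measurable (F t)" "\<forall>\<omega>\<in>?A \<inter> space (F t). g \<omega> = X t \<omega>" by blast
      then show ?thesis by (intro bexI[of _ g] AE_I2) auto
    qed
    show "\<exists>I\<in>borel_measurable P. tendsto_prob P (fwd X t) I \<and>
        (AE \<omega> in P. X t \<omega> = X 0 \<omega> + \<mu> * (\<integral>s. X s \<omega> \<partial>leb t) + \<sigma> * I \<omega>)" if t: "t \<in> {0..T}" for t
    proof -
      obtain J where J: "has_forward_integral P B X t J"
        and "AE \<omega> in P. X t \<omega> = X 0 \<omega> + \<mu> * (\<integral>s. X s \<omega> \<partial>leb t) + \<sigma> * J \<omega>"
        using eq[OF t] by blast
      then show ?thesis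
        using forward_integral_tendsto_prob[OF J]
        by (intro bexI[of _ J]) (auto simp: has_forward_integral_def)
    qed
  qed (use c in auto)
  then show ?thesis using AE_space by eventually_elim auto
qed

section \<open>Expectations of Skorokhod solutions\<close>

lemma malliavin_derivative_const:
  "has_malliavin_derivative P B T (\<lambda>_. 1) (\<lambda>_ _. 0)"
proof -
  \<comment> \<open>A function of no coordinates: with \<open>n = 0\<close> the only iterated
    derivative is the function itself, so the constant is a smooth functional whose derivative is an
    empty sum.\<close>
  have f: "(\<lambda>_. 1) \<in> smooth_poly_growth 0"
    unfolding smooth_poly_growth_def by (auto simp: Let_def intro!: exI[of _ 1])
  have "smooth_functional P B T (\<lambda>_. 1) (\<lambda>_ _. 0)"
    unfolding smooth_functional_def
    by (rule exI[of _ 0], rule exI[of _ "\<lambda>_. 1"]) (use f in auto)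
  moreover have "tendsto_L2 P (\<lambda>k _. 1) (\<lambda>_. 1)"
    "tendsto_L2 (leb T \<Otimes>\<^sub>M P) (\<lambda>k (s, \<omega>). 0) (\<lambda>(s, \<omega>). 0)"
    by (simp_all add: tendsto_L2_def split_beta')
  ultimately show ?thesis
    unfolding has_malliavin_derivative_def square_integrable_def
    by (intro conjI exI[of _ "\<lambda>_ _. 1"] exI[of _ "\<lambda>_ _ _. 0"]) (auto simp: split_beta')
qed

lemma skorokhod_integral_expectation:
  assumes "has_skorokhod_integral P B T u I"
  shows "integrable P I" "expectation I = 0"
proof -
  have I: "square_integrable P I" and d: "\<And>F DF. has_malliavin_derivative P B T F DF \<Longrightarrow>
        (\<integral>\<omega>. F \<omega> * I \<omega> \<partial>P) = (\<integral>\<omega>. (\<integral>s. DF s \<omega> * u s \<omega> \<partial>leb T) \<partial>P)"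
    using assms unfolding has_skorokhod_integral_def by auto
  show "integrable P I"
    by (rule square_integrable_imp_integrable) (use I in \<open>simp_all add: square_integrable_def\<close>)
  show "expectation I = 0"
    using d[OF malliavin_derivative_const] by simp
qed

text \<open>The integrand over the full horizon is jointly measurable as part of the notion of
  Skorokhod integral; its section at time \<open>t\<close> is \<open>X t\<close>.\<close>

lemma skorokhod_solution_measurable:
  assumes X: "skorokhod_solution P B \<mu> \<sigma> T X" and t: "t \<in> {0..T}"
  shows "X t \<in> borel_measurable P"
proof -
  obtain I where "has_skorokhod_integral P B T (\<lambda>s \<omega>. indicator {0..T} s * X s \<omega>) I"
    using X t unfolding skorokhod_solution_def linear_equation_def by (meson atLeastAtMost_iff order_refl order_trans)
  then have "(\<lambda>(s, \<omega>). indicator {0..T} s * X s \<omega>) \<in> borel_measurable (leb T \<Otimes>\<^sub>M F T)"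
    unfolding has_skorokhod_integral_def by auto
  from measurable_compose[OF measurable_Pair1'[of t "leb T" "F T"] this] t
  have "X t \<in> borel_measurable (F T)" by simp
  then show ?thesis by (rule measurable_F)
qed

text \<open>Testing the duality with the constant functional \<open>1\<close> shows that the Skorokhod integral has
  mean zero, so the expectation solves a deterministic linear equation.\<close>

lemma skorokhod_solution_expectation:
  assumes T: "0 < T" and \<mu>: "0 \<le> \<mu>" and X: "skorokhod_solution P B \<mu> \<sigma> T X" and X0: "integrable P (X 0)"
  shows "integrable P (X T)" "expectation (X T) = expectation (X 0) * exp (\<mu> * T)"
proof -
  interpret L: finite_measure "leb T" by (rule finite_measure_leb)
  interpret LP: pair_sigma_finite "leb T" P ..
  have "finite_measure (leb T \<Otimes>\<^sub>M P)"
    by (rule finite_measure_pair_measure) unfold_locales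
  then interpret LPf: finite_measure "leb T \<Otimes>\<^sub>M P" .
  have ex: "\<exists>I. has_skorokhod_integral P B T (\<lambda>s \<omega>. indicator {0..t} s * X s \<omega>) I \<and>
      (AE \<omega> in P. X t \<omega> = X 0 \<omega> + \<mu> * (\<integral>s. X s \<omega> \<partial>leb t) + \<sigma> * I \<omega>)" if "t \<in> {0..T}" for t
    using X that unfolding skorokhod_solution_def linear_equation_def by auto
  define m where "m t = expectation (X t)" for t
  have Xp: "integrable (leb T \<Otimes>\<^sub>M P) (\<lambda>(s, \<omega>). indicator {0..t} s * X s \<omega>)" if t: "t \<in> {0..T}" for t
  proof -
    obtain I where "has_skorokhod_integral P B T (\<lambda>s \<omega>. indicator {0..t} s * X s \<omega>) I" using ex[OF t] by blast
    then have "square_integrable (leb T \<Otimes>\<^sub>M P) (\<lambda>(s, \<omega>). indicator {0..t} s * X s \<omega>)"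
      unfolding has_skorokhod_integral_def by auto
    then show ?thesis
      unfolding square_integrable_def using LPf.square_integrable_imp_integrable by blast
  qed
  have step: "integrable P (X t) \<and> m t = m 0 + \<mu> * (\<integral>s. m s \<partial>leb t)" if t: "t \<in> {0..T}" for t
  proof -
    obtain I where I: "has_skorokhod_integral P B T (\<lambda>s \<omega>. indicator {0..t} s * X s \<omega>) I"
      and eq: "AE \<omega> in P. X t \<omega> = X 0 \<omega> + \<mu> * (\<integral>s. X s \<omega> \<partial>leb t) + \<sigma> * I \<omega>"
      using ex[OF t] by blast
    note II = skorokhod_integral_expectation[OF I]
    have ind: "(\<integral>s. indicator {0..t} s * X s \<omega> \<partial>leb T) = (\<integral>s. X s \<omega> \<partial>leb t)" for \<omega>
      using t by (intro integral_leb_indicator) simp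
    have i1: "integrable P (\<lambda>\<omega>. \<integral>s. X s \<omega> \<partial>leb t)"
      using LP.integrable_snd[OF Xp[OF t]] unfolding ind .
    \<comment> \<open>Fubini is applied to the integrand cut off at \<open>t\<close>, since this is
      the process whose square integrability over \<open>{0..T}\<close> the Skorokhod integral
      provides.\<close>
    have e1: "expectation (\<lambda>\<omega>. \<integral>s. X s \<omega> \<partial>leb t) = (\<integral>s. m s \<partial>leb t)"
    proof -
      have "expectation (\<lambda>\<omega>. \<integral>s. X s \<omega> \<partial>leb t) = (\<integral>s. expectation (\<lambda>\<omega>. indicator {0..t} s * X s \<omega>) \<partial>leb T)"
        unfolding ind[symmetric] by (rule LP.Fubini_integral) (use Xp[OF t] in simp)
      also have "\<dots> = (\<integral>s. indicator {0..t} s * m s \<partial>leb T)"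
        unfolding m_def by simp
      also have "\<dots> = (\<integral>s. m s \<partial>leb t)"
        using t by (intro integral_leb_indicator) simp
      finally show ?thesis .
    qed
    have i2: "integrable P (\<lambda>\<omega>. X 0 \<omega> + \<mu> * (\<integral>s. X s \<omega> \<partial>leb t) + \<sigma> * I \<omega>)"
      using X0 i1 II by simp
    have "integrable P (X t)"
      by (rule integrable_cong_AE_imp[OF i2 skorokhod_solution_measurable[OF X t]]) (use eq in auto)
    moreover have "m t = expectation (\<lambda>\<omega>. X 0 \<omega> + \<mu> * (\<integral>s. X s \<omega> \<partial>leb t) + \<sigma> * I \<omega>)"
      unfolding m_def using skorokhod_solution_measurable[OF X t] borel_measurable_integrable[OF i2] eq
      by (rule integral_cong_AE)
    moreover have "\<dots> = m 0 + \<mu> * (\<integral>s. m s \<partial>leb t)"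
      using X0 i1 II e1 by (simp add: m_def)
    ultimately show ?thesis by simp
  qed
  show "integrable P (X T)" using step[of T] T by simp
  \<comment> \<open>Skorokhod solutions carry no assumption of path continuity; the integrability of
    the mean in time comes from integrability on the product space.\<close>
  have "integrable (leb T) (\<lambda>s. indicator {0..T} s * m s)"
    using LP.integrable_fst[OF Xp[of T]] T unfolding m_def by simp
  then have mi: "integrable (leb T) m"
    by (rule Bochner_Integration.integrable_cong[THEN iffD1, rotated 2]) auto
  have "m T = m 0 * exp (\<mu> * T)"
  proof (rule gronwall_exp[OF _ \<mu> mi])
    show "m t = m 0 + \<mu> * (\<integral>s. m s \<partial>leb t)" if "t \<in> {0..T}" for t
      using step[OF that] by blast
  qed (use T in simp)
  then show "expectation (X T) = expectation (X 0) * exp (\<mu> * T)" unfolding m_def .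
qed

lemma bond_solution_eq:
  assumes T: "0 < T" and X: "bond_solution P \<rho> T X"
  shows "AE \<omega> in P. X T \<omega> = X 0 \<omega> * exp (\<rho> * T)"
proof -
  have "AE \<omega> in P. \<forall>t\<in>{0..T}. ((\<lambda>s. X s \<omega>) has_real_derivative \<rho> * X t \<omega>) (at t within {0..T})"
    using X unfolding bond_solution_def by auto
  then show ?thesis
    by eventually_elim (rule exp_ode_unique, use T in auto)
qed

end

section \<open>Comparison of the three expectations\<close>

theorem theorem3p1:
  fixes P :: "'a measure" and B :: "real \<Rightarrow> 'a \<Rightarrow> real"
    and M \<rho> \<mu> \<sigma> T :: real
    and barS0 :: "real \<Rightarrow> real"
    and barS1 S0_i S1_i S0_sk S1_sk S0_rs S1_rs :: "real \<Rightarrow> 'a \<Rightarrow> real"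
    and S_i S_sk S_rs :: "real \<Rightarrow> 'a \<Rightarrow> real"
  assumes "0 < M" "0 < \<rho>" "0 < \<mu>" "0 < \<sigma>" "0 < T" "\<rho> < \<mu>"
    and "prob_space P" "brownian_motion P B"
    and barS0: "\<forall>t\<in>{0..T}. (barS0 has_real_derivative \<rho> * barS0 t) (at t within {0..T})" "barS0 0 = 1"
    and barS1: "ito_solution P B \<mu> \<sigma> T barS1" "AE \<omega> in P. barS1 0 \<omega> = 1"
    and i0: "bond_solution P \<rho> T S0_i" "AE \<omega> in P. S0_i 0 \<omega> = 0"
    and i1: "ito_solution P B \<mu> \<sigma> T S1_i" "AE \<omega> in P. S1_i 0 \<omega> = M"
    and sk0: "bond_solution P \<rho> T S0_sk"
      "AE \<omega> in P. S0_sk 0 \<omega> = M * indicator {\<omega>. barS1 T \<omega> \<le> barS0 T} \<omega>"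
    and sk1: "skorokhod_solution P B \<mu> \<sigma> T S1_sk"
      "AE \<omega> in P. S1_sk 0 \<omega> = M * indicator {\<omega>. barS1 T \<omega> > barS0 T} \<omega>"
    and rs0: "bond_solution P \<rho> T S0_rs"
      "AE \<omega> in P. S0_rs 0 \<omega> = M * indicator {\<omega>. barS1 T \<omega> \<le> barS0 T} \<omega>"
    and rs1: "forward_solution P B \<mu> \<sigma> T S1_rs"
      "AE \<omega> in P. S1_rs 0 \<omega> = M * indicator {\<omega>. barS1 T \<omega> > barS0 T} \<omega>"
    and wealth_i: "\<forall>t\<in>{0..T}. \<forall>\<omega>\<in>space P. S_i t \<omega> = S0_i t \<omega> + S1_i t \<omega>"
    and wealth_sk: "\<forall>t\<in>{0..T}. \<forall>\<omega>\<in>space P. S_sk t \<omega> = S0_sk t \<omega> + S1_sk t \<omega>"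
    and wealth_rs: "\<forall>t\<in>{0..T}. \<forall>\<omega>\<in>space P. S_rs t \<omega> = S0_rs t \<omega> + S1_rs t \<omega>"
  shows "prob_space.expectation P (S_sk T) < prob_space.expectation P (S_i T) \<and>
         prob_space.expectation P (S_i T) < prob_space.expectation P (S_rs T)"
proof -
  interpret brownian P B
    by (rule brownian.intro) (use assms in \<open>auto intro: brownian_axioms.intro\<close>)
  note pos = \<open>0 < M\<close> \<open>0 < \<rho>\<close> \<open>0 < \<mu>\<close> \<open>0 < \<sigma>\<close> \<open>0 < T\<close> \<open>\<rho> < \<mu>\<close>
  have T: "0 \<le> T" "T \<in> {0..T}" "0 \<in> {0..T}" using pos by auto
  define Z where "Z = gbm \<mu> \<sigma> T"
  \<comment> \<open>The level of \<open>B T\<close> at which stock and bond are equal: dividing by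
    the positive \<open>\<sigma>\<close> shows that \<open>Z\<close> exceeds
    \<open>exp (\<rho> * T)\<close> exactly when \<open>B T\<close> exceeds
    \<open>c\<close>.\<close>
  define c where "c = (\<rho> * T - (\<mu> - \<sigma>\<^sup>2 / 2) * T) / \<sigma>"
  define H where "H = {\<omega> \<in> space P. c < B T \<omega>}"
  have BT[measurable]: "B T \<in> borel_measurable P" by (rule B_measurable[OF T(1)])
  have H[measurable]: "H \<in> sets P" unfolding H_def by measurable
  have Zm[measurable]: "Z \<in> borel_measurable P" unfolding Z_def by (rule gbm_measurable[OF T(1)])
  have Zi: "integrable P Z" "expectation Z = exp (\<mu> * T)"
    using gbm_expectation[OF T(1), of \<mu> \<sigma>] by (auto simp: Z_def has_bochner_integral_iff)
  have S0: "barS0 T = exp (\<rho> * T)"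
    using exp_ode_unique[OF T(1), of barS0 \<rho>] barS0 by simp
  have Zlog: "exp (\<rho> * T) < Z \<omega> \<longleftrightarrow> c < B T \<omega>" for \<omega>
    unfolding Z_def gbm_def c_def using pos(4) by (simp add: pos_divide_less_eq algebra_simps)
  have "AE \<omega> in P. barS1 T \<omega> = 1 * gbm \<mu> \<sigma> T \<omega>"
    by (rule ito_solution_eq_gbm[OF pos(5) barS1])
  then have win: "AE \<omega> in P. (barS0 T < barS1 T \<omega> \<longleftrightarrow> \<omega> \<in> H) \<and> (barS1 T \<omega> \<le> barS0 T \<longleftrightarrow> \<omega> \<notin> H)"
    using AE_space
  proof eventually_elim
    case (elim \<omega>)
    then show ?case using Zlog[of \<omega>] by (auto simp: H_def S0 Z_def)
  qed
  \<comment> \<open>The Gaussian variable \<open>B T\<close> charges the interval just below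
    \<open>c\<close>, where the bond wins.\<close>
  have lose_pos: "0 < prob (space P - H)"
  proof -
    have "0 < prob (inc 0 T -` {c - 1<..<c} \<inter> space P)"
      by (rule inc_prob_pos) (use pos in auto)
    also have "\<dots> \<le> prob (space P - H)"
      by (rule finite_measure_mono) (auto simp: inc_def B_zero H_def)
    finally show ?thesis .
  qed
  have bond: "S T \<in> borel_measurable P" if "bond_solution P \<rho> T S" for S
    using that T unfolding bond_solution_def by auto
  have bond0: "AE \<omega> in P. S T \<omega> = M * exp (\<rho> * T) * indicator (space P - H) \<omega>"
    if "bond_solution P \<rho> T S" "AE \<omega> in P. S 0 \<omega> = M * indicator {\<omega>. barS1 T \<omega> \<le> barS0 T} \<omega>" for S
    using bond_solution_eq[OF pos(5) that(1)] that(2) win AE_space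
    by eventually_elim (auto simp: indicator_def)

  have Ei: "expectation (S_i T) = M * exp (\<mu> * T)"
  proof -
    have "AE \<omega> in P. S1_i T \<omega> = M * Z \<omega>"
      unfolding Z_def by (rule ito_solution_eq_gbm[OF pos(5) i1])
    then have "AE \<omega> in P. S0_i T \<omega> + S1_i T \<omega> = M * Z \<omega>"
      using bond_solution_eq[OF pos(5) i0(1)] i0(2) by eventually_elim auto
    moreover have "S1_i T \<in> borel_measurable P"
    proof -
      obtain I where "has_ito_integral P B S1_i T I"
        using i1(1) T unfolding ito_solution_def linear_equation_def by blast
      then have "S1_i T \<in> borel_measurable (F T)" using T unfolding has_ito_integral_def by auto
      then show ?thesis by (rule measurable_F)
    qed
    ultimately have "expectation (\<lambda>\<omega>. S0_i T \<omega> + S1_i T \<omega>) = expectation (\<lambda>\<omega>. M * Z \<omega>)"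
      using bond[OF i0(1)] by (intro integral_cong_AE) auto
    moreover have "expectation (S_i T) = expectation (\<lambda>\<omega>. S0_i T \<omega> + S1_i T \<omega>)"
      by (rule Bochner_Integration.integral_cong) (use wealth_i T in auto)
    ultimately show ?thesis using Zi by simp
  qed

  \<comment> \<open>The stock part depends on \<open>H\<close> only through its probability: the
    mean grows from \<open>M * prob H\<close> by the factor \<open>exp (\<mu> * T)\<close>, whatever
    the dependence between \<open>H\<close> and \<open>Z\<close>. This is how the insider's
    information is lost.\<close>
  have Esk: "expectation (S_sk T) = M * exp (\<rho> * T) * prob (space P - H) + M * exp (\<mu> * T) * prob H"
  proof -
    have m0: "S1_sk 0 \<in> borel_measurable P" by (rule skorokhod_solution_measurable[OF sk1(1) T(3)])
    have ae: "AE \<omega> in P. S1_sk 0 \<omega> = M * indicator H \<omega>"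
      using sk1(2) win by eventually_elim (auto simp: indicator_def)
    have i: "integrable P (\<lambda>\<omega>. M * indicat_real H \<omega>)"
      by (intro integrable_mult_right integrable_real_indicator) (auto simp: emeasure_eq_measure)
    have i0: "integrable P (S1_sk 0)"
      by (rule integrable_cong_AE_imp[OF i m0]) (use ae in auto)
    have e0: "expectation (S1_sk 0) = M * prob H"
    proof -
      have "expectation (S1_sk 0) = expectation (\<lambda>\<omega>. M * indicat_real H \<omega>)"
        by (rule integral_cong_AE[OF m0 _ ae]) simp
      then show ?thesis by simp
    qed
    note E1 = skorokhod_solution_expectation[OF pos(5) _ sk1(1) i0]
    have iH: "integrable P (\<lambda>\<omega>. M * exp (\<rho> * T) * indicat_real (space P - H) \<omega>)"
      by (intro integrable_mult_right integrable_real_indicator) (auto simp: emeasure_eq_measure)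
    have iS0: "integrable P (S0_sk T)"
      by (rule integrable_cong_AE_imp[OF iH bond[OF sk0(1)]]) (use bond0[OF sk0] in auto)
    have "expectation (S0_sk T) = expectation (\<lambda>\<omega>. M * exp (\<rho> * T) * indicat_real (space P - H) \<omega>)"
      by (rule integral_cong_AE[OF bond[OF sk0(1)] _ bond0[OF sk0]]) simp
    then have "expectation (S0_sk T) = M * exp (\<rho> * T) * prob (space P - H)" by simp
    moreover have "expectation (S_sk T) = expectation (\<lambda>\<omega>. S0_sk T \<omega> + S1_sk T \<omega>)"
      by (rule Bochner_Integration.integral_cong) (use wealth_sk T in auto)
    ultimately show ?thesis using iS0 E1 e0 pos by simp
  qed

  let ?W = "\<lambda>\<omega>. M * exp (\<rho> * T) * indicator (space P - H) \<omega> + M * indicator H \<omega> * Z \<omega>"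
  have Ers: "expectation (S_rs T) = expectation ?W"
  proof -
    have ae0: "AE \<omega> in P. S1_rs 0 \<omega> = M * indicator H \<omega>"
      using rs1(2) win by eventually_elim (auto simp: indicator_def)
    \<comment> \<open>The two initial values are treated separately. Up to null sets the value
      \<open>M\<close> is taken where \<open>c < B T\<close>, so the transfer from above applies;
      the value 0 is taken on the complement and uses the transfer from below.\<close>
    have "AE \<omega> in P. S1_rs 0 \<omega> = M \<longrightarrow> S1_rs T \<omega> = M * gbm \<mu> \<sigma> T \<omega>"
    proof (rule forward_solution_eq_gbm[OF pos(5) rs1(1)])
      fix t N assume t: "0 \<le> t" "t < T" "N \<in> sets (F t)" and ae: "AE \<omega> in P. S1_rs 0 \<omega> = M \<longrightarrow> \<omega> \<in> N"
      show "AE \<omega> in P. \<omega> \<in> N"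
      proof (rule AE_transfer_above[OF t])
        show "AE \<omega> in P. c < B T \<omega> \<longrightarrow> \<omega> \<in> N"
          using ae ae0 AE_space by eventually_elim (auto simp: H_def indicator_def)
      qed
    qed
    moreover have "AE \<omega> in P. S1_rs 0 \<omega> = 0 \<longrightarrow> S1_rs T \<omega> = 0 * gbm \<mu> \<sigma> T \<omega>"
    proof (rule forward_solution_eq_gbm[OF pos(5) rs1(1)])
      fix t N assume t: "0 \<le> t" "t < T" "N \<in> sets (F t)" and ae: "AE \<omega> in P. S1_rs 0 \<omega> = 0 \<longrightarrow> \<omega> \<in> N"
      show "AE \<omega> in P. \<omega> \<in> N"
      proof (rule AE_transfer_below[OF t])
        show "AE \<omega> in P. B T \<omega> \<le> c \<longrightarrow> \<omega> \<in> N"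
          using ae ae0 AE_space by eventually_elim (auto simp: H_def indicator_def)
      qed
    qed
    ultimately have ae: "AE \<omega> in P. S0_rs T \<omega> + S1_rs T \<omega> = ?W \<omega>"
      using ae0 bond0[OF rs0] by eventually_elim (auto simp: indicator_def Z_def split: if_splits)
    have "S1_rs T \<in> borel_measurable P"
    proof -
      obtain I where "has_forward_integral P B S1_rs T I"
        using rs1(1) T unfolding forward_solution_def linear_equation_def by blast
      then have "(\<lambda>(s, \<omega>). S1_rs s \<omega>) \<in> borel_measurable (leb T \<Otimes>\<^sub>M P)" unfolding has_forward_integral_def by auto
      from measurable_compose[OF measurable_Pair1'[of T "leb T" P] this] T show ?thesis by simp
    qed
    then have "expectation (\<lambda>\<omega>. S0_rs T \<omega> + S1_rs T \<omega>) = expectation ?W"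
      using bond[OF rs0(1)] ae by (intro integral_cong_AE) auto
    moreover have "expectation (S_rs T) = expectation (\<lambda>\<omega>. S0_rs T \<omega> + S1_rs T \<omega>)"
      by (rule Bochner_Integration.integral_cong) (use wealth_rs T in auto)
    ultimately show ?thesis by simp
  qed

  have "expectation (S_sk T) < M * exp (\<mu> * T)"
  proof -
    define q where "q = prob (space P - H)"
    \<comment> \<open>The gap is exactly
      \<open>M * q * (exp (\<mu> * T) - exp (\<rho> * T))\<close>, where \<open>q\<close> is the
      probability that the bond wins.\<close>
    have "M * exp (\<rho> * T) * q < M * exp (\<mu> * T) * q"
      using pos lose_pos unfolding q_def by (intro mult_strict_right_mono mult_strict_left_mono) auto
    moreover have pH: "prob H = 1 - q" unfolding q_def by (simp add: prob_compl[OF H])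
    ultimately show ?thesis unfolding Esk q_def[symmetric] pH by (simp add: algebra_simps)
  qed
  \<comment> \<open>The two wealths agree on \<open>H\<close>, and off \<open>H\<close> the bond is
    worth at least as much as the stock. On paths ending strictly between \<open>c - 1\<close> and
    \<open>c\<close> the advantage is strict, the tie at \<open>c\<close> being excluded, and this
    event has positive probability.\<close>
  moreover have "expectation (\<lambda>\<omega>. M * Z \<omega>) < expectation ?W"
  proof (rule integral_less_AE)
    let ?A = "inc 0 T -` {c - 1<..<c} \<inter> space P"
    show "integrable P (\<lambda>\<omega>. M * Z \<omega>)" using Zi by simp
    have "integrable P (\<lambda>\<omega>. indicator H \<omega> *\<^sub>R Z \<omega>)"
      by (rule integrable_mult_indicator[OF H Zi(1)])
    moreover have "integrable P (\<lambda>\<omega>. M * exp (\<rho> * T) * indicat_real (space P - H) \<omega>)"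
      by (intro integrable_mult_right integrable_real_indicator) (auto simp: emeasure_eq_measure)
    ultimately show "integrable P ?W"
      by (simp add: mult.assoc)
    have Zle: "Z \<omega> \<le> exp (\<rho> * T)" if "\<omega> \<in> space P" "\<omega> \<notin> H" for \<omega>
      using Zlog[of \<omega>] that by (auto simp: H_def)
    show "AE \<omega> in P. M * Z \<omega> \<le> ?W \<omega>"
      using Zle pos(1) by (intro AE_I2) (auto simp: indicator_def)
    show A: "?A \<in> sets P"
      using inc_measurable[of 0 T] T by (intro measurable_sets[of _ P borel]) auto
    have "0 < prob ?A"
      by (rule inc_prob_pos) (use pos in auto)
    then show "emeasure P ?A \<noteq> 0"
      by (simp add: emeasure_eq_measure)
    have "Z \<omega> < exp (\<rho> * T)" if "\<omega> \<in> ?A" for \<omega>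
    proof -
      have "B T \<omega> < c" using that by (auto simp: inc_def B_zero)
      then show ?thesis
        unfolding Z_def gbm_def c_def using pos(4) by (simp add: pos_less_divide_eq algebra_simps)
    qed
    moreover have "\<omega> \<notin> H" if "\<omega> \<in> ?A" for \<omega> using that by (auto simp: inc_def B_zero H_def)
    ultimately show "AE \<omega> in P. \<omega> \<in> ?A \<longrightarrow> M * Z \<omega> \<noteq> ?W \<omega>"
      using pos(1) by (intro AE_I2) (fastforce simp: indicator_def)
  qed
  ultimately show ?thesis unfolding Ei Ers using Zi by simp
qed

end
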